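(* Let $n\ge2$ and let $G_{\mathbb{R}\mathrm{H}^n}$ be the connected and simply-connected Lie group whose Lie algebra $\mathfrak g$ has a basis $\{e_1,\dots,e_n\}$ with $[e_1,e_i]=e_i$ ($i=2,\dots,n$) and all other brackets of basis elements trivial. Let $\{x_1,\dots,x_n\}$ be the dual basis and $g$ the left-invariant Riemannian metric for which $\{e_1,\dots,e_n\}$ is orthonormal. For $\alpha\in\mathbb{R}$ put $$C^\alpha:=\alpha\Big(4x_1^3+6\sum_{i=2}^nx_1x_i^2\Big)\in S^3(\mathfrak g^* )\cong\mathrm{Homog}_3(x_1,\dots,x_n).$$ Then $$\nabla^gC^\alpha=-6\alpha\Big(\sum_{i\ge2}x_i^2\Big)^2\in S^4(\mathfrak g^* ),$$ $$R^{C^\alpha}_g=(1-\alpha^2)R^0_g=(1-\alpha^2)\sum_{1\le i<j\le n}\omega_{ij}\odot\omega_{ij},$$ $$S^3_{\mathrm{CS}}(\mathfrak g^*,g)=\{C^\alpha\mid\alpha\in\mathbb{R}\},\qquad S^3_{\mathrm{DF}}(\mathfrak g^*,g)=\{C^1,C^{-1}\}.$$ Furthermore (with $\cong$ meaning homeomorphic), $$\mathcal{ML}\mathrm{Stat}(G_{\mathbb{R}\mathrm{H}^n})\cong(SO(1)\times O(n-1))\backslash\mathrm{Homog}_3(x_1,\dots,x_n),$$ $$\mathcal{ML}\mathrm{Stat}^{\mathrm{CS}}(G_{\mathbb{R}\mathrm{H}^n})\cong\{C^\alpha\mid\alpha\in\mathbb{R}\}\cong\mathbb{R},\qquad\mathc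al{ML}\mathrm{Stat}^{\mathrm{DF}}(G_{\mathbb{R}\mathrm{H}^n})\cong\{C^\alpha\mid\alpha\in\{\pm1\}\}\cong\{\pm1\}.$$
   Context: A statistical structure on a manifold $M$ is a pair $(g,\nabla)$ of a Riemannian metric $g$ and a torsion-free affine connection $\nabla$ such that the $(0,3)$-tensor field $C:=\nabla g$, $C(X,Y,Z)=(\nabla_X g)(Y,Z)$ (the cubic form), is totally symmetric. For fixed $g$, $\nabla\mapsto\nabla g$ is a bijection onto the symmetric $(0,3)$-tensor fields; $\nabla^{(g,C)}$ is the connection with $\nabla g=C$, and $(g,C)$ is also called a statistical structure; $\nabla^g=\nabla^{(g,0)}$ is the Levi-Civita connection. The dual connection $\overline\nabla$ is defined by $Xg(Y,Z)=g(\nabla_XY,Z)+g(Y,\overline\nabla_XZ)$. With $R^\nabla(X,Y)Z=\nabla_X\nabla_YZ-\nabla_Y\nabla_XZ-\nabla_{[X,Y]}Z$, $(g,\nabla)$ is conjugate symmetric if $R^\nabla=R^{\overline\nabla}$, and dually flat if $R^\nabla=0$. For a Lie group $G$ with Lie algebra $\mathfrak g$, a statistical structure $(g,\nabla)$ is left-invariant if both $g$ and $\nabla$ are invariant under left translations; left-invariant cubic forms are elements of $S^3(\mathfrak g^* )$. $S^3_{\mathrm{CS}}(\mathfrak g^*,g)$ and $S^3_{\mathrm{DF}}(\mathfrak g^*,g)$ are the sets of $C\in S^3(\mathfrak g^* )$ with $(g,C)$ conjugate symmetric, resp. dually flat. $\mathcal{L}\mathrm{Stat}(G)$, the set of left-invariant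 statistical structures, is identified via $(g,\nabla)\mapsto(g,\nabla g)$ with $\widetilde{\mathfrak M}(G)\times S^3(\mathfrak g^* )$ ($\widetilde{\mathfrak M}(G)$ = left-invariant metrics = inner products on $\mathfrak g$) and carries the corresponding topology. $\mathbb{R}_{>0}\times\mathrm{Aut}(G)$ acts by $(r,\varphi).(g,\nabla)=(r\,(\varphi^{-1})^*g,(\varphi^{-1})^*\nabla)$; $\mathcal{ML}\mathrm{Stat}(G)$, $\mathcal{ML}\mathrm{Stat}^{\mathrm{CS}}(G)$, $\mathcal{ML}\mathrm{Stat}^{\mathrm{DF}}(G)$ are the orbit spaces, with quotient topology, of $\mathcal{L}\mathrm{Stat}(G)$ and of its invariant subsets of conjugate symmetric, resp. dually flat, structures. $S^k(\mathfrak g^* )$ denotes symmetric $k$-tensors, with products $(x_1\cdots x_k)(X_1,\dots,X_k)=\frac1{k!}\sum_{\sigma\in\mathfrak S_k}\prod_i x_{\sigma(i)}(X_i)$, identified with homogeneous polynomials $\mathrm{Homog}_k(x_1,\dots,x_n)$ of degree $k$. $R^C_g(X,Y,Z,W):=g(R^{\nabla^{(g,C)}}(X,Y)Z,W)$, $\omega_{ij}:=x_i\otimes x_j-x_j\otimes x_i$, and $\omega_{ij}\odot\omega_{ij}=\omega_{ij}\otimes\omega_{ij}$. $SO(1)\times O(n-1)$ is the group of block matrices $\mathrm{diag}(1,h_0)$, $h_0\in O(n-1)$, in the basis $\{e_i\}$, acting by $h.C=C(h^{-1}\cdot,h^{-1}\cdot,h^{-1}\cdot)$. *)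

theory Defs
  imports "HOL-Analysis.Analysis"
begin

section \<open>Calculus on a manifold with a global chart\<close>

text \<open>
  The manifold is a Euclidean space \<open>'a\<close> in its standard chart, so that every tangent space is
  \<open>'a\<close>: a vector field is a map \<open>'a \<Rightarrow> 'a\<close>, a covariant tensor field is a map that takes a point
  and tangent vectors at that point.
\<close>

fun times_differentiable :: "nat \<Rightarrow> ('a::real_normed_vector \<Rightarrow> 'b::real_normed_vector) \<Rightarrow> bool" where
  "times_differentiable 0 f \<longleftrightarrow> continuous_on UNIV f"
| "times_differentiable (Suc k) f \<longleftrightarrow>
     (\<forall>p. f differentiable (at p)) \<and>
     (\<forall>v. times_differentiable k (\<lambda>p. frechet_derivative f (at p) v))"

definition smooth :: "('a::real_normed_vector \<Rightarrow> 'b::real_normed_vector) \<Rightarrow> bool" where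
  "smooth f \<longleftrightarrow> (\<forall>k. times_differentiable k f)"

abbreviation vector_fields :: "('a::euclidean_space \<Rightarrow> 'a) set" where
  "vector_fields \<equiv> {X. smooth X}"

definition along :: "('a::euclidean_space \<Rightarrow> 'a) \<Rightarrow> ('a \<Rightarrow> 'b::real_normed_vector) \<Rightarrow> 'a \<Rightarrow> 'b" where
  "along X f = (\<lambda>p. frechet_derivative f (at p) (X p))"

definition lie_bracket ::
    "('a::euclidean_space \<Rightarrow> 'a) \<Rightarrow> ('a \<Rightarrow> 'a) \<Rightarrow> 'a \<Rightarrow> 'a" where
  "lie_bracket X Y = (\<lambda>p. along X Y p - along Y X p)"

text \<open>For a diffeomorphism \<open>\<phi>\<close>: \<open>push_field \<phi> X\<close> is the push-forward of the field \<open>X\<close>;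
  \<open>pull_metric\<close> and \<open>pull_connection\<close> are the pull-backs along \<open>\<phi>\<close>.\<close>

definition push_field :: "('a::euclidean_space \<Rightarrow> 'a) \<Rightarrow> ('a \<Rightarrow> 'a) \<Rightarrow> 'a \<Rightarrow> 'a" where
  "push_field \<phi> X = (\<lambda>p. frechet_derivative \<phi> (at (inv \<phi> p)) (X (inv \<phi> p)))"

type_synonym 'a metric = "'a \<Rightarrow> 'a \<Rightarrow> 'a \<Rightarrow> real"
type_synonym 'a connection = "('a \<Rightarrow> 'a) \<Rightarrow> ('a \<Rightarrow> 'a) \<Rightarrow> 'a \<Rightarrow> 'a"

definition pull_metric :: "('a::euclidean_space \<Rightarrow> 'a) \<Rightarrow> 'a metric \<Rightarrow> 'a metric" where
  "pull_metric \<phi> h = (\<lambda>p u v. h (\<phi> p) (frechet_derivative \<phi> (at p) u) (frechet_derivative \<phi> (at p) v))"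

definition pull_connection :: "('a::euclidean_space \<Rightarrow> 'a) \<Rightarrow> 'a connection \<Rightarrow> 'a connection" where
  "pull_connection \<phi> D = (\<lambda>X Y. push_field (inv \<phi>) (D (push_field \<phi> X) (push_field \<phi> Y)))"

definition riemannian_metric :: "'a::euclidean_space metric \<Rightarrow> bool" where
  "riemannian_metric h \<longleftrightarrow>
     (\<forall>p. bilinear (h p)) \<and> (\<forall>p u v. h p u v = h p v u) \<and> (\<forall>p u. u \<noteq> 0 \<longrightarrow> h p u u > 0) \<and>
     (\<forall>u v. smooth (\<lambda>p. h p u v))"

text \<open>The last conjunct only fixes the (meaningless) values on non-smooth arguments, so that two
  connections are equal as soon as they agree on vector fields.\<close>

definition affine_connection :: "'a::euclidean_space connection \<Rightarrow> bool" where
  "affine_connection D \<longleftrightarrow>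
     (\<forall>X\<in>vector_fields. \<forall>Y\<in>vector_fields. D X Y \<in> vector_fields) \<and>
     (\<forall>X\<in>vector_fields. \<forall>X'\<in>vector_fields. \<forall>Y\<in>vector_fields.
        D (\<lambda>p. X p + X' p) Y = (\<lambda>p. D X Y p + D X' Y p)) \<and>
     (\<forall>X\<in>vector_fields. \<forall>Y\<in>vector_fields. \<forall>Y'\<in>vector_fields.
        D X (\<lambda>p. Y p + Y' p) = (\<lambda>p. D X Y p + D X Y' p)) \<and>
     (\<forall>f::'a \<Rightarrow> real. \<forall>X\<in>vector_fields. \<forall>Y\<in>vector_fields. smooth f \<longrightarrow>
        D (\<lambda>p. f p *\<^sub>R X p) Y = (\<lambda>p. f p *\<^sub>R D X Y p) \<and>
        D X (\<lambda>p. f p *\<^sub>R Y p) = (\<lambda>p. along X f p *\<^sub>R Y p + f p *\<^sub>R D X Y p)) \<and>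
     (\<forall>X Y. X \<notin> vector_fields \<or> Y \<notin> vector_fields \<longrightarrow> D X Y = (\<lambda>p. 0))"

definition torsion_free :: "'a::euclidean_space connection \<Rightarrow> bool" where
  "torsion_free D \<longleftrightarrow>
     (\<forall>X\<in>vector_fields. \<forall>Y\<in>vector_fields. (\<lambda>p. D X Y p - D Y X p) = lie_bracket X Y)"

definition curvature ::
    "'a::euclidean_space connection \<Rightarrow> ('a \<Rightarrow> 'a) \<Rightarrow> ('a \<Rightarrow> 'a) \<Rightarrow> ('a \<Rightarrow> 'a) \<Rightarrow> 'a \<Rightarrow> 'a" where
  "curvature D X Y Z = (\<lambda>p. D X (D Y Z) p - D Y (D X Z) p - D (lie_bracket X Y) Z p)"


section \<open>Statistical structures\<close>

text \<open>\<open>nabla_metric D h X Y Z\<close> is the function \<open>(\<nabla>\<^sub>X h)(Y, Z)\<close>.\<close>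

definition nabla_metric ::
    "'a::euclidean_space connection \<Rightarrow> 'a metric \<Rightarrow> ('a \<Rightarrow> 'a) \<Rightarrow> ('a \<Rightarrow> 'a) \<Rightarrow> ('a \<Rightarrow> 'a) \<Rightarrow> 'a \<Rightarrow> real" where
  "nabla_metric D h X Y Z =
     (\<lambda>p. along X (\<lambda>q. h q (Y q) (Z q)) p - h p (D X Y p) (Z p) - h p (Y p) (D X Z p))"

text \<open>\<open>nabla_cubic D T W X Y Z\<close> is the function \<open>(\<nabla>\<^sub>W T)(X, Y, Z)\<close>.\<close>

definition nabla_cubic ::
    "'a::euclidean_space connection \<Rightarrow> ('a \<Rightarrow> 'a \<Rightarrow> 'a \<Rightarrow> 'a \<Rightarrow> real) \<Rightarrow>
     ('a \<Rightarrow> 'a) \<Rightarrow> ('a \<Rightarrow> 'a) \<Rightarrow> ('a \<Rightarrow> 'a) \<Rightarrow> ('a \<Rightarrow> 'a) \<Rightarrow> 'a \<Rightarrow> real" where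
  "nabla_cubic D T W X Y Z =
     (\<lambda>p. along W (\<lambda>q. T q (X q) (Y q) (Z q)) p
        - T p (D W X p) (Y p) (Z p) - T p (X p) (D W Y p) (Z p) - T p (X p) (Y p) (D W Z p))"

definition statistical_structure :: "'a::euclidean_space metric \<Rightarrow> 'a connection \<Rightarrow> bool" where
  "statistical_structure h D \<longleftrightarrow>
     riemannian_metric h \<and> affine_connection D \<and> torsion_free D \<and>
     (\<forall>X\<in>vector_fields. \<forall>Y\<in>vector_fields. \<forall>Z\<in>vector_fields.
        nabla_metric D h X Y Z = nabla_metric D h Y X Z \<and>
        nabla_metric D h X Y Z = nabla_metric D h X Z Y)"

text \<open>The connection \<open>\<nabla>\<^bsup>(h,T)\<^esup>\<close> for a symmetric (0,3)-tensor field \<open>T\<close>.\<close>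

definition cubic_connection ::
    "'a::euclidean_space metric \<Rightarrow> ('a \<Rightarrow> 'a \<Rightarrow> 'a \<Rightarrow> 'a \<Rightarrow> real) \<Rightarrow> 'a connection" where
  "cubic_connection h T = (THE D. affine_connection D \<and> torsion_free D \<and>
     (\<forall>X\<in>vector_fields. \<forall>Y\<in>vector_fields. \<forall>Z\<in>vector_fields.
        nabla_metric D h X Y Z = (\<lambda>p. T p (X p) (Y p) (Z p))))"

definition levi_civita :: "'a::euclidean_space metric \<Rightarrow> 'a connection" where
  "levi_civita h = cubic_connection h (\<lambda>p u v w. 0)"

definition dual_connection :: "'a::euclidean_space metric \<Rightarrow> 'a connection \<Rightarrow> 'a connection" where
  "dual_connection h D = (THE D'. affine_connection D' \<and>
     (\<forall>X\<in>vector_fields. \<forall>Y\<in>vector_fields. \<forall>Z\<in>vector_fields.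
        along X (\<lambda>q. h q (Y q) (Z q)) = (\<lambda>p. h p (D X Y p) (Z p) + h p (Y p) (D' X Z p))))"

definition conjugate_symmetric :: "'a::euclidean_space metric \<Rightarrow> 'a connection \<Rightarrow> bool" where
  "conjugate_symmetric h D \<longleftrightarrow>
     (\<forall>X\<in>vector_fields. \<forall>Y\<in>vector_fields. \<forall>Z\<in>vector_fields.
        curvature D X Y Z = curvature (dual_connection h D) X Y Z)"

definition dually_flat :: "'a::euclidean_space metric \<Rightarrow> 'a connection \<Rightarrow> bool" where
  "dually_flat h D \<longleftrightarrow>
     (\<forall>X\<in>vector_fields. \<forall>Y\<in>vector_fields. \<forall>Z\<in>vector_fields. curvature D X Y Z = (\<lambda>p. 0))"


section \<open>Lie groups and left-invariant structures\<close>

text \<open>A Lie group with underlying manifold \<open>'a\<close> is given by its multiplication.\<close>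

definition lie_group :: "('a::euclidean_space \<Rightarrow> 'a \<Rightarrow> 'a) \<Rightarrow> bool" where
  "lie_group mul \<longleftrightarrow>
     (\<forall>a b c. mul (mul a b) c = mul a (mul b c)) \<and>
     (\<exists>u i. (\<forall>a. mul u a = a \<and> mul a u = a) \<and> (\<forall>a. mul (i a) a = u \<and> mul a (i a) = u) \<and>
        smooth (\<lambda>p. mul (fst p) (snd p)) \<and> smooth i)"

definition lie_unit :: "('a::euclidean_space \<Rightarrow> 'a \<Rightarrow> 'a) \<Rightarrow> 'a" where
  "lie_unit mul = (THE u. \<forall>a. mul u a = a \<and> mul a u = a)"

definition lie_algebra :: "('a::euclidean_space \<Rightarrow> 'a \<Rightarrow> 'a) \<Rightarrow> ('a \<Rightarrow> 'a) set" where
  "lie_algebra mul = {X. smooth X \<and> (\<forall>a. push_field (mul a) X = X)}"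

definition lie_group_automorphisms :: "('a::euclidean_space \<Rightarrow> 'a \<Rightarrow> 'a) \<Rightarrow> ('a \<Rightarrow> 'a) set" where
  "lie_group_automorphisms mul =
     {\<phi>. bij \<phi> \<and> smooth \<phi> \<and> smooth (inv \<phi>) \<and> (\<forall>a b. \<phi> (mul a b) = mul (\<phi> a) (\<phi> b))}"

definition left_invariant_statistical_structures ::
    "('a::euclidean_space \<Rightarrow> 'a \<Rightarrow> 'a) \<Rightarrow> ('a metric \<times> 'a connection) set" where
  "left_invariant_statistical_structures mul =
     {(h, D). statistical_structure h D \<and>
        (\<forall>a. pull_metric (mul a) h = h) \<and> (\<forall>a. pull_connection (mul a) D = D)}"

text \<open>Tensors on a Lie algebra \<open>L\<close> of vector fields are functions of elements of \<open>L\<close>, extended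
  by zero to arguments outside \<open>L\<close>.\<close>

definition linear_form_on :: "('a::euclidean_space \<Rightarrow> 'a) set \<Rightarrow> (('a \<Rightarrow> 'a) \<Rightarrow> real) \<Rightarrow> bool" where
  "linear_form_on L f \<longleftrightarrow>
     (\<forall>X\<in>L. \<forall>Y\<in>L. f (\<lambda>p. X p + Y p) = f X + f Y) \<and>
     (\<forall>c. \<forall>X\<in>L. f (\<lambda>p. c *\<^sub>R X p) = c * f X) \<and>
     (\<forall>X. X \<notin> L \<longrightarrow> f X = 0)"

type_synonym 'a cubic_form = "('a \<Rightarrow> 'a) \<Rightarrow> ('a \<Rightarrow> 'a) \<Rightarrow> ('a \<Rightarrow> 'a) \<Rightarrow> real"

definition symmetric_cubic_forms :: "('a::euclidean_space \<Rightarrow> 'a) set \<Rightarrow> 'a cubic_form set" where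
  "symmetric_cubic_forms L =
     {C. (\<forall>X Y. linear_form_on L (C X Y)) \<and> (\<forall>X Y Z. C X Y Z = C Y X Z \<and> C X Y Z = C X Z Y)}"

text \<open>The left-invariant tensor field with the given values on left-invariant fields: a tangent
  vector at \<open>p\<close> is the value at \<open>p\<close> of a unique left-invariant field.\<close>

definition left_field :: "('a::euclidean_space \<Rightarrow> 'a \<Rightarrow> 'a) \<Rightarrow> 'a \<Rightarrow> 'a \<Rightarrow> 'a \<Rightarrow> 'a" where
  "left_field mul p u = (THE X. X \<in> lie_algebra mul \<and> X p = u)"

definition left_cubic_tensor ::
    "('a::euclidean_space \<Rightarrow> 'a \<Rightarrow> 'a) \<Rightarrow> 'a cubic_form \<Rightarrow> 'a \<Rightarrow> 'a \<Rightarrow> 'a \<Rightarrow> 'a \<Rightarrow> real" where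
  "left_cubic_tensor mul C = (\<lambda>p u v w. C (left_field mul p u) (left_field mul p v) (left_field mul p w))"

definition metric_at_unit ::
    "('a::euclidean_space \<Rightarrow> 'a \<Rightarrow> 'a) \<Rightarrow> 'a metric \<Rightarrow> ('a \<Rightarrow> 'a) \<Rightarrow> ('a \<Rightarrow> 'a) \<Rightarrow> real" where
  "metric_at_unit mul h = (\<lambda>X Y.
     if X \<in> lie_algebra mul \<and> Y \<in> lie_algebra mul
     then h (lie_unit mul) (X (lie_unit mul)) (Y (lie_unit mul)) else 0)"

definition cubic_at_unit ::
    "('a::euclidean_space \<Rightarrow> 'a \<Rightarrow> 'a) \<Rightarrow> 'a metric \<Rightarrow> 'a connection \<Rightarrow> 'a cubic_form" where
  "cubic_at_unit mul h D = (\<lambda>X Y Z.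
     if X \<in> lie_algebra mul \<and> Y \<in> lie_algebra mul \<and> Z \<in> lie_algebra mul
     then nabla_metric D h X Y Z (lie_unit mul) else 0)"

definition cs_forms :: "('a::euclidean_space \<Rightarrow> 'a \<Rightarrow> 'a) \<Rightarrow> 'a metric \<Rightarrow> 'a cubic_form set" where
  "cs_forms mul h = {C \<in> symmetric_cubic_forms (lie_algebra mul).
     conjugate_symmetric h (cubic_connection h (left_cubic_tensor mul C))}"

definition df_forms :: "('a::euclidean_space \<Rightarrow> 'a \<Rightarrow> 'a) \<Rightarrow> 'a metric \<Rightarrow> 'a cubic_form set" where
  "df_forms mul h = {C \<in> symmetric_cubic_forms (lie_algebra mul).
     dually_flat h (cubic_connection h (left_cubic_tensor mul C))}"


section \<open>Moduli spaces\<close>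

definition orbit_topology :: "'b topology \<Rightarrow> ('b \<Rightarrow> 'b set) \<Rightarrow> 'b set topology" where
  "orbit_topology T orb =
     topology (\<lambda>U. U \<subseteq> orb ` topspace T \<and> openin T {x \<in> topspace T. orb x \<in> U})"

lemma openin_orbit_topology:
  "openin (orbit_topology T orb) U \<longleftrightarrow>
     U \<subseteq> orb ` topspace T \<and> openin T {x \<in> topspace T. orb x \<in> U}"
proof -
  have "istopology (\<lambda>U. U \<subseteq> orb ` topspace T \<and> openin T {x \<in> topspace T. orb x \<in> U})"
    unfolding istopology_def
  proof (intro conjI allI impI)
    fix S U
    assume S: "S \<subseteq> orb ` topspace T \<and> openin T {x \<in> topspace T. orb x \<in> S}"
      and U: "U \<subseteq> orb ` topspace T \<and> openin T {x \<in> topspace T. orb x \<in> U}"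
    have "{x \<in> topspace T. orb x \<in> S \<inter> U} =
        {x \<in> topspace T. orb x \<in> S} \<inter> {x \<in> topspace T. orb x \<in> U}" by auto
    then show "openin T {x \<in> topspace T. orb x \<in> S \<inter> U}"
      using openin_Int[OF conjunct2[OF S] conjunct2[OF U]] by (simp only:)
    show "S \<inter> U \<subseteq> orb ` topspace T" using S by auto
  next
    fix \<K>
    assume K: "\<forall>K\<in>\<K>. K \<subseteq> orb ` topspace T \<and> openin T {x \<in> topspace T. orb x \<in> K}"
    have "{x \<in> topspace T. orb x \<in> \<Union>\<K>} = (\<Union>K\<in>\<K>. {x \<in> topspace T. orb x \<in> K})" by auto
    then show "openin T {x \<in> topspace T. orb x \<in> \<Union>\<K>}" using K by auto
    show "\<Union>\<K> \<subseteq> orb ` topspace T" using K by auto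
  qed
  then show ?thesis
    by (simp add: orbit_topology_def topology_inverse')
qed

lemma topspace_orbit_topology: "topspace (orbit_topology T orb) = orb ` topspace T"
proof -
  have "{x \<in> topspace T. orb x \<in> orb ` topspace T} = topspace T" by auto
  then have "openin (orbit_topology T orb) (orb ` topspace T)"
    by (simp add: openin_orbit_topology)
  then have "orb ` topspace T \<subseteq> topspace (orbit_topology T orb)"
    by (rule openin_subset)
  moreover have "topspace (orbit_topology T orb) \<subseteq> orb ` topspace T"
    using openin_topspace[of "orbit_topology T orb"] unfolding openin_orbit_topology by (rule conjunct1)
  ultimately show ?thesis by (rule subset_antisym[rotated])
qed

lemma quotient_map_orbit_topology: "quotient_map T (orbit_topology T orb) orb"
  by (simp add: quotient_map_def topspace_orbit_topology openin_orbit_topology)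

text \<open>
  The structure \<open>(h, D)\<close> is identified with the inner product and the cubic form it induces on the Lie
  algebra. These forms carry the topology of pointwise convergence (the product topology of
  the function type), which on the finite-dimensional spaces of bilinear and of trilinear forms is
  the usual vector space topology.
\<close>

definition statistical_topology ::
    "('a::euclidean_space \<Rightarrow> 'a \<Rightarrow> 'a) \<Rightarrow> ('a metric \<times> 'a connection) topology" where
  "statistical_topology mul =
     pullback_topology (left_invariant_statistical_structures mul)
       (\<lambda>(h, D). (metric_at_unit mul h, cubic_at_unit mul h D)) euclidean"

definition statistical_orbit ::
    "('a::euclidean_space \<Rightarrow> 'a \<Rightarrow> 'a) \<Rightarrow> 'a metric \<times> 'a connection \<Rightarrow> ('a metric \<times> 'a connection) set" where
  "statistical_orbit mul = (\<lambda>(h, D).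
     {((\<lambda>p u v. r * pull_metric (inv \<phi>) h p u v), pull_connection (inv \<phi>) D) | r \<phi>.
        r > 0 \<and> \<phi> \<in> lie_group_automorphisms mul})"

definition moduli_stat ::
    "('a::euclidean_space \<Rightarrow> 'a \<Rightarrow> 'a) \<Rightarrow> ('a metric \<times> 'a connection) set topology" where
  "moduli_stat mul = orbit_topology (statistical_topology mul) (statistical_orbit mul)"

definition moduli_stat_cs ::
    "('a::euclidean_space \<Rightarrow> 'a \<Rightarrow> 'a) \<Rightarrow> ('a metric \<times> 'a connection) set topology" where
  "moduli_stat_cs mul =
     orbit_topology (subtopology (statistical_topology mul) {(h, D). conjugate_symmetric h D})
       (statistical_orbit mul)"

definition moduli_stat_df ::
    "('a::euclidean_space \<Rightarrow> 'a \<Rightarrow> 'a) \<Rightarrow> ('a metric \<times> 'a connection) set topology" where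
  "moduli_stat_df mul =
     orbit_topology (subtopology (statistical_topology mul) {(h, D). dually_flat h D})
       (statistical_orbit mul)"


section \<open>Bases, symmetric products and the block orthogonal group\<close>

definition lie_basis ::
    "('a::euclidean_space \<Rightarrow> 'a) set \<Rightarrow> nat \<Rightarrow> (nat \<Rightarrow> 'a \<Rightarrow> 'a) \<Rightarrow> bool" where
  "lie_basis L n e \<longleftrightarrow>
     (\<forall>i\<in>{1..n}. e i \<in> L) \<and>
     (\<forall>X\<in>L. \<exists>!c::nat \<Rightarrow> real. (\<forall>i. i \<notin> {1..n} \<longrightarrow> c i = 0) \<and> X = (\<lambda>p. \<Sum>i=1..n. c i *\<^sub>R e i p))"

definition dual_basis_of ::
    "('a::euclidean_space \<Rightarrow> 'a) set \<Rightarrow> nat \<Rightarrow> (nat \<Rightarrow> 'a \<Rightarrow> 'a) \<Rightarrow> (nat \<Rightarrow> ('a \<Rightarrow> 'a) \<Rightarrow> real) \<Rightarrow> bool" where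
  "dual_basis_of L n e x \<longleftrightarrow>
     (\<forall>i\<in>{1..n}. linear_form_on L (x i) \<and> (\<forall>j\<in>{1..n}. x i (e j) = (if i = j then 1 else 0)))"

text \<open>\<open>sym_prod [x\<^sub>1, \<dots>, x\<^sub>k] [X\<^sub>1, \<dots>, X\<^sub>k]\<close> is \<open>(x\<^sub>1 \<cdots> x\<^sub>k)(X\<^sub>1, \<dots>, X\<^sub>k)\<close>.\<close>

definition sym_prod :: "('b \<Rightarrow> real) list \<Rightarrow> 'b list \<Rightarrow> real" where
  "sym_prod xs Xs =
     (\<Sum>\<sigma> | \<sigma> permutes {..<length xs}. \<Prod>i<length xs. (xs ! \<sigma> i) (Xs ! i)) / fact (length xs)"

definition cubic_alpha :: "nat \<Rightarrow> (nat \<Rightarrow> ('a \<Rightarrow> 'a) \<Rightarrow> real) \<Rightarrow> real \<Rightarrow> 'a cubic_form" where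
  "cubic_alpha n x \<alpha> = (\<lambda>X Y Z. \<alpha> * (4 * sym_prod [x 1, x 1, x 1] [X, Y, Z] +
     6 * (\<Sum>i=2..n. sym_prod [x 1, x i, x i] [X, Y, Z])))"

definition wedge :: "('b \<Rightarrow> real) \<Rightarrow> ('b \<Rightarrow> real) \<Rightarrow> 'b \<Rightarrow> 'b \<Rightarrow> real" where
  "wedge a b = (\<lambda>X Y. a X * b Y - b X * a Y)"

text \<open>Matrices \<open>diag(1, h\<^sub>0)\<close> with \<open>h\<^sub>0 \<in> O(n - 1)\<close>, entries indexed from 1; \<open>matrix_map\<close> is the
  linear map with the given matrix in the basis \<open>e\<close> with dual basis \<open>x\<close>.\<close>

definition block_orthogonal :: "nat \<Rightarrow> (nat \<Rightarrow> nat \<Rightarrow> real) set" where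
  "block_orthogonal n = {m. m 1 1 = 1 \<and> (\<forall>i\<in>{2..n}. m 1 i = 0 \<and> m i 1 = 0) \<and>
     (\<forall>i\<in>{2..n}. \<forall>j\<in>{2..n}. (\<Sum>k=2..n. m k i * m k j) = (if i = j then 1 else 0))}"

definition matrix_map ::
    "nat \<Rightarrow> (nat \<Rightarrow> 'a::euclidean_space \<Rightarrow> 'a) \<Rightarrow> (nat \<Rightarrow> ('a \<Rightarrow> 'a) \<Rightarrow> real) \<Rightarrow>
     (nat \<Rightarrow> nat \<Rightarrow> real) \<Rightarrow> ('a \<Rightarrow> 'a) \<Rightarrow> 'a \<Rightarrow> 'a" where
  "matrix_map n e x m X = (\<lambda>p. \<Sum>i=1..n. (\<Sum>j=1..n. m i j * x j X) *\<^sub>R e i p)"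

definition act_cubic ::
    "('a::euclidean_space \<Rightarrow> 'a) set \<Rightarrow> (('a \<Rightarrow> 'a) \<Rightarrow> 'a \<Rightarrow> 'a) \<Rightarrow> 'a cubic_form \<Rightarrow> 'a cubic_form" where
  "act_cubic L f C = (\<lambda>X Y Z. if X \<in> L \<and> Y \<in> L \<and> Z \<in> L
     then C (inv_into L f X) (inv_into L f Y) (inv_into L f Z) else 0)"

definition block_orbit ::
    "('a::euclidean_space \<Rightarrow> 'a) set \<Rightarrow> nat \<Rightarrow> (nat \<Rightarrow> 'a \<Rightarrow> 'a) \<Rightarrow> (nat \<Rightarrow> ('a \<Rightarrow> 'a) \<Rightarrow> real) \<Rightarrow>
     'a cubic_form \<Rightarrow> 'a cubic_form set" where
  "block_orbit L n e x C = {act_cubic L (matrix_map n e x m) C | m. m \<in> block_orthogonal n}"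


section \<open>The Lie group of real hyperbolic space\<close>

text \<open>
  A connected and simply connected Lie group is determined up to isomorphism by its Lie algebra.
  For the algebra with basis \<open>e\<^sub>1, \<dots>, e\<^sub>n\<close> and nonzero brackets \<open>[e\<^sub>1, e\<^sub>i] = e\<^sub>i\<close>
  the group is the semidirect product of the additive group of \<open>'v\<close>, where \<open>DIM('v) = n - 1\<close>, with
  the real line acting by \<open>exp\<close>. The lemmas below show that this group has the defining properties.
\<close>

definition rh_mult :: "real \<times> 'v \<Rightarrow> real \<times> 'v \<Rightarrow> real \<times> 'v::euclidean_space" where
  "rh_mult a b = (fst a + fst b, snd a + exp (fst a) *\<^sub>R snd b)"

abbreviation rh_algebra :: "(real \<times> 'v::euclidean_space \<Rightarrow> real \<times> 'v) set" where
  "rh_algebra \<equiv> lie_algebra rh_mult"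

definition rh_relations :: "nat \<Rightarrow> (nat \<Rightarrow> 'a::euclidean_space \<Rightarrow> 'a) \<Rightarrow> bool" where
  "rh_relations n e \<longleftrightarrow>
     (\<forall>i\<in>{2..n}. lie_bracket (e 1) (e i) = e i) \<and>
     (\<forall>i\<in>{2..n}. \<forall>j\<in>{2..n}. lie_bracket (e i) (e j) = (\<lambda>p. 0))"

lemma times_differentiable_add:
  assumes "times_differentiable k f" "times_differentiable k g"
  shows "times_differentiable k (\<lambda>p. f p + g p)"
  using assms
proof (induction k arbitrary: f g)
  case 0
  then show ?case by (auto intro: continuous_on_add)
next
  case (Suc k)
  have d: "((\<lambda>p. f p + g p) has_derivative
      (\<lambda>v. frechet_derivative f (at p) v + frechet_derivative g (at p) v)) (at p)" for p
    using Suc.prems by (auto intro!: has_derivative_add simp: frechet_derivative_works[symmetric])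
  then have "frechet_derivative (\<lambda>p. f p + g p) (at p) =
      (\<lambda>v. frechet_derivative f (at p) v + frechet_derivative g (at p) v)" for p
    by (rule frechet_derivative_at[symmetric])
  moreover have "(\<lambda>p. f p + g p) differentiable (at p)" for p
    using d[of p] differentiableI by blast
  ultimately show ?case
    using Suc by simp
qed

lemma smooth_add: "smooth f \<Longrightarrow> smooth g \<Longrightarrow> smooth (\<lambda>p. f p + g p)"
  by (simp add: smooth_def times_differentiable_add)

lemma smooth_exp_affine:
  fixes c :: "'a::euclidean_space \<Rightarrow> real" and B :: "'a \<Rightarrow> 'b::euclidean_space"
  assumes "bounded_linear c" "bounded_linear B"
  shows "smooth (\<lambda>p. exp (c p) *\<^sub>R (B p + w))"
proof -
  have d: "((\<lambda>p. exp (c p) *\<^sub>R (B p + w)) has_derivative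
      (\<lambda>v. exp (c p) *\<^sub>R ((c v *\<^sub>R B p + B v) + c v *\<^sub>R w))) (at p)"
    if B: "bounded_linear B" for B :: "'a \<Rightarrow> 'b" and w p
  proof -
    have c: "(c has_derivative c) (at p)" and b: "(B has_derivative B) (at p)"
      using assms(1) B by (auto intro: bounded_linear_imp_has_derivative)
    have "((\<lambda>p. exp (c p)) has_derivative (\<lambda>v. exp (c p) * c v)) (at p)"
      using has_derivative_exp[OF c] by (simp add: mult.commute)
    from has_derivative_scaleR[OF this has_derivative_add_const[OF b, of w]] show ?thesis
      by (simp add: algebra_simps)
  qed
  have "times_differentiable k (\<lambda>p. exp (c p) *\<^sub>R (B p + w))" if "bounded_linear B"
    for k and B :: "'a \<Rightarrow> 'b" and w
    using that
  proof (induction k arbitrary: B w)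
    case 0
    then show ?case
      using assms(1) unfolding times_differentiable.simps
      by (intro continuous_intros) (auto intro: linear_continuous_on)
  next
    case (Suc k)
    have eq: "frechet_derivative (\<lambda>p. exp (c p) *\<^sub>R (B p + w)) (at p) v =
        exp (c p) *\<^sub>R (c v *\<^sub>R B p + (B v + c v *\<^sub>R w))" for p v
      unfolding frechet_derivative_at[OF d[OF Suc.prems, of w p], symmetric]
      by (simp only: add.assoc)
    have "bounded_linear (\<lambda>p. c v *\<^sub>R B p)" for v
      using Suc.prems by (rule bounded_linear_const_scaleR)
    from Suc.IH[OF this] have "times_differentiable k
        (\<lambda>p. frechet_derivative (\<lambda>p. exp (c p) *\<^sub>R (B p + w)) (at p) v)" for v
      unfolding eq .
    moreover have "(\<lambda>p. exp (c p) *\<^sub>R (B p + w)) differentiable (at p)" for p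
      using d[OF Suc.prems, of w p] differentiableI by blast
    ultimately show ?case by simp
  qed
  with assms(2) show ?thesis by (simp add: smooth_def)
qed

lemma smooth_affine:
  fixes B :: "'a::euclidean_space \<Rightarrow> 'b::euclidean_space"
  shows "bounded_linear B \<Longrightarrow> smooth (\<lambda>p. B p + w)"
  using smooth_exp_affine[of "\<lambda>_. 0" B w] by (simp add: bounded_linear_zero)

lemma lie_group_rh: "lie_group (rh_mult :: real \<times> 'v::euclidean_space \<Rightarrow> _)"
  unfolding lie_group_def
proof (intro conjI exI)
  show "\<forall>a b c. rh_mult (rh_mult a b) c = rh_mult a (rh_mult b (c :: real \<times> 'v))"
    by (auto simp: rh_mult_def exp_add algebra_simps)
  show "\<forall>a. rh_mult (0, 0) a = a \<and> rh_mult a (0, 0) = (a :: real \<times> 'v)"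
    by (auto simp: rh_mult_def)
  let ?i = "\<lambda>a :: real \<times> 'v. (- fst a, - exp (- fst a) *\<^sub>R snd a)"
  show "\<forall>a. rh_mult (?i a) a = (0, 0) \<and> rh_mult a (?i a) = (0, 0)"
    by (auto simp: rh_mult_def exp_minus)
  have "(\<lambda>p. rh_mult (fst p) (snd p)) =
      (\<lambda>p :: (real \<times> 'v) \<times> (real \<times> 'v). ((fst (fst p) + fst (snd p), snd (fst p)) + 0) +
        exp (fst (fst p)) *\<^sub>R ((0, snd (snd p)) + 0))"
    by (auto simp: rh_mult_def)
  then show "smooth (\<lambda>p. rh_mult (fst p) (snd p :: real \<times> 'v))"
    by (simp only:) (intro smooth_add smooth_exp_affine smooth_affine;
      simp add: linear_conv_bounded_linear[symmetric] linear_iff algebra_simps)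
  have "?i = (\<lambda>p. ((- fst p, 0) + 0) + exp (- fst p) *\<^sub>R ((0, - snd p) + 0))"
    by auto
  then show "smooth ?i"
    by (simp only:) (intro smooth_add smooth_exp_affine smooth_affine;
      simp add: linear_conv_bounded_linear[symmetric] linear_iff algebra_simps)
qed

lemma connected_rh: "connected (UNIV :: (real \<times> 'v::euclidean_space) set)"
  by (rule connected_UNIV)

lemma simply_connected_rh: "simply_connected (UNIV :: (real \<times> 'v::euclidean_space) set)"
  by (rule convex_imp_simply_connected) simp

lemma lie_algebra_rh:
  "lie_algebra rh_mult = range (\<lambda>(a, b) p. (a, exp (fst p) *\<^sub>R (b :: 'v::euclidean_space)))"
proof -
  have inv: "inv (rh_mult a) p = rh_mult (- fst a, - exp (- fst a) *\<^sub>R snd a) p"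
    for a p :: "real \<times> 'v"
    by (rule inv_f_eq) (auto simp: inj_on_def rh_mult_def exp_minus prod_eq_iff algebra_simps)
  have "(rh_mult a has_derivative (\<lambda>u. (fst u, exp (fst a) *\<^sub>R snd u))) (at p)"
    for a p :: "real \<times> 'v"
  proof -
    have "bounded_linear (\<lambda>u :: real \<times> 'v. (fst u, exp (fst a) *\<^sub>R snd u))"
      by (simp add: linear_conv_bounded_linear[symmetric] linear_iff algebra_simps)
    from has_derivative_add[OF has_derivative_const[of a] bounded_linear_imp_has_derivative[OF this]]
    have "((\<lambda>u. a + (fst u, exp (fst a) *\<^sub>R snd u)) has_derivative
        (\<lambda>u. (fst u, exp (fst a) *\<^sub>R snd u))) (at p)" by simp
    moreover have "rh_mult a = (\<lambda>u. a + (fst u, exp (fst a) *\<^sub>R snd u))"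
      by (simp add: rh_mult_def fun_eq_iff prod_eq_iff)
    ultimately show ?thesis by simp
  qed
  then have D: "frechet_derivative (rh_mult a) (at p) = (\<lambda>u. (fst u, exp (fst a) *\<^sub>R snd u))"
    for a p :: "real \<times> 'v"
    by (rule frechet_derivative_at[symmetric])
  show ?thesis
  proof (intro set_eqI iffI)
    fix X :: "real \<times> 'v \<Rightarrow> real \<times> 'v"
    assume "X \<in> lie_algebra rh_mult"
    then have push: "push_field (rh_mult a) X = X" for a
      unfolding lie_algebra_def by blast
    have unit: "inv (rh_mult a) a = (0, 0)" for a :: "real \<times> 'v"
      unfolding inv by (simp add: rh_mult_def exp_minus)
    have "X a = (fst (X (0, 0)), exp (fst a) *\<^sub>R snd (X (0, 0)))" for a
      using fun_cong[OF push, of a a] unfolding push_field_def D unit by (rule sym)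
    then have "X = (\<lambda>(a, b) p. (a, exp (fst p) *\<^sub>R b)) (X (0, 0))"
      unfolding case_prod_beta by (rule ext)
    then show "X \<in> range (\<lambda>(a, b) p. (a, exp (fst p) *\<^sub>R (b :: 'v)))" by (rule range_eqI)
  next
    fix X :: "real \<times> 'v \<Rightarrow> real \<times> 'v"
    assume "X \<in> range (\<lambda>(a, b) p. (a, exp (fst p) *\<^sub>R (b :: 'v)))"
    then obtain a b where X: "X = (\<lambda>p. (a, exp (fst p) *\<^sub>R b))" by auto
    have eq: "X = (\<lambda>p. (0 + (a, 0)) + exp (fst p) *\<^sub>R (0 + (0, b)))"
      by (auto simp: X)
    have "smooth (\<lambda>p::real \<times> 'v. (0 + (a, 0)) + exp (fst p) *\<^sub>R (0 + (0, b)))"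
      by (intro smooth_add smooth_exp_affine smooth_affine;
        simp add: linear_conv_bounded_linear[symmetric] linear_iff algebra_simps)
    then have "smooth X" unfolding eq .
    moreover have "push_field (rh_mult c) X = X" for c
      unfolding push_field_def D X inv by (simp add: rh_mult_def exp_add[symmetric])
    ultimately show "X \<in> lie_algebra rh_mult"
      by (simp add: lie_algebra_def)
  qed
qed

lemma rh_basis_exists:
  assumes n: "n = DIM('v::euclidean_space) + 1"
  shows "\<exists>e. lie_basis (lie_algebra (rh_mult :: real \<times> 'v \<Rightarrow> _)) n e \<and> rh_relations n e"
proof -
  have "card {2..n} = card (Basis :: 'v set)" by (simp add: n)
  then obtain b :: "nat \<Rightarrow> 'v" where b: "bij_betw b {2..n} Basis"
    by (metis bij_betw_iff_card finite_Basis finite_atLeastAtMost)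
  define e :: "nat \<Rightarrow> real \<times> 'v \<Rightarrow> real \<times> 'v"
    where "e i = (if i = 1 then (\<lambda>p. (1, 0)) else (\<lambda>p. (0, exp (fst p) *\<^sub>R b i)))" for i
  have split: "{1..n} = insert 1 {2..n}" using n by auto
  have comb: "(\<Sum>i=1..n. c i *\<^sub>R e i p) = (c 1, exp (fst p) *\<^sub>R (\<Sum>i=2..n. c i *\<^sub>R b i))"
    for c :: "nat \<Rightarrow> real" and p
  proof -
    have "(\<Sum>i=2..n. c i *\<^sub>R e i p) = (\<Sum>i=2..n. (0, exp (fst p) *\<^sub>R c i *\<^sub>R b i))"
      by (rule sum.cong) (auto simp: e_def)
    also have "\<dots> = (0, exp (fst p) *\<^sub>R (\<Sum>i=2..n. c i *\<^sub>R b i))"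
      by (simp add: sum_prod scaleR_sum_right)
    finally show ?thesis
      by (simp only: split) (simp add: e_def)
  qed
  have inner: "(\<Sum>i=2..n. c i *\<^sub>R b i) \<bullet> b j = c j" if "j \<in> {2..n}" for c :: "nat \<Rightarrow> real" and j
  proof -
    have "c i *\<^sub>R b i \<bullet> b j = (if i = j then c j else 0)" if "i \<in> {2..n}" for i
      using that \<open>j \<in> {2..n}\<close> b bij_betwE[OF b]
      by (auto simp: inner_Basis bij_betw_def inj_on_def)
    then show ?thesis using that by (simp add: inner_sum_left)
  qed
  have "e i \<in> lie_algebra rh_mult" for i
    unfolding lie_algebra_rh
    by (rule range_eqI[of _ _ "if i = 1 then (1, 0) else (0, b i)"]) (auto simp: e_def)
  moreover have "\<exists>!c. (\<forall>i. i \<notin> {1..n} \<longrightarrow> c i = 0) \<and> X = (\<lambda>p. \<Sum>i=1..n. c i *\<^sub>R e i p)"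
    if "X \<in> lie_algebra rh_mult" for X :: "real \<times> 'v \<Rightarrow> real \<times> 'v"
  proof -
    from that obtain a v where X: "X = (\<lambda>p. (a, exp (fst p) *\<^sub>R v))"
      unfolding lie_algebra_rh by auto
    define c where "c i = (if i = 1 then a else if i \<in> {2..n} then v \<bullet> b i else 0)" for i
    have "(\<Sum>i=2..n. c i *\<^sub>R b i) = (\<Sum>i=2..n. (v \<bullet> b i) *\<^sub>R b i)"
      by (rule sum.cong) (auto simp: c_def)
    also have "\<dots> = (\<Sum>u\<in>Basis. (v \<bullet> u) *\<^sub>R u)"
      by (rule sum.reindex_bij_betw[OF b])
    finally have v: "(\<Sum>i=2..n. c i *\<^sub>R b i) = v" by (simp add: euclidean_representation)
    show ?thesis
    proof (rule ex1I[of _ c])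
      show "(\<forall>i. i \<notin> {1..n} \<longrightarrow> c i = 0) \<and> X = (\<lambda>p. \<Sum>i=1..n. c i *\<^sub>R e i p)"
        unfolding comb v X using n by (auto simp: c_def)
      fix d assume d: "(\<forall>i. i \<notin> {1..n} \<longrightarrow> d i = 0) \<and> X = (\<lambda>p. \<Sum>i=1..n. d i *\<^sub>R e i p)"
      then have "X (0, 0) = (\<Sum>i=1..n. d i *\<^sub>R e i (0, 0))" by (rule conjunct2[THEN fun_cong])
      then have da: "d 1 = a" and dv: "(\<Sum>i=2..n. d i *\<^sub>R b i) = v"
        unfolding comb X by simp_all
      show "d = c"
      proof
        fix i
        consider "i = 1" | "i \<in> {2..n}" | "i \<notin> {1..n}" by fastforce
        then show "d i = c i"
        proof cases
          case 2
          then show ?thesis using inner[OF 2, of d] inner[OF 2, of c] dv v by simp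
        next
          case 3
          then show ?thesis using d n by (auto simp: c_def)
        qed (use da in \<open>simp add: c_def\<close>)
      qed
    qed
  qed
  moreover have "rh_relations n e"
  proof -
    have D1: "frechet_derivative (\<lambda>p::real \<times> 'v. (1::real, 0::'v)) (at p) = (\<lambda>u. 0)" for p
      by (rule frechet_derivative_at[symmetric]) (rule has_derivative_const)
    have "((\<lambda>p::real \<times> 'v. (0::real, exp (fst p) *\<^sub>R w)) has_derivative
        (\<lambda>u. (0, (fst u * exp (fst p)) *\<^sub>R w))) (at p)" for w :: 'v and p
      using has_derivative_Pair[OF has_derivative_const[of "0::real"] has_derivative_scaleR_left[OF
        has_derivative_exp[OF bounded_linear_imp_has_derivative[OF bounded_linear_fst]], of w],
        of p UNIV]
      by simp
    then have D2: "frechet_derivative (\<lambda>p::real \<times> 'v. (0::real, exp (fst p) *\<^sub>R w)) (at p) =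
        (\<lambda>u. (0, (fst u * exp (fst p)) *\<^sub>R w))" for w :: 'v and p
      by (rule frechet_derivative_at[symmetric])
    show ?thesis
      by (auto simp: rh_relations_def lie_bracket_def along_def e_def D1 D2 zero_prod_def)
  qed
  ultimately show ?thesis
    unfolding lie_basis_def by (intro exI[of _ e] conjI ballI)
qed

end

theory Submission
  imports Defs
begin

text \<open>
  The group is hyperbolic space in horospherical coordinates: \<open>'v rh = \<real> \<times> 'v\<close> with the left-invariant frame
  \<open>(t, v) \<mapsto> (a, exp t *\<^sub>R b)\<close>, so that its Lie algebra is \<open>'v rh\<close> itself with the bracket
  \<open>br u v = fst u *\<^sub>R v - fst v *\<^sub>R u\<close>. The linear form \<open>fst\<close> carries all the structure, and nearly every
  step below is a computation with \<open>fst\<close>, an inner product \<open>m\<close> and a trilinear form \<open>c\<close>, for an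
  arbitrary \<open>m\<close> and without coordinates.

  \<^item> Differential geometry is reduced to algebra. In the left-invariant frame a left-invariant
  connection is differentiation of components plus a bilinear product \<open>B\<close> (\<open>conn B\<close>). Its curvature is a
  tensor with constant components (\<open>curvature_conn\<close>), which rests on the symmetry of second
  derivatives. The left-invariant statistical structures correspond to the pairs \<open>(m, c)\<close>, with
  \<open>B\<close> given by the Koszul formula (\<open>stat_mult\<close>, \<open>left_invariant_statistical_structures_eq\<close>).

  \<^item> Let \<open>grad m\<close> be the vector that represents \<open>fst\<close>. The Levi-Civita product is
  \<open>m u v *\<^sub>R grad m - fst v *\<^sub>R u\<close>, so \<open>grad m\<close> acts by zero from the left. Conjugate symmetry says that
  \<open>\<nabla>\<^sup>g c\<close> is totally symmetric; since its components with first argument \<open>grad m\<close> vanish, all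
  components with an argument \<open>grad m\<close> must vanish. This linear condition leaves the line of the forms
  \<open>alpha_form m a\<close> (\<open>alpha_form_of_curv_eq\<close>). On that line the curvature is \<open>1 - a\<^sup>2\<close> times
  that of the metric (\<open>curv_alpha_form\<close>), so the flat structures are \<open>a = 1\<close> and \<open>a = -1\<close>.

  \<^item> Automorphisms of the group correspond to the linear bijections \<open>T\<close> of the Lie algebra with
  \<open>fst (T u) = fst u\<close> (\<open>group_automorphism_intertwines\<close>, \<open>automorphism_integrates\<close>). Together
  with the scalings they act transitively on inner products, and the stabilizer of \<open>m\<close> is the group of
  those \<open>T\<close> that preserve \<open>m\<close>, which is the block orthogonal group. Orthonormalization moves
  any inner product to \<open>m\<close> by an element that depends continuously on it (\<open>continuous_normalization\<close>),
  which gives a continuous normal form of structures that is inverse, up to orbits, to \<open>C \<mapsto> (g, C)\<close>. A normal form of this kind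
  identifies the orbit spaces (\<open>orbit_topology_homeomorphic_normal_forms\<close>). The forms \<open>alpha_form m a\<close> are
  fixed by the stabilizer, so the two smaller moduli spaces are the line and the two points themselves.
\<close>

section \<open>Smooth maps\<close>

lemma times_differentiable_SucD: "times_differentiable (Suc k) f \<Longrightarrow> times_differentiable k f"
proof (induction k arbitrary: f)
  case 0
  then show ?case
    by (auto intro!: continuous_at_imp_continuous_on differentiable_imp_continuous_within)
next
  case (Suc k)
  then show ?case by auto
qed

lemma smooth_has_derivative:
  "smooth f \<Longrightarrow> (f has_derivative frechet_derivative f (at p)) (at p)"
  unfolding smooth_def
  by (metis times_differentiable.simps(2) frechet_derivative_works)

lemma smooth_linear_derivative: "smooth f \<Longrightarrow> linear (frechet_derivative f (at p))"
  using smooth_has_derivative[of f p] has_derivative_linear by blast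

lemma smooth_continuous: "smooth f \<Longrightarrow> continuous_on UNIV f"
  unfolding smooth_def by (metis times_differentiable.simps(1))

lemma smooth_frechet: "smooth f \<Longrightarrow> smooth (\<lambda>p. frechet_derivative f (at p) v)"
  unfolding smooth_def by (metis times_differentiable.simps(2))

lemma smooth_const [simp]: "smooth (\<lambda>p. c)"
proof -
  have "frechet_derivative (\<lambda>p::'a. c) (at p) = (\<lambda>v. 0)" for p and c :: 'b
    using frechet_derivative_at[OF has_derivative_const[of c "at p"]] by simp
  then have "times_differentiable k (\<lambda>p::'a. c)" for k and c :: 'b
    by (induction k arbitrary: c) auto
  then show ?thesis by (simp add: smooth_def)
qed

lemma times_differentiable_bilinear:
  assumes "bounded_bilinear B" "times_differentiable k f" "times_differentiable k g"
  shows "times_differentiable k (\<lambda>p. B (f p) (g p))"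
  using assms(2,3)
proof (induction k arbitrary: f g)
  case 0
  then show ?case
    by (auto intro: bounded_bilinear.continuous_on[OF assms(1)])
next
  case (Suc k)
  have d: "((\<lambda>p. B (f p) (g p)) has_derivative
      (\<lambda>v. B (f p) (frechet_derivative g (at p) v) + B (frechet_derivative f (at p) v) (g p))) (at p)" for p
    using Suc.prems by (auto intro!: bounded_bilinear.FDERIV[OF assms(1)] simp: frechet_derivative_works[symmetric])
  then have "frechet_derivative (\<lambda>p. B (f p) (g p)) (at p) =
      (\<lambda>v. B (f p) (frechet_derivative g (at p) v) + B (frechet_derivative f (at p) v) (g p))" for p
    by (rule frechet_derivative_at[symmetric])
  moreover have "(\<lambda>p. B (f p) (g p)) differentiable (at p)" for p
    using d[of p] differentiableI by blast
  ultimately show ?case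
    using Suc times_differentiable_SucD[OF Suc.prems(1)] times_differentiable_SucD[OF Suc.prems(2)]
    by (auto intro!: times_differentiable_add)
qed

lemma smooth_bilinear:
  "bounded_bilinear B \<Longrightarrow> smooth f \<Longrightarrow> smooth g \<Longrightarrow> smooth (\<lambda>p. B (f p) (g p))"
  by (simp add: smooth_def times_differentiable_bilinear)

lemmas smooth_scaleR = smooth_bilinear[OF bounded_bilinear_scaleR]

lemma smooth_linear_compose:
  assumes A: "bounded_linear A" and f: "smooth f"
  shows "smooth (\<lambda>p. A (f p))"
proof -
  have d: "((\<lambda>p. A (f p)) has_derivative (\<lambda>v. A (frechet_derivative f (at p) v))) (at p)"
    if "smooth f" for p and f :: "'c::real_normed_vector \<Rightarrow> 'a"
    using bounded_linear.has_derivative[OF A smooth_has_derivative[OF that]] .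
  have "times_differentiable k (\<lambda>p. A (f p))" if "smooth f" for k and f :: "'c \<Rightarrow> 'a"
    using that
  proof (induction k arbitrary: f)
    case 0
    then show ?case
      by (auto intro: bounded_linear.continuous_on[OF A] smooth_continuous)
  next
    case (Suc k)
    have "frechet_derivative (\<lambda>p. A (f p)) (at p) = (\<lambda>v. A (frechet_derivative f (at p) v))" for p
      using frechet_derivative_at[OF d[OF Suc.prems]] by simp
    then show ?case
      using Suc.IH[OF smooth_frechet[OF Suc.prems]] d[OF Suc.prems] differentiableI by fastforce
  qed
  then show ?thesis using f by (simp add: smooth_def)
qed

lemma smooth_sum:
  assumes "finite I" "\<And>i. i \<in> I \<Longrightarrow> smooth (f i)"
  shows "smooth (\<lambda>p. \<Sum>i\<in>I. f i p)"
  using assms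
proof (induction I rule: finite_induct)
  case (insert i I)
  then have "smooth (f i)" "smooth (\<lambda>p. \<Sum>i\<in>I. f i p)" by auto
  from smooth_add[OF this] insert.hyps show ?case by simp
qed simp

lemma smooth_diff:
  assumes f: "smooth f" and g: "smooth g"
  shows "smooth (\<lambda>p. f p - g p :: 'b::real_normed_vector)"
proof -
  have "bounded_linear (\<lambda>x. - x :: 'b)"
    by (rule bounded_linear_minus[OF bounded_linear_ident])
  from smooth_add[OF f smooth_linear_compose[OF this g]] show ?thesis
    by (simp only: diff_conv_add_uminus)
qed

lemma derivative_expansion:
  fixes f :: "'a::euclidean_space \<Rightarrow> 'b::real_normed_vector"
  assumes "linear f"
  shows "f v = (\<Sum>b\<in>Basis. (v \<bullet> b) *\<^sub>R f b)"
  by (metis (mono_tags, lifting) assms euclidean_representation linear_scale linear_sum sum.cong)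

lemma smooth_along:
  fixes X :: "'a::euclidean_space \<Rightarrow> 'a"
  assumes "smooth X" "smooth f"
  shows "smooth (along X f)"
proof -
  have "along X f = (\<lambda>p. \<Sum>b\<in>Basis. (X p \<bullet> b) *\<^sub>R frechet_derivative f (at p) b)"
    unfolding along_def by (intro ext derivative_expansion smooth_linear_derivative assms)
  then show ?thesis
    by (simp only:) (intro smooth_sum smooth_scaleR smooth_frechet assms
        smooth_linear_compose[OF bounded_linear_inner_left] finite_Basis)
qed

lemma smooth_compose:
  fixes f :: "'a::euclidean_space \<Rightarrow> 'b::real_normed_vector" and s :: "'c::real_normed_vector \<Rightarrow> 'a"
  assumes f: "smooth f" and s: "smooth s"
  shows "smooth (\<lambda>p. f (s p))"
proof -
  have "times_differentiable k (\<lambda>p. f (s p))" if "smooth f" for k and f :: "'a \<Rightarrow> 'b"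
    using that
  proof (induction k arbitrary: f)
    case 0
    show ?case
      using continuous_on_compose2[OF smooth_continuous[OF 0] smooth_continuous[OF s]] by simp
  next
    case (Suc k)
    have d: "((\<lambda>p. f (s p)) has_derivative
        (\<lambda>v. frechet_derivative f (at (s p)) (frechet_derivative s (at p) v))) (at p)" for p
      using has_derivative_compose[OF smooth_has_derivative[OF s] smooth_has_derivative[OF Suc.prems]] .
    have eq: "frechet_derivative (\<lambda>p. f (s p)) (at p) v =
        (\<Sum>b\<in>Basis. (frechet_derivative s (at p) v \<bullet> b) *\<^sub>R frechet_derivative f (at (s p)) b)" for p v
      unfolding frechet_derivative_at[OF d[of p], symmetric]
      by (rule derivative_expansion[OF smooth_linear_derivative[OF Suc.prems]])
    have sm: "times_differentiable k (\<lambda>p. (frechet_derivative s (at p) v \<bullet> b) *\<^sub>R frechet_derivative f (at (s p)) b)" for v b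
    proof (rule times_differentiable_bilinear[OF bounded_bilinear_scaleR])
      show "times_differentiable k (\<lambda>p. frechet_derivative s (at p) v \<bullet> b)"
        using smooth_linear_compose[OF bounded_linear_inner_left smooth_frechet[OF s]]
        by (auto simp: smooth_def)
      show "times_differentiable k (\<lambda>p. frechet_derivative f (at (s p)) b)"
        by (rule Suc.IH[OF smooth_frechet[OF Suc.prems]])
    qed
    have "times_differentiable k (\<lambda>p. \<Sum>b\<in>I. (frechet_derivative s (at p) v \<bullet> b) *\<^sub>R frechet_derivative f (at (s p)) b)"
      if "finite I" for v I
      using that
    proof (induction I rule: finite_induct)
      case empty
      have "smooth (\<lambda>p::'c. 0::'b)" by simp
      then show ?case unfolding smooth_def by simp
    next
      case (insert b I)
      from times_differentiable_add[OF sm[of v b] insert.IH] show ?case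
        using insert.hyps by simp
    qed
    from this[OF finite_Basis]
    have "times_differentiable k (\<lambda>p. frechet_derivative (\<lambda>p. f (s p)) (at p) v)" for v
      unfolding eq .
    moreover have "(\<lambda>p. f (s p)) differentiable (at p)" for p
      using d[of p] differentiableI by blast
    ultimately show ?case by simp
  qed
  then show ?thesis using f by (simp add: smooth_def)
qed

text \<open>The mean value theorem in the direction \<open>u\<close> and then in the direction \<open>v\<close>. The left-hand side of
  the equation is symmetric in \<open>u\<close> and \<open>v\<close>; this is the source of the symmetry of second derivatives.\<close>

lemma second_difference_quotient:
  fixes f :: "'a::euclidean_space \<Rightarrow> real"
  assumes f: "smooth f" and h: "h > 0"
  obtains s t where "0 < s" "s < h" "0 < t" "t < h"
    "f (p + h *\<^sub>R u + h *\<^sub>R v) - f (p + h *\<^sub>R u) - f (p + h *\<^sub>R v) + f p =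
     h * h * frechet_derivative (\<lambda>q. frechet_derivative f (at q) u) (at (p + s *\<^sub>R u + t *\<^sub>R v)) v"
proof -
  have line: "((\<lambda>s. k (q + s *\<^sub>R w)) has_real_derivative frechet_derivative k (at (q + s *\<^sub>R w)) w) (at s)"
    if k: "smooth k" for k :: "'a \<Rightarrow> real" and q w s
  proof -
    have "((\<lambda>s. q + s *\<^sub>R w) has_derivative (\<lambda>r. r *\<^sub>R w)) (at s)"
      by (auto intro!: derivative_eq_intros)
    from has_derivative_compose[OF this smooth_has_derivative[OF k]]
    show ?thesis
      by (simp add: has_field_derivative_def linear_scale[OF smooth_linear_derivative[OF k]] mult_commute_abs)
  qed
  have "\<exists>s. 0 < s \<and> s < h \<and>
      (f ((p + h *\<^sub>R v) + h *\<^sub>R u) - f (p + h *\<^sub>R u)) - (f ((p + h *\<^sub>R v) + 0 *\<^sub>R u) - f (p + 0 *\<^sub>R u)) =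
      (h - 0) * (frechet_derivative f (at ((p + h *\<^sub>R v) + s *\<^sub>R u)) u - frechet_derivative f (at (p + s *\<^sub>R u)) u)"
    by (rule MVT2) (use h in \<open>auto intro!: DERIV_diff line f\<close>)
  then obtain s where s: "0 < s" "s < h" and 1:
      "f (p + h *\<^sub>R u + h *\<^sub>R v) - f (p + h *\<^sub>R u) - f (p + h *\<^sub>R v) + f p =
       h * (frechet_derivative f (at ((p + s *\<^sub>R u) + h *\<^sub>R v)) u - frechet_derivative f (at (p + s *\<^sub>R u + 0 *\<^sub>R v)) u)"
    by (auto simp: algebra_simps)
  have "\<exists>t. 0 < t \<and> t < h \<and>
      frechet_derivative f (at ((p + s *\<^sub>R u) + h *\<^sub>R v)) u - frechet_derivative f (at ((p + s *\<^sub>R u) + 0 *\<^sub>R v)) u =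
      (h - 0) * frechet_derivative (\<lambda>q. frechet_derivative f (at q) u) (at ((p + s *\<^sub>R u) + t *\<^sub>R v)) v"
    by (rule MVT2) (use h in \<open>auto intro!: line[OF smooth_frechet[OF f]]\<close>)
  then show thesis
    using s 1 that by auto
qed

text \<open>Both orders of differentiation have, at points arbitrarily close to \<open>p\<close>, the second difference
  quotient as a common value, and both are continuous.\<close>

lemma second_derivative_symmetric_real:
  fixes f :: "'a::euclidean_space \<Rightarrow> real"
  assumes f: "smooth f"
  shows "frechet_derivative (\<lambda>q. frechet_derivative f (at q) u) (at p) v =
         frechet_derivative (\<lambda>q. frechet_derivative f (at q) v) (at p) u"
proof -
  let ?F = "\<lambda>u v p. frechet_derivative (\<lambda>q. frechet_derivative f (at q) u) (at p) v"
  have "\<exists>s t s' t'. {s, t, s', t'} \<subseteq> {0<..<h} \<and>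
     ?F u v (p + s *\<^sub>R u + t *\<^sub>R v) = ?F v u (p + s' *\<^sub>R v + t' *\<^sub>R u)" if h: "h > 0" for h :: real
  proof -
    obtain s t where 1: "0 < s" "s < h" "0 < t" "t < h"
      "f (p + h *\<^sub>R u + h *\<^sub>R v) - f (p + h *\<^sub>R u) - f (p + h *\<^sub>R v) + f p = h * h * ?F u v (p + s *\<^sub>R u + t *\<^sub>R v)"
      by (rule second_difference_quotient[OF f h])
    obtain s' t' where 2: "0 < s'" "s' < h" "0 < t'" "t' < h"
      "f (p + h *\<^sub>R v + h *\<^sub>R u) - f (p + h *\<^sub>R v) - f (p + h *\<^sub>R u) + f p = h * h * ?F v u (p + s' *\<^sub>R v + t' *\<^sub>R u)"
      by (rule second_difference_quotient[OF f h])
    have "h * h * ?F u v (p + s *\<^sub>R u + t *\<^sub>R v) = h * h * ?F v u (p + s' *\<^sub>R v + t' *\<^sub>R u)"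
      using 1(5) 2(5) by (simp add: algebra_simps)
    then show ?thesis using h 1 2 by (intro exI[of _ s] exI[of _ t] exI[of _ s'] exI[of _ t']) auto
  qed
  from this[of "1 / Suc n" for n]
  obtain s t s' t' where st: "\<And>n::nat. {s n, t n, s' n, t' n} \<subseteq> {0<..<1 / Suc n} \<and>
     ?F u v (p + s n *\<^sub>R u + t n *\<^sub>R v) = ?F v u (p + s' n *\<^sub>R v + t' n *\<^sub>R u)"
    by (metis of_nat_0_less_iff zero_less_Suc zero_less_divide_1_iff)
  have lim0: "r \<longlonglongrightarrow> 0" if "\<And>n::nat. r n \<in> {0<..<1 / Suc n}" for r :: "nat \<Rightarrow> real"
    by (rule tendsto_sandwich[OF _ _ tendsto_const LIMSEQ_Suc[OF lim_1_over_n]])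
       (use that in \<open>auto intro!: always_eventually intro: less_imp_le\<close>)
  have lim: "(\<lambda>n. ?F u v (p + r n *\<^sub>R a + r' n *\<^sub>R b)) \<longlonglongrightarrow> ?F u v p"
    if "\<And>n::nat. r n \<in> {0<..<1 / Suc n}" "\<And>n::nat. r' n \<in> {0<..<1 / Suc n}" for r r' u v a b
  proof -
    have "(\<lambda>n. p + r n *\<^sub>R a + r' n *\<^sub>R b) \<longlonglongrightarrow> p + 0 *\<^sub>R a + 0 *\<^sub>R b"
      by (intro tendsto_intros lim0 that)
    moreover have "isCont (?F u v) p"
      using smooth_continuous[OF smooth_frechet[OF smooth_frechet[OF f]]] by (simp add: continuous_on_eq_continuous_at)
    ultimately show ?thesis
      using isCont_tendsto_compose by fastforce
  qed
  have lim_u: "(\<lambda>n. ?F u v (p + s n *\<^sub>R u + t n *\<^sub>R v)) \<longlonglongrightarrow> ?F u v p"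
    using st by (intro lim) blast+
  have "(\<lambda>n. ?F v u (p + s' n *\<^sub>R v + t' n *\<^sub>R u)) \<longlonglongrightarrow> ?F v u p"
    using st by (intro lim) blast+
  moreover have "(\<lambda>n. ?F u v (p + s n *\<^sub>R u + t n *\<^sub>R v)) = (\<lambda>n. ?F v u (p + s' n *\<^sub>R v + t' n *\<^sub>R u))"
    using st by (intro ext) blast
  ultimately have "(\<lambda>n. ?F u v (p + s n *\<^sub>R u + t n *\<^sub>R v)) \<longlonglongrightarrow> ?F v u p"
    by (simp only:)
  then show ?thesis
    by (rule LIMSEQ_unique[OF lim_u])
qed

lemma frechet_linear_compose:
  assumes "bounded_linear A" "smooth f"
  shows "frechet_derivative (\<lambda>q. A (f q)) (at p) = (\<lambda>v. A (frechet_derivative f (at p) v))"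
  using frechet_derivative_at[OF bounded_linear.has_derivative[OF assms(1) smooth_has_derivative[OF assms(2)]]]
  by simp

lemma second_derivative_symmetric:
  fixes f :: "'a::euclidean_space \<Rightarrow> 'b::euclidean_space"
  assumes f: "smooth f"
  shows "frechet_derivative (\<lambda>q. frechet_derivative f (at q) u) (at p) v =
         frechet_derivative (\<lambda>q. frechet_derivative f (at q) v) (at p) u"
proof (rule euclidean_eqI)
  fix b :: 'b
  note bl = bounded_linear_inner_left[of b]
  have "frechet_derivative (\<lambda>q. frechet_derivative f (at q) u) (at p) v \<bullet> b =
      frechet_derivative (\<lambda>q. frechet_derivative (\<lambda>q. f q \<bullet> b) (at q) u) (at p) v" for u v
    by (simp add: frechet_linear_compose[OF bl f] frechet_linear_compose[OF bl smooth_frechet[OF f]])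
  then show "frechet_derivative (\<lambda>q. frechet_derivative f (at q) u) (at p) v \<bullet> b =
      frechet_derivative (\<lambda>q. frechet_derivative f (at q) v) (at p) u \<bullet> b"
    by (metis second_derivative_symmetric_real[OF smooth_linear_compose[OF bl f]])
qed

section \<open>Derivatives along vector fields\<close>

lemma along_add:
  assumes "smooth f" "smooth g"
  shows "along X (\<lambda>p. f p + g p) = (\<lambda>p. along X f p + along X g p)"
  unfolding along_def
    frechet_derivative_at[OF has_derivative_add[OF assms[THEN smooth_has_derivative]], symmetric]
  by (rule refl)

lemma along_const [simp]: "along X (\<lambda>p. c) = (\<lambda>p. 0)"
  unfolding along_def frechet_derivative_at[OF has_derivative_const, symmetric] by (rule refl)

lemma along_linear:
  "bounded_linear A \<Longrightarrow> smooth f \<Longrightarrow> along X (\<lambda>p. A (f p)) = (\<lambda>p. A (along X f p))"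
  by (simp add: along_def frechet_linear_compose)

lemma along_bilinear:
  assumes "bounded_bilinear B" "smooth f" "smooth g"
  shows "along X (\<lambda>p. B (f p) (g p)) = (\<lambda>p. B (along X f p) (g p) + B (f p) (along X g p))"
proof -
  have "frechet_derivative (\<lambda>p. B (f p) (g p)) (at p) =
      (\<lambda>v. B (f p) (frechet_derivative g (at p) v) + B (frechet_derivative f (at p) v) (g p))" for p
    using frechet_derivative_at[OF bounded_bilinear.FDERIV[OF assms(1) smooth_has_derivative[OF assms(2)]
          smooth_has_derivative[OF assms(3)]]] by simp
  then show ?thesis by (simp add: along_def add.commute)
qed

lemma along_add_field:
  "smooth f \<Longrightarrow> along (\<lambda>p. X p + Y p) f = (\<lambda>p. along X f p + along Y f p)"
  by (simp add: along_def linear_add[OF smooth_linear_derivative])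

lemma along_scale_field:
  "smooth f \<Longrightarrow> along (\<lambda>p. k p *\<^sub>R X p) f = (\<lambda>p. k p *\<^sub>R along X f p)"
  by (simp add: along_def linear_scale[OF smooth_linear_derivative])

text \<open>In the second derivative \<open>X (Y f)\<close> only the first summand distinguishes \<open>X\<close> from \<open>Y\<close>; the sum is the
  Hessian of \<open>f\<close> on \<open>X p\<close> and \<open>Y p\<close>.\<close>

lemma along_along:
  fixes X Y :: "'a::euclidean_space \<Rightarrow> 'a" and f :: "'a \<Rightarrow> 'b::euclidean_space"
  assumes "smooth X" "smooth Y" "smooth f"
  shows "along X (along Y f) p =
    frechet_derivative f (at p) (along X Y p) +
    (\<Sum>b\<in>Basis. (Y p \<bullet> b) *\<^sub>R frechet_derivative (\<lambda>q. frechet_derivative f (at q) b) (at p) (X p))"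
proof -
  have sum: "along X (\<lambda>p. \<Sum>b\<in>I. k b p) = (\<lambda>p. \<Sum>b\<in>I. along X (k b) p)"
    if "finite I" "\<And>b. b \<in> I \<Longrightarrow> smooth (k b)" for I and k :: "'a \<Rightarrow> 'a \<Rightarrow> 'b"
    using that
  proof (induction I rule: finite_induct)
    case (insert i I)
    then show ?case
      using along_add[of "k i" "\<lambda>p. \<Sum>b\<in>I. k b p" X] by (simp add: smooth_sum)
  qed auto
  have sm: "smooth (\<lambda>p. Y p \<bullet> b)" for b
    by (rule smooth_linear_compose[OF bounded_linear_inner_left assms(2)])
  have "along Y f = (\<lambda>p. \<Sum>b\<in>Basis. (Y p \<bullet> b) *\<^sub>R frechet_derivative f (at p) b)"
    unfolding along_def by (intro ext derivative_expansion smooth_linear_derivative assms)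
  then have "along X (along Y f) p =
     (\<Sum>b\<in>Basis. along X (\<lambda>p. (Y p \<bullet> b) *\<^sub>R frechet_derivative f (at p) b) p)"
    by (simp add: sum smooth_scaleR sm smooth_frechet assms)
  also have "\<dots> = (\<Sum>b\<in>Basis. (along X Y p \<bullet> b) *\<^sub>R frechet_derivative f (at p) b +
      (Y p \<bullet> b) *\<^sub>R along X (\<lambda>q. frechet_derivative f (at q) b) p)"
    by (simp add: along_bilinear[OF bounded_bilinear_scaleR] sm smooth_frechet assms
        along_linear[OF bounded_linear_inner_left])
  also have "\<dots> = frechet_derivative f (at p) (along X Y p) +
    (\<Sum>b\<in>Basis. (Y p \<bullet> b) *\<^sub>R frechet_derivative (\<lambda>q. frechet_derivative f (at q) b) (at p) (X p))"
    by (subst (2) derivative_expansion[OF smooth_linear_derivative[OF assms(3)]]) 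
       (simp add: sum.distrib along_def)
  finally show ?thesis .
qed

text \<open>The commutator of two derivations is the derivation along the bracket: the second order
  terms cancel because second derivatives are symmetric.\<close>

lemma along_lie_bracket:
  fixes X Y :: "'a::euclidean_space \<Rightarrow> 'a" and f :: "'a \<Rightarrow> 'b::euclidean_space"
  assumes "smooth X" "smooth Y" "smooth f"
  shows "along (lie_bracket X Y) f p = along X (along Y f) p - along Y (along X f) p"
proof -
  let ?H = "\<lambda>u v. frechet_derivative (\<lambda>q. frechet_derivative f (at q) u) (at p) v"
  have lin: "linear (?H u)" for u
    by (rule smooth_linear_derivative[OF smooth_frechet[OF assms(3)]])
  have "(\<Sum>b\<in>Basis. (u \<bullet> b) *\<^sub>R ?H b v) = ?H u v" for u v
    using derivative_expansion[OF lin, of v u] second_derivative_symmetric[OF assms(3)] by simp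
  then show ?thesis
    using second_derivative_symmetric[OF assms(3), of "X p" p "Y p"]
    by (simp add: along_along assms)
       (simp add: along_def lie_bracket_def linear_diff[OF smooth_linear_derivative[OF assms(3)]])
qed

section \<open>The left-invariant frame and the left-invariant connections\<close>

text \<open>\<open>frame p u\<close> is the value at \<open>p\<close> of the left-invariant field \<open>left_inv u\<close> with value \<open>u\<close> at the unit;
  \<open>hat X\<close> is the field \<open>X\<close> in components with respect to the left-invariant frame. The connection
  \<open>conn B\<close> differentiates components and adds the product \<open>B\<close>, so that
  \<open>conn B (left_inv u) (left_inv v) = left_inv (B u v)\<close>.\<close>

type_synonym 'v rh = "real \<times> 'v"

definition frame :: "'v::euclidean_space rh \<Rightarrow> 'v rh \<Rightarrow> 'v rh" where
  "frame p u = (fst u, exp (fst p) *\<^sub>R snd u)"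

definition coframe :: "'v::euclidean_space rh \<Rightarrow> 'v rh \<Rightarrow> 'v rh" where
  "coframe p u = (fst u, exp (- fst p) *\<^sub>R snd u)"

definition left_inv :: "'v::euclidean_space rh \<Rightarrow> 'v rh \<Rightarrow> 'v rh" where
  "left_inv u = (\<lambda>p. frame p u)"

definition hat :: "('v::euclidean_space rh \<Rightarrow> 'v rh) \<Rightarrow> 'v rh \<Rightarrow> 'v rh" where
  "hat X = (\<lambda>p. coframe p (X p))"

definition br :: "'v::euclidean_space rh \<Rightarrow> 'v rh \<Rightarrow> 'v rh" where
  "br u v = fst u *\<^sub>R v - fst v *\<^sub>R u"

definition conn :: "('v rh \<Rightarrow> 'v rh \<Rightarrow> 'v rh) \<Rightarrow> ('v::euclidean_space rh) connection" where
  "conn B X Y = (if smooth X \<and> smooth Y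
     then (\<lambda>p. frame p (along X (hat Y) p + B (hat X p) (hat Y p))) else (\<lambda>p. 0))"

lemma frame_coframe [simp]: "frame p (coframe p u) = u" "coframe p (frame p u) = u"
  by (simp_all add: frame_def coframe_def exp_minus)

lemma fst_frame [simp]: "fst (frame p u) = fst u" "fst (coframe p u) = fst u"
  by (simp_all add: frame_def coframe_def)

lemma linear_frame: "linear (frame p)" and linear_coframe: "linear (coframe p)"
  by (auto simp: linear_iff frame_def coframe_def algebra_simps)

lemmas frame_linear_simps =
  linear_add[OF linear_frame] linear_diff[OF linear_frame] linear_scale[OF linear_frame] linear_0[OF linear_frame]
lemmas coframe_linear_simps =
  linear_add[OF linear_coframe] linear_diff[OF linear_coframe] linear_scale[OF linear_coframe] linear_0[OF linear_coframe]

lemma frame_eq_iff [simp]: "frame p u = frame p v \<longleftrightarrow> u = v"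
  by (metis frame_coframe(2))

lemma frame_zero_pt [simp]: "fst p = 0 \<Longrightarrow> frame p u = u" "fst p = 0 \<Longrightarrow> coframe p u = u"
  by (simp_all add: frame_def coframe_def)

lemma left_inv_at_0 [simp]: "left_inv u 0 = u"
  by (simp add: left_inv_def)

lemma left_inv_inject [simp]: "left_inv u = left_inv v \<longleftrightarrow> u = v"
  by (metis left_inv_at_0)

lemma hat_left_inv [simp]: "hat (left_inv u) = (\<lambda>p. u)"
  by (simp add: hat_def left_inv_def)

lemma coframe_left_inv [simp]: "coframe p (left_inv u p) = u"
  by (simp add: left_inv_def)

lemma frame_hat [simp]: "frame p (hat X p) = X p"
  by (simp add: hat_def)

lemma hat_frame [simp]: "hat (\<lambda>p. frame p (f p)) = f"
  by (simp add: hat_def)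

lemma fst_hat [simp]: "fst (hat X p) = fst (X p)"
  by (simp add: hat_def)

lemma left_inv_linear_simps:
  "left_inv (u + v) = (\<lambda>p. left_inv u p + left_inv v p)"
  "left_inv (c *\<^sub>R u) = (\<lambda>p. c *\<^sub>R left_inv u p)"
  by (simp_all add: left_inv_def frame_linear_simps)

lemma rh_algebra_eq: "rh_algebra = range (left_inv :: _ \<Rightarrow> 'v::euclidean_space rh \<Rightarrow> _)"
proof -
  have "(\<lambda>(a, b) p. (a, exp (fst p) *\<^sub>R (b :: 'v))) = left_inv"
    by (auto simp: left_inv_def frame_def fun_eq_iff)
  then show ?thesis unfolding lie_algebra_rh by simp
qed

lemma left_inv_in [simp]: "left_inv u \<in> rh_algebra"
  by (simp add: rh_algebra_eq)

lemma rh_algebra_at_0: "X \<in> rh_algebra \<Longrightarrow> left_inv (X 0) = X"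
  by (auto simp: rh_algebra_eq)

lemma smooth_frame:
  fixes f :: "'v::euclidean_space rh \<Rightarrow> 'v rh"
  assumes f: "smooth f"
  shows "smooth (\<lambda>p. frame p (f p))" "smooth (\<lambda>p. coframe p (f p))"
proof -
  have b: "bounded_linear (fst :: 'v rh \<Rightarrow> real)" "bounded_linear (\<lambda>p :: 'v rh. - fst p)"
    "bounded_linear (\<lambda>u :: 'v rh. (fst u, 0 :: 'v))" "bounded_linear (\<lambda>u :: 'v rh. (0 :: real, snd u))"
    by (simp_all add: linear_conv_bounded_linear[symmetric] linear_iff)
  have e: "smooth (\<lambda>p :: 'v rh. exp (c p))" if "bounded_linear c" for c :: "'v rh \<Rightarrow> real"
    using smooth_exp_affine[OF that bounded_linear_zero, of "1::real"] by simp
  have "smooth (\<lambda>p. (fst (f p), 0 :: 'v) + exp (c p) *\<^sub>R (0, snd (f p)))" if c: "bounded_linear c"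
    for c :: "'v rh \<Rightarrow> real"
    by (rule smooth_add[OF smooth_linear_compose[OF b(3) f]
          smooth_scaleR[OF e[OF c] smooth_linear_compose[OF b(4) f]]])
  from this[OF b(1)] this[OF b(2)]
  show "smooth (\<lambda>p. frame p (f p))" "smooth (\<lambda>p. coframe p (f p))"
    by (simp_all add: frame_def coframe_def)
qed

lemma smooth_hat_iff [simp]: "smooth (hat X) \<longleftrightarrow> smooth X"
  using smooth_frame(1)[of "hat X"] smooth_frame(2)[of X] by (auto simp: hat_def)

lemma smooth_frame_iff [simp]: "smooth (\<lambda>p. frame p (f p)) \<longleftrightarrow> smooth f"
  using smooth_hat_iff[of "\<lambda>p. frame p (f p)"] by (simp del: smooth_hat_iff)

lemma smooth_left_inv [simp]: "smooth (left_inv u)"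
  by (simp add: left_inv_def)

lemma bilinear_bounded:
  fixes B :: "'a::euclidean_space \<Rightarrow> 'b::euclidean_space \<Rightarrow> 'c::real_normed_vector"
  shows "bilinear B \<Longrightarrow> bounded_bilinear B"
  by (simp add: bilinear_conv_bounded_bilinear)

text \<open>The second summand comes from the derivative of the factor \<open>exp (fst p)\<close> of the frame. Its
  antisymmetrization is the bracket of the Lie algebra.\<close>

lemma along_frame:
  fixes f :: "'v::euclidean_space rh \<Rightarrow> 'v rh"
  assumes f: "smooth f"
  shows "along X (\<lambda>p. frame p (f p)) p = frame p (along X f p + (0, fst (X p) *\<^sub>R snd (f p)))"
proof -
  have "((\<lambda>p. frame p (f p)) has_derivative
    (\<lambda>u. frame p (frechet_derivative f (at p) u + (0, fst u *\<^sub>R snd (f p))))) (at p)"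
  proof -
    note d = smooth_has_derivative[OF f, of p]
    have "((\<lambda>p. (fst (f p), exp (fst p) *\<^sub>R snd (f p))) has_derivative
      (\<lambda>u. (fst (frechet_derivative f (at p) u),
        exp (fst p) *\<^sub>R snd (frechet_derivative f (at p) u) + (exp (fst p) * fst u) *\<^sub>R snd (f p)))) (at p)"
      by (auto intro!: derivative_eq_intros d)
    moreover have "(\<lambda>u. (fst (frechet_derivative f (at p) u),
        exp (fst p) *\<^sub>R snd (frechet_derivative f (at p) u) + (exp (fst p) * fst u) *\<^sub>R snd (f p))) =
      (\<lambda>u. frame p (frechet_derivative f (at p) u + (0, fst u *\<^sub>R snd (f p))))"
      by (simp add: frame_def scaleR_add_right)
    ultimately show ?thesis by (simp add: frame_def)
  qed
  from frechet_derivative_at[OF this, symmetric] show ?thesis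
    by (simp add: along_def)
qed

lemma along_eq_frame:
  assumes "smooth Y"
  shows "along X Y p = frame p (along X (hat Y) p + (0, fst (X p) *\<^sub>R snd (hat Y p)))"
  using along_frame[of "hat Y" X p] assms by simp

lemma lie_bracket_frame:
  assumes "smooth X" "smooth Y"
  shows "lie_bracket X Y p = frame p (along X (hat Y) p - along Y (hat X) p + br (hat X p) (hat Y p))"
proof -
  have "(0, fst (X p) *\<^sub>R snd (hat Y p)) - (0, fst (Y p) *\<^sub>R snd (hat X p)) = br (hat X p) (hat Y p)"
    by (simp add: br_def prod_eq_iff)
  then show ?thesis
    using assms by (simp only: lie_bracket_def along_eq_frame frame_linear_simps(2)[symmetric] add_diff_add)
qed

lemma lie_bracket_left_inv: "lie_bracket (left_inv u) (left_inv v) = left_inv (br u v)"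
  by (rule ext) (simp add: lie_bracket_frame, simp add: left_inv_def)

lemma smooth_lie_bracket: "smooth X \<Longrightarrow> smooth Y \<Longrightarrow> smooth (lie_bracket X Y)"
  unfolding lie_bracket_def by (intro smooth_diff smooth_along)

lemma hat_add: "hat (\<lambda>p. X p + Y p) = (\<lambda>p. hat X p + hat Y p)"
  and hat_scale: "hat (\<lambda>p. f p *\<^sub>R X p) = (\<lambda>p. f p *\<^sub>R hat X p)"
  by (simp_all add: hat_def coframe_linear_simps)

lemma hat_conn:
  "smooth X \<Longrightarrow> smooth Y \<Longrightarrow> hat (conn B X Y) = (\<lambda>p. along X (hat Y) p + B (hat X p) (hat Y p))"
  by (simp add: conn_def)

lemma conn_left_inv [simp]: "conn B (left_inv u) (left_inv v) = left_inv (B u v)"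
  by (simp add: conn_def) (simp add: left_inv_def)

lemma smooth_conn: 
  assumes B: "bilinear B" and "smooth X" "smooth Y"
  shows "smooth (conn B X Y)"
proof -
  have "smooth (\<lambda>p. along X (hat Y) p + B (hat X p) (hat Y p))"
    using assms by (intro smooth_add smooth_along smooth_bilinear[OF bilinear_bounded[OF B]]) auto
  then show ?thesis using assms by (simp add: conn_def)
qed

lemma affine_connection_conn:
  fixes B :: "'v::euclidean_space rh \<Rightarrow> 'v rh \<Rightarrow> 'v rh"
  assumes B: "bilinear B"
  shows "affine_connection (conn B)"
proof -
  note B_simps = bilinear_ladd[OF B] bilinear_radd[OF B] bilinear_lmul[OF B] bilinear_rmul[OF B]
  have 1: "conn B (\<lambda>p. X p + X' p) Y = (\<lambda>p. conn B X Y p + conn B X' Y p)"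
    if "smooth X" "smooth X'" "smooth Y" for X X' Y
    using that by (simp add: conn_def smooth_add hat_add along_add_field B_simps frame_linear_simps algebra_simps)
  have 2: "conn B X (\<lambda>p. Y p + Y' p) = (\<lambda>p. conn B X Y p + conn B X Y' p)"
    if "smooth X" "smooth Y" "smooth Y'" for X Y Y'
    using that by (simp add: conn_def smooth_add hat_add along_add B_simps frame_linear_simps algebra_simps)
  have 3: "conn B (\<lambda>p. f p *\<^sub>R X p) Y = (\<lambda>p. f p *\<^sub>R conn B X Y p)"
    if "smooth f" "smooth X" "smooth Y" for X Y f
    using that by (simp add: conn_def smooth_scaleR hat_scale along_scale_field B_simps frame_linear_simps algebra_simps)
  have 4: "conn B X (\<lambda>p. f p *\<^sub>R Y p) = (\<lambda>p. along X f p *\<^sub>R Y p + f p *\<^sub>R conn B X Y p)"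
    if "smooth f" "smooth X" "smooth Y" for X Y f
  proof -
    have "along X (\<lambda>p. f p *\<^sub>R hat Y p) = (\<lambda>p. along X f p *\<^sub>R hat Y p + f p *\<^sub>R along X (hat Y) p)"
      using that by (intro along_bilinear[OF bounded_bilinear_scaleR]) auto
    then show ?thesis
      using that by (simp add: conn_def smooth_scaleR hat_scale B_simps frame_linear_simps algebra_simps)
  qed
  show ?thesis
    unfolding affine_connection_def
    using 1 2 3 4 smooth_conn[OF B] by (auto simp: conn_def)
qed

text \<open>Expand both fields in the left-invariant frame. The Leibniz rule produces the derivative of the
  components of \<open>Y\<close>; the remaining term is linear over functions in both fields, so it depends
  on their values at \<open>p\<close> only.\<close>

lemma affine_connection_frame:
  fixes D :: "('v::euclidean_space rh) connection"
  assumes D: "affine_connection D" and X: "smooth X" and Y: "smooth Y"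
  shows "D X Y p = frame p (along X (hat Y) p) + D (left_inv (hat X p)) (left_inv (hat Y p)) p"
proof -
  have add1: "D (\<lambda>p. X p + X' p) Y = (\<lambda>p. D X Y p + D X' Y p)"
    and add2: "D Y (\<lambda>p. X p + X' p) = (\<lambda>p. D Y X p + D Y X' p)"
    if "smooth X" "smooth X'" "smooth Y" for X X' Y
    using D that unfolding affine_connection_def by auto
  have sc1: "D (\<lambda>p. f p *\<^sub>R X p) Y = (\<lambda>p. f p *\<^sub>R D X Y p)"
    and sc2: "D X (\<lambda>p. f p *\<^sub>R Y p) = (\<lambda>p. along X f p *\<^sub>R Y p + f p *\<^sub>R D X Y p)"
    if "smooth X" "smooth f" "smooth Y" for X Y and f :: "'v rh \<Rightarrow> real"
    using D that unfolding affine_connection_def by auto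
  have z1: "D (\<lambda>p. 0) Y = (\<lambda>p. 0)" and z2: "D Y (\<lambda>p. 0) = (\<lambda>p. 0)" if "smooth Y" for Y
    using sc1[of Y "\<lambda>p. 0" Y] sc2[of Y "\<lambda>p. 0" Y] that by auto
  have sum1: "D (\<lambda>p. \<Sum>i\<in>I. f i p *\<^sub>R X i p) Y = (\<lambda>p. \<Sum>i\<in>I. f i p *\<^sub>R D (X i) Y p)"
    if "finite I" "\<And>i. i \<in> I \<Longrightarrow> smooth (f i)" "\<And>i. i \<in> I \<Longrightarrow> smooth (X i)" "smooth Y"
    for I and f :: "'v rh \<Rightarrow> 'v rh \<Rightarrow> real" and X Y
    using that
  proof (induction I rule: finite_induct)
    case (insert i I)
    have i: "smooth (f i)" "smooth (X i)" and I: "\<And>j. j \<in> I \<Longrightarrow> smooth (\<lambda>p. f j p *\<^sub>R X j p)"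
      using insert.prems by (simp_all add: smooth_scaleR del: split_paired_All)
    show ?case using insert.IH insert.hyps insert.prems i smooth_scaleR[OF i] smooth_sum[OF insert.hyps(1) I] by (simp add: add1 sc1)
  qed (simp add: z1)
  have sum2: "D X (\<lambda>p. \<Sum>i\<in>I. f i p *\<^sub>R Y i p) =
       (\<lambda>p. \<Sum>i\<in>I. along X (f i) p *\<^sub>R Y i p + f i p *\<^sub>R D X (Y i) p)"
    if "finite I" "\<And>i. i \<in> I \<Longrightarrow> smooth (f i)" "\<And>i. i \<in> I \<Longrightarrow> smooth (Y i)" "smooth X"
    for I and f :: "'v rh \<Rightarrow> 'v rh \<Rightarrow> real" and X Y
    using that
  proof (induction I rule: finite_induct)
    case (insert i I)
    have i: "smooth (f i)" "smooth (Y i)" and I: "\<And>j. j \<in> I \<Longrightarrow> smooth (\<lambda>p. f j p *\<^sub>R Y j p)"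
      using insert.prems by (simp_all add: smooth_scaleR del: split_paired_All)
    show ?case using insert.IH insert.hyps insert.prems i smooth_scaleR[OF i] smooth_sum[OF insert.hyps(1) I] by (simp add: add2 sc2)
  qed (simp add: z2)
  let ?x = "\<lambda>X b p. hat X p \<bullet> b"
  have exp_hat: "X = (\<lambda>p. \<Sum>b\<in>Basis. ?x X b p *\<^sub>R left_inv b p)" for X :: "'v rh \<Rightarrow> 'v rh"
  proof
    fix p
    have "X p = frame p (hat X p)" by simp
    also have "\<dots> = (\<Sum>b\<in>Basis. ?x X b p *\<^sub>R left_inv b p)"
      unfolding left_inv_def by (rule derivative_expansion[OF linear_frame])
    finally show "X p = (\<Sum>b\<in>Basis. ?x X b p *\<^sub>R left_inv b p)" .
  qed
  have sx: "smooth (?x X b)" if "smooth X" for X :: "'v rh \<Rightarrow> 'v rh" and b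
    by (rule smooth_linear_compose[OF bounded_linear_inner_left]) (use that in simp)
  have general: "D X Y p = (\<Sum>b\<in>Basis. along X (?x Y b) p *\<^sub>R left_inv b p) +
      (\<Sum>b\<in>Basis. ?x Y b p *\<^sub>R (\<Sum>a\<in>Basis. ?x X a p *\<^sub>R D (left_inv a) (left_inv b) p))"
    if X: "smooth X" and Y: "smooth Y" for X Y
  proof -
    have "D X Y p = (\<Sum>b\<in>Basis. along X (?x Y b) p *\<^sub>R left_inv b p + ?x Y b p *\<^sub>R D X (left_inv b) p)"
      by (subst (1) exp_hat[of Y], subst sum2) (simp_all add: sx X Y)
    moreover have "D X (left_inv b) p = (\<Sum>a\<in>Basis. ?x X a p *\<^sub>R D (left_inv a) (left_inv b) p)" for b
      by (subst (1) exp_hat[of X], subst sum1) (simp_all add: sx X Y)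
    ultimately show ?thesis by (simp add: sum.distrib)
  qed
  have "along X (?x Y b) p = along X (hat Y) p \<bullet> b" for b
    using along_linear[OF bounded_linear_inner_left, of "hat Y" X b] Y by simp
  then have "(\<Sum>b\<in>Basis. along X (?x Y b) p *\<^sub>R left_inv b p) = frame p (along X (hat Y) p)"
    unfolding left_inv_def by (simp add: derivative_expansion[OF linear_frame, of p "along X (hat Y) p"])
  moreover have "(\<Sum>b\<in>Basis. ?x Y b p *\<^sub>R (\<Sum>a\<in>Basis. ?x X a p *\<^sub>R D (left_inv a) (left_inv b) p)) =
      D (left_inv (hat X p)) (left_inv (hat Y p)) p"
    using general[of "left_inv (hat X p)" "left_inv (hat Y p)"] by simp
  ultimately show ?thesis using general[OF X Y] by simp
qed

lemma affine_connection_eqI: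
  fixes D :: "('v::euclidean_space rh) connection"
  assumes D: "affine_connection D" and D': "affine_connection D'"
    and eq: "\<And>u v p. D (left_inv u) (left_inv v) p = D' (left_inv u) (left_inv v) p"
  shows "D = D'"
proof (intro ext)
  fix X Y p
  show "D X Y p = D' X Y p"
  proof (cases "smooth X \<and> smooth Y")
    case True
    then show ?thesis
      using affine_connection_frame[OF D, of X Y p] affine_connection_frame[OF D', of X Y p] eq by simp
  next
    case False
    then show ?thesis
      using D D' unfolding affine_connection_def by simp
  qed
qed

lemma torsion_free_conn:
  "torsion_free (conn B) \<longleftrightarrow> (\<forall>u v. B u v - B v u = br u v)"
proof
  assume t: "torsion_free (conn B)"
  show "\<forall>u v. B u v - B v u = br u v"
  proof (intro allI)
    fix u v
    have "(\<lambda>p. conn B (left_inv u) (left_inv v) p - conn B (left_inv v) (left_inv u) p) =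
        lie_bracket (left_inv u) (left_inv v)"
      using t unfolding torsion_free_def by (blast intro: CollectI smooth_left_inv)
    then have "left_inv (B u v) 0 - left_inv (B v u) 0 = left_inv (br u v) 0"
      unfolding lie_bracket_left_inv conn_left_inv by (rule fun_cong)
    then show "B u v - B v u = br u v" by simp
  qed
next
  assume br: "\<forall>u v. B u v - B v u = br u v"
  show "torsion_free (conn B)"
    by (simp add: torsion_free_def conn_def lie_bracket_frame fun_eq_iff frame_linear_simps(2)[symmetric]
        add_diff_add br del: split_paired_All)
qed

definition curv ::
    "('v::euclidean_space rh \<Rightarrow> 'v rh \<Rightarrow> 'v rh) \<Rightarrow> 'v rh \<Rightarrow> 'v rh \<Rightarrow> 'v rh \<Rightarrow> 'v rh" where
  "curv B u v w = B u (B v w) - B v (B u w) - B (br u v) w"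

text \<open>For fields with varying components the terms with first derivatives cancel because \<open>B\<close> is bilinear,
  and those with second derivatives because \<open>[X, Y]\<close> acts as the commutator.\<close>

lemma curvature_conn:
  fixes B :: "'v::euclidean_space rh \<Rightarrow> 'v rh \<Rightarrow> 'v rh"
  assumes B: "bilinear B" and X: "smooth X" and Y: "smooth Y" and Z: "smooth Z"
  shows "curvature (conn B) X Y Z p = frame p (curv B (hat X p) (hat Y p) (hat Z p))"
proof -
  note B_simps = bilinear_ladd[OF B] bilinear_radd[OF B] bilinear_lsub[OF B] bilinear_rsub[OF B]
  have alongB: "along X (\<lambda>p. B (hat Y p) (hat Z p)) p = B (along X (hat Y) p) (hat Z p) + B (hat Y p) (along X (hat Z) p)"
    if "smooth Y" "smooth Z" for X Y Z p
    using along_bilinear[OF bilinear_bounded[OF B], of "hat Y" "hat Z" X] that by simp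
  have DD: "conn B X (conn B Y Z) p = frame p (along X (along Y (hat Z)) p +
      B (along X (hat Y) p) (hat Z p) + B (hat Y p) (along X (hat Z) p) +
      B (hat X p) (along Y (hat Z) p) + B (hat X p) (B (hat Y p) (hat Z p)))"
    if X: "smooth X" and Y: "smooth Y" and Z: "smooth Z" for X Y Z
  proof -
    have "smooth (along Y (hat Z))" "smooth (\<lambda>p. B (hat Y p) (hat Z p))"
      using Y Z by (auto intro!: smooth_along smooth_bilinear[OF bilinear_bounded[OF B]])
    then have "along X (\<lambda>p. along Y (hat Z) p + B (hat Y p) (hat Z p)) p =
        along X (along Y (hat Z)) p + (B (along X (hat Y) p) (hat Z p) + B (hat Y p) (along X (hat Z) p))"
      by (simp add: along_add alongB[OF Y Z])
    then show ?thesis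
      using X smooth_conn[OF B Y Z] unfolding conn_def[of B X]
      by (simp add: hat_conn[OF Y Z] B_simps)
  qed
  have "conn B (lie_bracket X Y) Z p = frame p (along X (along Y (hat Z)) p - along Y (along X (hat Z)) p +
      B (along X (hat Y) p) (hat Z p) - B (along Y (hat X) p) (hat Z p) + B (br (hat X p) (hat Y p)) (hat Z p))"
  proof -
    have "hat (lie_bracket X Y) p = along X (hat Y) p - along Y (hat X) p + br (hat X p) (hat Y p)"
      by (simp add: hat_def lie_bracket_frame[OF X Y])
    then show ?thesis
      using X Y Z by (simp add: conn_def smooth_lie_bracket along_lie_bracket B_simps)
  qed
  then show ?thesis
    unfolding curvature_def DD[OF X Y Z] DD[OF Y X Z]
    by (simp add: curv_def algebra_simps flip: frame_linear_simps)
qed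

lemma curvature_conn_left_inv:
  "curvature (conn B) (left_inv u) (left_inv v) (left_inv w) = left_inv (curv B u v w)"
  unfolding curvature_def lie_bracket_left_inv conn_left_inv
  by (simp add: left_inv_def curv_def frame_linear_simps)

(* Quantified elements of 'v rh are vectors; they should not be split into pairs. *)
declare split_paired_All [simp del] split_paired_Ex [simp del]

section \<open>Inner products and symmetric trilinear forms\<close>

definition inner_product :: "('a::euclidean_space \<Rightarrow> 'a \<Rightarrow> real) \<Rightarrow> bool" where
  "inner_product m \<longleftrightarrow> bilinear m \<and> (\<forall>u v. m u v = m v u) \<and> (\<forall>u. u \<noteq> 0 \<longrightarrow> m u u > 0)"

definition sym_trilinear :: "('a::euclidean_space \<Rightarrow> 'a \<Rightarrow> 'a \<Rightarrow> real) \<Rightarrow> bool" where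
  "sym_trilinear c \<longleftrightarrow>
     (\<forall>u v. linear (c u v)) \<and> (\<forall>u v w. c u v w = c v u w \<and> c u v w = c u w v)"

lemma inner_product_bilinear: "inner_product m \<Longrightarrow> bilinear m"
  and inner_product_commute: "inner_product m \<Longrightarrow> m u v = m v u"
  by (auto simp: inner_product_def)

lemma inner_product_linear: "inner_product m \<Longrightarrow> linear (m u)"
  by (simp add: inner_product_def bilinear_def)

lemma inner_product_simps:
  assumes "inner_product m"
  shows "m (u + v) w = m u w + m v w" "m w (u + v) = m w u + m w v"
    "m (u - v) w = m u w - m v w" "m w (u - v) = m w u - m w v"
    "m (k *\<^sub>R u) w = k * m u w" "m w (k *\<^sub>R u) = k * m w u"
    "m 0 w = 0" "m w 0 = 0" "m (- u) w = - m u w" "m w (- u) = - m w u"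
  using inner_product_bilinear[OF assms]
  by (simp_all add: bilinear_ladd bilinear_radd bilinear_lsub bilinear_rsub bilinear_lmul bilinear_rmul
      bilinear_lzero bilinear_rzero bilinear_lneg bilinear_rneg)

lemma inner_product_eqI:
  assumes m: "inner_product m" and eq: "\<And>w. m u w = m v w"
  shows "u = v"
proof (rule ccontr)
  assume "u \<noteq> v"
  then have "m (u - v) (u - v) > 0" using m by (simp add: inner_product_def)
  then show False using eq[of "u - v"] by (simp add: inner_product_simps[OF m])
qed

lemma sym_trilinear_commute:
  assumes "sym_trilinear c"
  shows "c u v w = c v u w" "c u v w = c u w v"
  using assms by (auto simp: sym_trilinear_def)

lemma sym_trilinear_linear:
  assumes "sym_trilinear c"
  shows "linear (\<lambda>u. c u v w)" "linear (\<lambda>v. c u v w)" "linear (\<lambda>w. c u v w)"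
proof -
  have lin: "linear (c u v)" for u v using assms by (simp add: sym_trilinear_def)
  have "(\<lambda>u. c u v w) = c v w" "(\<lambda>v. c u v w) = c u w"
    using sym_trilinear_commute[OF assms] by (intro ext; metis)+
  then show "linear (\<lambda>u. c u v w)" "linear (\<lambda>v. c u v w)" "linear (\<lambda>w. c u v w)"
    using lin[of v w] lin[of u w] lin[of u v] by (simp_all only:)
qed

lemma sym_trilinear_simps:
  assumes "sym_trilinear c"
  shows "c (u + u') v w = c u v w + c u' v w" "c v (u + u') w = c v u w + c v u' w"
    "c v w (u + u') = c v w u + c v w u'"
    "c (u - u') v w = c u v w - c u' v w" "c v (u - u') w = c v u w - c v u' w"
    "c v w (u - u') = c v w u - c v w u'"
    "c (k *\<^sub>R u) v w = k * c u v w" "c v (k *\<^sub>R u) w = k * c v u w" "c v w (k *\<^sub>R u) = k * c v w u"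
    "c 0 v w = 0" "c v 0 w = 0" "c v w 0 = 0"
    "c (- u) v w = - c u v w" "c v (- u) w = - c v u w" "c v w (- u) = - c v w u"
  using sym_trilinear_linear[OF assms, THEN linear_add] sym_trilinear_linear[OF assms, THEN linear_diff]
    sym_trilinear_linear[OF assms, THEN linear_scale] sym_trilinear_linear[OF assms, THEN linear_0]
    sym_trilinear_linear[OF assms, THEN linear_neg]
  by simp_all

definition riesz :: "('a::euclidean_space \<Rightarrow> 'a \<Rightarrow> real) \<Rightarrow> ('a \<Rightarrow> real) \<Rightarrow> 'a" where
  "riesz m f = (THE z. \<forall>w. m z w = f w)"

text \<open>An inner product is nondegenerate, so \<open>z \<mapsto> m z\<close> is an injective linear map between spaces
  of the same dimension. In the proof, linear forms are represented by their values on \<open>Basis\<close>.\<close>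

lemma riesz:
  assumes m: "inner_product m" and f: "linear f"
  shows "m (riesz m f) w = f w"
proof -
  let ?A = "\<lambda>z. \<Sum>b\<in>Basis. m z b *\<^sub>R b"
  have eqI: "u = v" if "\<And>b. b \<in> Basis \<Longrightarrow> m u b = m v b" for u v
  proof (rule inner_product_eqI[OF m])
    fix w
    show "m u w = m v w"
      using that by (subst (1 2) derivative_expansion[OF inner_product_linear[OF m]]) simp
  qed
  have lin: "linear ?A"
    by (auto simp: linear_iff inner_product_simps[OF m] sum.distrib scaleR_sum_right algebra_simps)
  have "inj ?A"
  proof (rule injI)
    fix u v assume "?A u = ?A v"
    then have "?A u \<bullet> b = ?A v \<bullet> b" for b by simp
    then show "u = v" by (intro eqI) (metis inner_sum_left_Basis)
  qed
  then have "surj ?A" by (intro linear_injective_imp_surjective[OF lin]) simp_all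
  from surjD[OF this, of "\<Sum>b\<in>Basis. f b *\<^sub>R b"]
  obtain z where z: "?A z = (\<Sum>b\<in>Basis. f b *\<^sub>R b)" by auto
  have zb: "m z b = f b" if "b \<in> Basis" for b
    using arg_cong[OF z, of "\<lambda>x. x \<bullet> b"] that by (simp add: inner_sum_left_Basis)
  have zw: "\<forall>w. m z w = f w"
  proof
    fix w
    have "m z w = (\<Sum>b\<in>Basis. (w \<bullet> b) *\<^sub>R m z b)"
      by (rule derivative_expansion[OF inner_product_linear[OF m]])
    also have "\<dots> = (\<Sum>b\<in>Basis. (w \<bullet> b) *\<^sub>R f b)" by (simp add: zb)
    also have "\<dots> = f w" by (rule derivative_expansion[OF f, symmetric])
    finally show "m z w = f w" .
  qed
  have "riesz m f = z"
    unfolding riesz_def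
  proof (rule the_equality, rule zw)
    fix z' assume "\<forall>w. m z' w = f w"
    then show "z' = z" using zw by (intro inner_product_eqI[OF m]) simp
  qed
  then show ?thesis using zw by simp
qed

section \<open>The statistical structure of an inner product and a cubic form\<close>

text \<open>The Koszul formula for left-invariant fields, with the inner products of the brackets inserted: as
  \<open>br u v = fst u *\<^sub>R v - fst v *\<^sub>R u\<close>, most of its terms cancel. The gradient \<open>grad m\<close> plays the part of
  \<open>e\<^sub>1\<close>: it is orthogonal to the kernel of \<open>fst\<close>, but of length one only if \<open>fst (grad m) = 1\<close>.\<close>

definition stat_mult ::
    "('v rh \<Rightarrow> 'v rh \<Rightarrow> real) \<Rightarrow> ('v rh \<Rightarrow> 'v rh \<Rightarrow> 'v rh \<Rightarrow> real) \<Rightarrow>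
     'v::euclidean_space rh \<Rightarrow> 'v rh \<Rightarrow> 'v rh" where
  "stat_mult m c u v = riesz m (\<lambda>w. m u v * fst w - fst v * m u w - c u v w / 2)"

definition grad :: "('v rh \<Rightarrow> 'v rh \<Rightarrow> real) \<Rightarrow> 'v::euclidean_space rh" where
  "grad m = riesz m fst"

context
  fixes m :: "'v::euclidean_space rh \<Rightarrow> 'v rh \<Rightarrow> real"
  assumes m: "inner_product m"
begin

lemma grad: "m (grad m) w = fst w" "m w (grad m) = fst w"
  using riesz[OF m, of fst w] inner_product_commute[OF m] by (simp_all add: grad_def linear_fst)

lemma fst_grad_pos: "fst (grad m) > 0"
proof -
  have "grad m \<noteq> 0" using grad(1)[of "(1, 0)"] by (auto simp: inner_product_simps[OF m])
  then have "m (grad m) (grad m) > 0" using m by (simp add: inner_product_def)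
  then show ?thesis by (simp add: grad)
qed

lemma stat_mult:
  assumes c: "sym_trilinear c"
  shows "m (stat_mult m c u v) w = m u v * fst w - fst v * m u w - c u v w / 2"
  unfolding stat_mult_def
  by (rule riesz[OF m])
     (simp add: linear_iff inner_product_simps[OF m] sym_trilinear_simps[OF c] algebra_simps add_divide_distrib)

lemma bilinear_stat_mult:
  assumes c: "sym_trilinear c"
  shows "bilinear (stat_mult m c)"
  unfolding bilinear_def linear_iff
  by (intro conjI allI inner_product_eqI[OF m]; simp add: stat_mult[OF c] inner_product_simps[OF m]
      sym_trilinear_simps[OF c] algebra_simps add_divide_distrib)

lemma stat_mult_torsion:
  assumes c: "sym_trilinear c"
  shows "stat_mult m c u v - stat_mult m c v u = br u v"
  by (rule inner_product_eqI[OF m])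
     (simp add: stat_mult[OF c] inner_product_simps[OF m] br_def inner_product_commute[OF m, of u v]
       sym_trilinear_commute(1)[OF c, of u v])

lemma stat_mult_cubic:
  assumes c: "sym_trilinear c"
  shows "- m (stat_mult m c u v) w - m v (stat_mult m c u w) = c u v w"
  by (simp add: stat_mult[OF c] inner_product_commute[OF m, of v] sym_trilinear_commute(2)[OF c, of u w v])

text \<open>Koszul's argument: torsion-freeness and the cubic form allow permuting the arguments of
  \<open>m (B u v) w\<close>, and going once around all cyclic permutations expresses the value by known
  terms.\<close>

lemma stat_mult_unique:
  assumes c: "sym_trilinear c"
    and torsion: "\<And>u v. B u v - B v u = br u v"
    and cubic: "\<And>u v w. - m (B u v) w - m v (B u w) = c u v w"
  shows "B u v = stat_mult m c u v"
proof (rule inner_product_eqI[OF m])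
  fix w
  have t: "m (B a b) d = m (B b a) d + m (br a b) d" for a b d
    using torsion[of a b] by (metis add.commute diff_add_cancel inner_product_simps(1)[OF m])
  have c': "m (B a b) d = - m (B a d) b - c a b d" for a b d
    using cubic[of a b d] inner_product_commute[OF m, of b] by simp
  note sym = sym_trilinear_commute[OF c] 
  have "c w u v = c u v w" "c v w u = c u v w" using sym by metis+
  then show "m (B u v) w = m (stat_mult m c u v) w"
    using c'[of u v w] t[of u w v] c'[of w u v] t[of w v u] c'[of v w u] t[of v u w]
    by (simp add: stat_mult[OF c] br_def inner_product_simps[OF m] inner_product_commute[OF m, of _ u]
        inner_product_commute[OF m, of w v])
qed

end

definition metric_of :: "('v rh \<Rightarrow> 'v rh \<Rightarrow> real) \<Rightarrow> ('v::euclidean_space rh) metric" where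
  "metric_of m = (\<lambda>p u v. m (coframe p u) (coframe p v))"

definition tensor_of ::
    "('v rh \<Rightarrow> 'v rh \<Rightarrow> 'v rh \<Rightarrow> real) \<Rightarrow>
     'v::euclidean_space rh \<Rightarrow> 'v rh \<Rightarrow> 'v rh \<Rightarrow> 'v rh \<Rightarrow> real" where
  "tensor_of c = (\<lambda>p u v w. c (coframe p u) (coframe p v) (coframe p w))"

lemma metric_of_hat [simp]: "metric_of m p (X p) (Y p) = m (hat X p) (hat Y p)"
  by (simp add: metric_of_def hat_def)

lemma metric_of_frame [simp]: "metric_of m p (frame p u) (frame p v) = m u v"
  "metric_of m p (frame p u) (Y p) = m u (hat Y p)" "metric_of m p (X p) (frame p v) = m (hat X p) v"
  by (simp_all add: metric_of_def hat_def)

lemma tensor_of_hat: "tensor_of c p (X p) (Y p) (Z p) = c (hat X p) (hat Y p) (hat Z p)"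
  by (simp add: tensor_of_def hat_def)

lemma riemannian_metric_of:
  assumes m: "inner_product m"
  shows "riemannian_metric (metric_of m)"
proof -
  have "bilinear (metric_of m p)" for p
    unfolding bilinear_def linear_iff
    by (simp add: metric_of_def inner_product_simps[OF m] coframe_linear_simps)
  moreover have "smooth (\<lambda>p. metric_of m p u v)" for u v
    unfolding metric_of_def
    by (intro smooth_bilinear[OF bilinear_bounded[OF inner_product_bilinear[OF m]]] smooth_frame smooth_const)
  moreover have "metric_of m p u u > 0" if "u \<noteq> 0" for p u
  proof -
    have "coframe p u \<noteq> 0" using that by (metis coframe_linear_simps(4) frame_coframe(1) frame_linear_simps(4))
    then show ?thesis using m by (simp add: metric_of_def inner_product_def)
  qed
  moreover have "metric_of m p u v = metric_of m p v u" for p u v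
    unfolding metric_of_def by (rule inner_product_commute[OF m])
  ultimately show ?thesis unfolding riemannian_metric_def by blast
qed

lemma along_metric_of:
  assumes m: "inner_product m" and "smooth Y" "smooth Z"
  shows "along X (\<lambda>q. metric_of m q (Y q) (Z q)) =
    (\<lambda>p. m (along X (hat Y) p) (hat Z p) + m (hat Y p) (along X (hat Z) p))"
  using along_bilinear[OF bilinear_bounded[OF inner_product_bilinear[OF m]], of "hat Y" "hat Z" X] assms(2,3)
  by simp

lemma nabla_metric_conn:
  assumes m: "inner_product m" and "smooth X" "smooth Y" "smooth Z"
  shows "nabla_metric (conn B) (metric_of m) X Y Z p =
    - m (B (hat X p) (hat Y p)) (hat Z p) - m (hat Y p) (B (hat X p) (hat Z p))"
  using along_metric_of[OF m assms(3,4), of X] assms(2-)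
  by (simp add: nabla_metric_def conn_def inner_product_simps[OF m])

lemma conn_stat_mult:
  assumes m: "inner_product m" and c: "sym_trilinear c"
  shows "affine_connection (conn (stat_mult m c))" "torsion_free (conn (stat_mult m c))"
    "smooth X \<Longrightarrow> smooth Y \<Longrightarrow> smooth Z \<Longrightarrow>
      nabla_metric (conn (stat_mult m c)) (metric_of m) X Y Z = (\<lambda>p. c (hat X p) (hat Y p) (hat Z p))"
proof -
  show "affine_connection (conn (stat_mult m c))"
    by (rule affine_connection_conn[OF bilinear_stat_mult[OF m c]])
  show "torsion_free (conn (stat_mult m c))"
    unfolding torsion_free_conn using stat_mult_torsion[OF m c] by blast
  show "smooth X \<Longrightarrow> smooth Y \<Longrightarrow> smooth Z \<Longrightarrow>
      nabla_metric (conn (stat_mult m c)) (metric_of m) X Y Z = (\<lambda>p. c (hat X p) (hat Y p) (hat Z p))"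
    by (rule ext) (simp only: nabla_metric_conn[OF m] stat_mult_cubic[OF m c])
qed

text \<open>At each point the values of \<open>D\<close> on left-invariant fields form a product to which the algebraic
  uniqueness applies, because the metric is constant on such fields.\<close>

lemma conn_stat_mult_unique:
  assumes m: "inner_product m" and c: "sym_trilinear c"
    and D: "affine_connection D" "torsion_free D"
    and cubic: "\<And>u v w. nabla_metric D (metric_of m) (left_inv u) (left_inv v) (left_inv w) = (\<lambda>p. c u v w)"
  shows "D = conn (stat_mult m c)"
proof (rule affine_connection_eqI[OF D(1) conn_stat_mult(1)[OF m c]])
  fix u v p
  define B where "B u v = coframe p (D (left_inv u) (left_inv v) p)" for u v
  have DB: "D (left_inv u) (left_inv v) p = frame p (B u v)" for u v
    by (simp add: B_def)
  have "B u v - B v u = br u v" for u v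
  proof -
    have "D (left_inv u) (left_inv v) p - D (left_inv v) (left_inv u) p = left_inv (br u v) p"
      using D(2)[unfolded torsion_free_def, rule_format, of "left_inv u" "left_inv v", THEN fun_cong, of p]
      by (simp add: lie_bracket_left_inv)
    then show ?thesis
      unfolding B_def by (simp add: left_inv_def flip: coframe_linear_simps)
  qed
  moreover have "- m (B u v) w - m v (B u w) = c u v w" for u v w
    using fun_cong[OF cubic[of u v w], of p]
    by (simp add: nabla_metric_def metric_of_def B_def)
  ultimately show "D (left_inv u) (left_inv v) p = conn (stat_mult m c) (left_inv u) (left_inv v) p"
    using stat_mult_unique[OF m c, of B u v] by (simp add: DB) (simp add: left_inv_def)
qed

lemma cubic_connection_tensor_of:
  assumes m: "inner_product m" and c: "sym_trilinear c"
  shows "cubic_connection (metric_of m) (tensor_of c) = conn (stat_mult m c)"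
  unfolding cubic_connection_def
proof (rule the_equality)
  show "affine_connection (conn (stat_mult m c)) \<and> torsion_free (conn (stat_mult m c)) \<and>
    (\<forall>X\<in>vector_fields. \<forall>Y\<in>vector_fields. \<forall>Z\<in>vector_fields.
      nabla_metric (conn (stat_mult m c)) (metric_of m) X Y Z = (\<lambda>p. tensor_of c p (X p) (Y p) (Z p)))"
    using conn_stat_mult[OF m c] by (simp add: tensor_of_hat)
  fix D assume "affine_connection D \<and> torsion_free D \<and>
    (\<forall>X\<in>vector_fields. \<forall>Y\<in>vector_fields. \<forall>Z\<in>vector_fields.
      nabla_metric D (metric_of m) X Y Z = (\<lambda>p. tensor_of c p (X p) (Y p) (Z p)))"
  then show "D = conn (stat_mult m c)"
    by (intro conn_stat_mult_unique[OF m c]) (simp_all add: tensor_of_hat)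
qed

lemma sym_trilinear_zero [simp]: "sym_trilinear (\<lambda>u v w. 0)"
  by (simp add: sym_trilinear_def linear_iff)

lemma sym_trilinear_scale:
  assumes c: "sym_trilinear c"
  shows "sym_trilinear (\<lambda>u v w. k * c u v w)"
  unfolding sym_trilinear_def linear_iff
  using sym_trilinear_commute[OF c]
  by (simp add: sym_trilinear_simps[OF c] algebra_simps)

lemma sym_trilinear_minus:
  "sym_trilinear c \<Longrightarrow> sym_trilinear (\<lambda>u v w. - c u v w)"
  using sym_trilinear_scale[of c "-1"] by simp

lemma levi_civita_metric_of:
  assumes m: "inner_product m"
  shows "levi_civita (metric_of m) = conn (stat_mult m (\<lambda>u v w. 0))"
  using cubic_connection_tensor_of[OF m sym_trilinear_zero]
  by (simp add: levi_civita_def tensor_of_def)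

text \<open>Dualizing replaces the product by minus its adjoint. The Levi-Civita part is skew-adjoint and the cubic part
  self-adjoint, so this amounts to a change of sign of \<open>c\<close>.\<close>

lemma dual_connection_conn:
  assumes m: "inner_product m" and c: "sym_trilinear c"
  shows "dual_connection (metric_of m) (conn (stat_mult m c)) = conn (stat_mult m (\<lambda>u v w. - c u v w))"
    (is "_ = conn ?B'")
  unfolding dual_connection_def
proof (rule the_equality)
  note c' = sym_trilinear_minus[OF c]
  have dual: "m (stat_mult m c u v) w + m v (?B' u w) = 0" for u v w
    by (simp add: stat_mult[OF m c] stat_mult[OF m c'] inner_product_commute[OF m, of v]
        sym_trilinear_commute(2)[OF c, of u w v])
  show ex: "affine_connection (conn ?B') \<and>
    (\<forall>X\<in>vector_fields. \<forall>Y\<in>vector_fields. \<forall>Z\<in>vector_fields.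
        along X (\<lambda>q. metric_of m q (Y q) (Z q)) =
        (\<lambda>p. metric_of m p (conn (stat_mult m c) X Y p) (Z p) + metric_of m p (Y p) (conn ?B' X Z p)))"
  proof (intro conjI ballI)
    show "affine_connection (conn ?B')" by (rule conn_stat_mult(1)[OF m c'])
    fix X Y Z :: "real \<times> 'a \<Rightarrow> real \<times> 'a" assume "X \<in> vector_fields" "Y \<in> vector_fields" "Z \<in> vector_fields"
    then have XYZ: "smooth X" "smooth Y" "smooth Z" by auto
    show "along X (\<lambda>q. metric_of m q (Y q) (Z q)) =
        (\<lambda>p. metric_of m p (conn (stat_mult m c) X Y p) (Z p) + metric_of m p (Y p) (conn ?B' X Z p))"
    proof
      fix p
      show "along X (\<lambda>q. metric_of m q (Y q) (Z q)) p =
        metric_of m p (conn (stat_mult m c) X Y p) (Z p) + metric_of m p (Y p) (conn ?B' X Z p)"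
        using XYZ dual[of "hat X p" "hat Y p" "hat Z p"]
        by (simp add: along_metric_of[OF m XYZ(2,3)] conn_def inner_product_simps[OF m] del: metric_of_hat)
    qed
  qed
  fix D' assume D': "affine_connection D' \<and>
    (\<forall>X\<in>vector_fields. \<forall>Y\<in>vector_fields. \<forall>Z\<in>vector_fields.
        along X (\<lambda>q. metric_of m q (Y q) (Z q)) =
        (\<lambda>p. metric_of m p (conn (stat_mult m c) X Y p) (Z p) + metric_of m p (Y p) (D' X Z p)))"
  show "D' = conn ?B'"
  proof (rule affine_connection_eqI)
    fix u w p
    have "m v (coframe p (D' (left_inv u) (left_inv w) p)) = m v (?B' u w)" for v
    proof -
      have "along (left_inv u) (\<lambda>q. metric_of m q (left_inv v q) (left_inv w q)) p =
        metric_of m p (conn (stat_mult m c) (left_inv u) (left_inv v) p) (left_inv w p) +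
        metric_of m p (left_inv v p) (D' (left_inv u) (left_inv w) p)"
        using D'[THEN conjunct2, rule_format, of "left_inv u" "left_inv v" "left_inv w", THEN fun_cong, of p] by simp
      then show ?thesis using dual[of u v w] by (simp add: metric_of_def)
    qed
    then have "coframe p (D' (left_inv u) (left_inv w) p) = ?B' u w"
      by (intro inner_product_eqI[OF m]) (simp add: inner_product_commute[OF m])
    then have "D' (left_inv u) (left_inv w) p = frame p (?B' u w)"
      by (metis frame_coframe(1))
    then show "D' (left_inv u) (left_inv w) p = conn ?B' (left_inv u) (left_inv w) p"
      by simp (simp add: left_inv_def)
  qed (use D' ex in auto)
qed

section \<open>Conjugate symmetric and dually flat forms\<close>

text \<open>If \<open>fst (grad m) = 1\<close>, this is \<open>C\<^sup>\<alpha>\<close>: in an orthonormal basis that starts with \<open>grad m\<close>, the sum of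
  \<open>x\<^sub>1 x\<^sub>i\<^sup>2\<close> over all \<open>i\<close> gives the three mixed terms, and the last term corrects the coefficient of
  \<open>x\<^sub>1\<^sup>3\<close> from 6 to 4. The denominator extends the family to inner products with any
  \<open>fst (grad m)\<close> so that it is compatible with scaling.\<close>

definition alpha_form ::
    "('v rh \<Rightarrow> 'v rh \<Rightarrow> real) \<Rightarrow> real \<Rightarrow>
     'v::euclidean_space rh \<Rightarrow> 'v rh \<Rightarrow> 'v rh \<Rightarrow> real" where
  "alpha_form m a u v w = 2 * a * (fst u * m v w + fst v * m u w + fst w * m u v
     - fst u * fst v * fst w / fst (grad m))"

context
  fixes m :: "'v::euclidean_space rh \<Rightarrow> 'v rh \<Rightarrow> real"
  assumes m: "inner_product m"
begin

lemma sym_trilinear_alpha_form: "sym_trilinear (alpha_form m a)"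
  unfolding sym_trilinear_def linear_iff
  using inner_product_commute[OF m]
  by (simp add: alpha_form_def inner_product_simps[OF m] algebra_simps add_divide_distrib)

lemma stat_mult_alpha_form:
  "stat_mult m (alpha_form m a) u v =
   (m u v - a * (m u v - fst u * fst v / fst (grad m))) *\<^sub>R grad m - ((1 + a) * fst v) *\<^sub>R u - (a * fst u) *\<^sub>R v"
  by (rule inner_product_eqI[OF m])
     (simp add: stat_mult[OF m sym_trilinear_alpha_form] alpha_form_def inner_product_simps[OF m] grad[OF m]
       algebra_simps add_divide_distrib diff_divide_distrib)

lemma curv_alpha_form:
  "curv (stat_mult m (alpha_form m a)) u v w =
   (fst (grad m) * (1 - a\<^sup>2)) *\<^sub>R (m u w *\<^sub>R v - m v w *\<^sub>R u)"
proof (rule inner_product_eqI[OF m])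
  fix t
  define \<rho> where "\<rho> = fst (grad m)"
  have \<rho>: "\<rho> \<noteq> 0" using fst_grad_pos[OF m] by (simp add: \<rho>_def)
  have com: "m v u = m u v" "m w u = m u w" "m w v = m v w" by (rule inner_product_commute[OF m])+
  show "m (curv (stat_mult m (alpha_form m a)) u v w) t =
    m ((fst (grad m) * (1 - a\<^sup>2)) *\<^sub>R (m u w *\<^sub>R v - m v w *\<^sub>R u)) t"
    using \<rho>
    by (simp add: curv_def br_def stat_mult_alpha_form inner_product_simps[OF m] grad[OF m] com \<rho>_def[symmetric])
       (simp add: field_simps power2_eq_square)
qed

text \<open>The curvatures of dual connections are adjoint up to sign, so they vanish together. Hence flat structures
  are conjugate symmetric.\<close>

lemma curv_dual:
  assumes c: "sym_trilinear c"
  shows "m (curv (stat_mult m c) u v w) t = - m w (curv (stat_mult m (\<lambda>u v w. - c u v w)) u v t)"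
proof -
  let ?B = "stat_mult m c" and ?B' = "stat_mult m (\<lambda>u v w. - c u v w)"
  note c' = sym_trilinear_minus[OF c]
  have dual: "m (?B u v) w = - m v (?B' u w)" for u v w
    by (simp add: stat_mult[OF m c] stat_mult[OF m c'] inner_product_commute[OF m, of v]
        sym_trilinear_commute(2)[OF c, of u w v])
  show ?thesis
    by (simp add: curv_def inner_product_simps[OF m] dual)
qed

text \<open>Already the case \<open>u = grad m\<close> of the condition determines the form, because left
  multiplication by \<open>grad m\<close> vanishes for the Levi-Civita product: the condition then expresses
  \<open>c v w t\<close> by the values of \<open>c\<close> with one argument \<open>grad m\<close>.\<close>

lemma alpha_form_of_curv_eq:
  assumes c: "sym_trilinear c"
    and eq: "\<And>u v w. curv (stat_mult m c) u v w = curv (stat_mult m (\<lambda>u v w. - c u v w)) u v w"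
  shows "\<exists>a. c = alpha_form m a"
proof -
  \<comment> \<open>\<open>N\<close> is the Levi-Civita product, and \<open>K\<close> is the difference of the dual and the given product.\<close>
  define z where "z = grad m"
  define \<rho> where "\<rho> = fst z"
  define N where "N u v = m u v *\<^sub>R z - fst v *\<^sub>R u" for u v
  define K where "K u v = riesz m (c u v)" for u v
  note c' = sym_trilinear_minus[OF c]
  note c_simps = sym_trilinear_simps[OF c]
  note m_simps = inner_product_simps[OF m]
  have \<rho>: "\<rho> \<noteq> 0" using fst_grad_pos[OF m] by (simp add: \<rho>_def z_def)
  have z: "m z u = fst u" "m u z = fst u" for u by (simp_all add: z_def grad[OF m])
  have K: "m (K u v) w = c u v w" for u v w
    unfolding K_def by (rule riesz[OF m sym_trilinear_linear(3)[OF c]])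
  have B: "stat_mult m c u v = N u v - (1/2) *\<^sub>R K u v" for u v
    by (rule inner_product_eqI[OF m]) (simp add: stat_mult[OF m c] N_def K m_simps z)
  have B': "stat_mult m (\<lambda>u v w. - c u v w) u v = N u v + (1/2) *\<^sub>R K u v" for u v
    by (rule inner_product_eqI[OF m]) (simp add: stat_mult[OF m c'] N_def K m_simps z)
  have fK: "fst (K u v) = c u v z" for u v
    using K[of u v z] z by simp
  have mK: "m w (K u v) = c u v w" for u v w
    using K[of u v w] inner_product_commute[OF m] by simp
  have csym: "c u v w = c v u w" "c u v w = c u w v" for u v w
    by (rule sym_trilinear_commute[OF c])+
  \<comment> \<open>The terms quadratic in \<open>K\<close> agree for the two products; what remains is linear in \<open>c\<close>.\<close>
  have main: "\<rho> * c v w t = fst v * c z w t - fst w * c z v t - fst t * c z v w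
      + m v w * c z z t + m v t * c z z w" for v w t
  proof -
    have "m (curv (stat_mult m c) z v w) t = m (curv (stat_mult m (\<lambda>u v w. - c u v w)) z v w) t"
      by (simp only: eq)
    moreover have "c z w v = c z v w" "c z w z = c z z w" using csym by metis+
    moreover have "m (K a (N v w - s *\<^sub>R K v w)) t = c a (N v w) t - s * c a (K v w) t" for a v w s
      by (simp add: K c_simps)
    moreover have "m (K a (N v w + s *\<^sub>R K v w)) t = c a (N v w) t + s * c a (K v w) t" for a v w s
      by (simp add: K c_simps)
    ultimately show ?thesis
      unfolding curv_def B B'
      by (simp add: N_def br_def K mK fK m_simps c_simps z \<rho>_def[symmetric])
         (simp add: algebra_simps add_divide_distrib diff_divide_distrib)
  qed
  have fz: "fst z = \<rho>" by (simp add: \<rho>_def)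
  define k where "k = c z z z"
  have zz: "c z z v = fst v * k / \<rho>" for v
    using main[of v z z] csym(1)[of v z z] csym(2)[of z v z] \<rho>
    by (simp add: z fz k_def field_simps)
  have zv: "c z v w = (fst v * fst w * k / \<rho> + m v w * k) / (2 * \<rho>)" for v w
  proof -
    have "c v w z = c z v w" "c z w z = c z z w" "c z v z = c z z v" using csym by metis+
    then have "2 * \<rho> * c z v w = 2 * fst v * c z z w - fst w * c z z v + m v w * k"
      using main[of v w z] by (simp add: z fz k_def)
    also have "\<dots> = fst v * fst w * k / \<rho> + m v w * k"
      by (simp add: zz)
    finally show ?thesis using \<rho> by (simp add: field_simps)
  qed
  have "c v w t = alpha_form m (k / (4 * \<rho>\<^sup>2)) v w t" for v w t
  proof -
    have "c v w t = (\<rho> * c v w t) / \<rho>" using \<rho> by simp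
    also have "\<dots> = alpha_form m (k / (4 * \<rho>\<^sup>2)) v w t"
      unfolding main[of v w t] zz zv alpha_form_def z_def[symmetric] fz
      using \<rho> by (simp add: z field_simps power2_eq_square)
    finally show ?thesis .
  qed
  then show ?thesis by (intro exI[of _ "k / (4 * \<rho>\<^sup>2)"] ext)
qed

lemma alpha_form_minus: "(\<lambda>u v w. - alpha_form m a u v w) = alpha_form m (- a)"
  by (simp add: alpha_form_def fun_eq_iff)

lemma conjugate_symmetric_conn:
  assumes c: "sym_trilinear c"
  shows "conjugate_symmetric (metric_of m) (conn (stat_mult m c)) \<longleftrightarrow> c \<in> range (alpha_form m)"
proof
  let ?c' = "\<lambda>u v w. - c u v w"
  note c' = sym_trilinear_minus[OF c]
  note CS = conjugate_symmetric_def dual_connection_conn[OF m c]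
  {
    assume cs: "conjugate_symmetric (metric_of m) (conn (stat_mult m c))"
    have "curv (stat_mult m c) u v w = curv (stat_mult m ?c') u v w" for u v w
    proof -
      have "curvature (conn (stat_mult m c)) (left_inv u) (left_inv v) (left_inv w) =
          curvature (conn (stat_mult m ?c')) (left_inv u) (left_inv v) (left_inv w)"
        using cs[unfolded CS, rule_format, of "left_inv u" "left_inv v" "left_inv w"] by simp
      then show ?thesis unfolding curvature_conn_left_inv by simp
    qed
    from alpha_form_of_curv_eq[OF c this] show "c \<in> range (alpha_form m)" by auto
  next
    assume "c \<in> range (alpha_form m)"
    then obtain a where a: "c = alpha_form m a" by auto
    have "curv (stat_mult m c) u v w = curv (stat_mult m ?c') u v w" for u v w
      unfolding a alpha_form_minus curv_alpha_form by simp
    then show "conjugate_symmetric (metric_of m) (conn (stat_mult m c))"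
      unfolding CS by (auto simp: curvature_conn[OF bilinear_stat_mult[OF m c]]
          curvature_conn[OF bilinear_stat_mult[OF m c']] fun_eq_iff)
  }
qed

lemma dually_flat_conn:
  assumes c: "sym_trilinear c"
  shows "dually_flat (metric_of m) (conn (stat_mult m c)) \<longleftrightarrow> c \<in> alpha_form m ` {1, -1}"
proof
  let ?c' = "\<lambda>u v w. - c u v w"
  assume df: "dually_flat (metric_of m) (conn (stat_mult m c))"
  have flat: "curv (stat_mult m c) u v w = 0" for u v w
  proof -
    have "curvature (conn (stat_mult m c)) (left_inv u) (left_inv v) (left_inv w) = (\<lambda>p. 0)"
      using df[unfolded dually_flat_def, rule_format, of "left_inv u" "left_inv v" "left_inv w"] by simp
    then have "left_inv (curv (stat_mult m c) u v w) 0 = 0"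
      unfolding curvature_conn_left_inv by (rule fun_cong)
    then show ?thesis by simp
  qed
  have "curv (stat_mult m ?c') u v t = 0" for u v t
    using curv_dual[OF c, of u v _ t]
    by (intro inner_product_eqI[OF m]) (simp add: flat inner_product_simps[OF m] inner_product_commute[OF m, of _ "curv _ _ _ _"])
  then obtain a where a: "c = alpha_form m a"
    using alpha_form_of_curv_eq[OF c] flat by auto
  obtain b :: 'v where b: "b \<noteq> 0" using nonempty_Basis nonzero_Basis by blast
  have "(fst (grad m) * (1 - a\<^sup>2)) *\<^sub>R (m (grad m) (grad m) *\<^sub>R (0, b) - m (0, b) (grad m) *\<^sub>R grad m) = 0"
    using flat[of "grad m" "(0, b)" "grad m"] unfolding a curv_alpha_form .
  then have "1 - a\<^sup>2 = 0"
    using b fst_grad_pos[OF m] by (simp add: grad[OF m] prod_eq_iff)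
  then have "a = 1 \<or> a = -1" by (simp add: power2_eq_1_iff)
  then show "c \<in> alpha_form m ` {1, -1}" unfolding a by auto
next
  assume "c \<in> alpha_form m ` {1, -1}"
  then have "curv (stat_mult m c) u v w = 0" for u v w
    by (auto simp: curv_alpha_form)
  then show "dually_flat (metric_of m) (conn (stat_mult m c))"
    unfolding dually_flat_def
    by (simp add: curvature_conn[OF bilinear_stat_mult[OF m c]] fun_eq_iff frame_linear_simps)
qed

end

section \<open>Diffeomorphisms that preserve the left-invariant fields\<close>

text \<open>The diffeomorphism \<open>\<phi>\<close> maps each field \<open>left_inv u\<close> to \<open>left_inv (L u)\<close>. This covers left translations, with
  \<open>L\<close> the identity, and group automorphisms, with \<open>L\<close> their derivative at the unit.\<close>

definition intertwines ::
    "('v::euclidean_space rh \<Rightarrow> 'v rh) \<Rightarrow> ('v rh \<Rightarrow> 'v rh) \<Rightarrow> bool" where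
  "intertwines \<phi> L \<longleftrightarrow> bij \<phi> \<and> smooth \<phi> \<and> smooth (inv \<phi>) \<and> linear L \<and> bij L \<and>
     (\<forall>p u. frechet_derivative \<phi> (at p) (frame p u) = frame (\<phi> p) (L u))"

lemma linear_inv:
  fixes L :: "'a::euclidean_space \<Rightarrow> 'a"
  assumes "linear L" "bij L"
  shows "linear (inv L)"
proof -
  have s: "L (inv L v) = v" "inv L (L v) = v" for v
    using assms(2) by (simp_all add: bij_is_inj bij_is_surj surj_f_inv_f)
  have "inv L (u + v) = inv L u + inv L v" for u v
    using s(2)[of "inv L u + inv L v"] by (simp only: linear_add[OF assms(1)] s(1))
  moreover have "inv L (r *\<^sub>R u) = r *\<^sub>R inv L u" for r u
    using s(2)[of "r *\<^sub>R inv L u"] by (simp only: linear_scale[OF assms(1)] s(1))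
  ultimately show ?thesis by (simp add: linear_iff del: split_paired_All)
qed

lemma intertwines_inv:
  assumes \<phi>: "intertwines \<phi> L"
  shows "intertwines (inv \<phi>) (inv L)"
proof -
  have *: "bij \<phi>" "smooth \<phi>" "smooth (inv \<phi>)" "linear L" "bij L"
    and D: "\<And>p u. frechet_derivative \<phi> (at p) (frame p u) = frame (\<phi> p) (L u)"
    using \<phi> by (auto simp: intertwines_def)
  have "frechet_derivative (inv \<phi>) (at p) (frame p u) = frame (inv \<phi> p) (inv L u)" for p u
  proof -
    define q where "q = inv \<phi> p"
    have p: "p = \<phi> q" using *(1) by (simp add: q_def bij_is_surj surj_f_inv_f)
    have "((\<lambda>x. inv \<phi> (\<phi> x)) has_derivative
      (\<lambda>v. frechet_derivative (inv \<phi>) (at (\<phi> q)) (frechet_derivative \<phi> (at q) v))) (at q)"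
      by (rule has_derivative_compose[OF smooth_has_derivative[OF *(2)] smooth_has_derivative[OF *(3)]])
    moreover have "(\<lambda>x. inv \<phi> (\<phi> x)) = (\<lambda>x. x)" using *(1) by (simp add: bij_is_inj)
    ultimately have "(\<lambda>v. frechet_derivative (inv \<phi>) (at (\<phi> q)) (frechet_derivative \<phi> (at q) v)) = (\<lambda>v. v)"
      using has_derivative_unique[OF _ has_derivative_ident] by simp
    from fun_cong[OF this, of "frame q (inv L u)"]
    show ?thesis
      using *(5) by (simp add: D p[symmetric] q_def[symmetric] bij_is_surj surj_f_inv_f)
  qed
  then show ?thesis
    using * by (simp add: intertwines_def bij_imp_bij_inv inv_inv_eq linear_inv)
qed

context
  fixes \<phi> :: "'v::euclidean_space rh \<Rightarrow> 'v rh" and L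
  assumes \<phi>: "intertwines \<phi> L"
begin

lemma intertwines_inv_simps: "inv \<phi> (\<phi> p) = p" "\<phi> (inv \<phi> p) = p" "inv L (L u) = u" "L (inv L u) = u"
  using \<phi> by (simp_all add: intertwines_def bij_is_inj bij_is_surj surj_f_inv_f)

lemma push_field_intertwines: "push_field \<phi> X = (\<lambda>p. frame p (L (hat X (inv \<phi> p))))"
proof
  fix p
  have "frechet_derivative \<phi> (at (inv \<phi> p)) (frame (inv \<phi> p) (hat X (inv \<phi> p))) =
      frame (\<phi> (inv \<phi> p)) (L (hat X (inv \<phi> p)))"
    using \<phi> unfolding intertwines_def by blast
  then show "push_field \<phi> X p = frame p (L (hat X (inv \<phi> p)))"
    by (simp add: push_field_def intertwines_inv_simps)
qed

lemma hat_push_field: "hat (push_field \<phi> X) = (\<lambda>p. L (hat X (inv \<phi> p)))"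
  by (simp add: push_field_intertwines)

lemma push_field_left_inv: "push_field \<phi> (left_inv u) = left_inv (L u)"
  by (simp add: push_field_intertwines) (simp add: left_inv_def)

lemma smooth_push_field:
  assumes "smooth X"
  shows "smooth (push_field \<phi> X)"
proof -
  have "smooth (\<lambda>p. hat X (inv \<phi> p))"
    by (rule smooth_compose) (use assms \<phi> in \<open>simp_all add: intertwines_def\<close>)
  then have "smooth (\<lambda>p. L (hat X (inv \<phi> p)))"
    by (rule smooth_linear_compose[rotated]) (use \<phi> in \<open>simp add: intertwines_def linear_conv_bounded_linear\<close>)
  then show ?thesis by (simp add: push_field_intertwines)
qed

end

lemma push_field_inv:
  assumes \<phi>: "intertwines \<phi> L"
  shows "push_field (inv \<phi>) (push_field \<phi> X) = X"
  unfolding push_field_intertwines[OF intertwines_inv[OF \<phi>]] hat_push_field[OF \<phi>]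
  using \<phi> by (simp add: intertwines_inv_simps[OF \<phi>] intertwines_def inv_inv_eq)

lemma smooth_push_field_iff:
  assumes \<phi>: "intertwines \<phi> L"
  shows "smooth (push_field \<phi> X) \<longleftrightarrow> smooth X"
  using smooth_push_field[OF \<phi>, of X] smooth_push_field[OF intertwines_inv[OF \<phi>], of "push_field \<phi> X"]
  by (auto simp: push_field_inv[OF \<phi>])

lemma along_push_field:
  fixes f :: "'v::euclidean_space rh \<Rightarrow> 'v rh"
  assumes \<phi>: "intertwines \<phi> L" and f: "smooth f"
  shows "along (push_field \<phi> X) f (\<phi> p) = along X (\<lambda>q. f (\<phi> q)) p"
proof -
  have s: "smooth \<phi>" using \<phi> by (simp add: intertwines_def)
  have "frechet_derivative (\<lambda>q. f (\<phi> q)) (at p) =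
      (\<lambda>v. frechet_derivative f (at (\<phi> p)) (frechet_derivative \<phi> (at p) v))"
    by (rule frechet_derivative_at[symmetric],
      rule has_derivative_compose[OF smooth_has_derivative[OF s] smooth_has_derivative[OF f]])
  then show ?thesis
    by (simp add: along_def push_field_def intertwines_inv_simps[OF \<phi>])
qed

lemma pull_metric_intertwines:
  assumes \<phi>: "intertwines \<phi> L"
  shows "pull_metric \<phi> (metric_of m) = metric_of (\<lambda>u v. m (L u) (L v))"
proof -
  have "frechet_derivative \<phi> (at p) u = frame (\<phi> p) (L (coframe p u))" for p u
    using \<phi> unfolding intertwines_def by (metis frame_coframe(1))
  then show ?thesis
    by (simp add: pull_metric_def metric_of_def)
qed

text \<open>In components with respect to the left-invariant frame, pulling back is substitution of \<open>\<phi>\<close>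
  combined with the constant map \<open>L\<close>. By the chain rule this commutes with the differentiation of
  components, so that only the product changes.\<close>

lemma pull_connection_intertwines:
  fixes B :: "'v::euclidean_space rh \<Rightarrow> 'v rh \<Rightarrow> 'v rh"
  assumes \<phi>: "intertwines \<phi> L" and B: "bilinear B" and B': "\<And>u v. L (B' u v) = B (L u) (L v)"
  shows "pull_connection \<phi> (conn B) = conn B'"
proof (intro ext)
  fix X Y p
  note inv = intertwines_inv_simps[OF \<phi>]
  note push_inv = push_field_intertwines[OF intertwines_inv[OF \<phi>]]
  have inv_inv: "inv (inv \<phi>) = \<phi>" using \<phi> by (simp add: intertwines_def inv_inv_eq)
  have L: "linear L" "bounded_linear L"
    using \<phi> by (simp_all add: intertwines_def linear_conv_bounded_linear)
  show "pull_connection \<phi> (conn B) X Y p = conn B' X Y p"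
  proof (cases "smooth X \<and> smooth Y")
    case True
    then have X: "smooth X" and Y: "smooth Y" by auto
    have sX: "smooth (push_field \<phi> X)" and sY: "smooth (push_field \<phi> Y)"
      using X Y smooth_push_field[OF \<phi>] by auto
    have "smooth (hat (push_field \<phi> Y))" using sY by simp
    from along_push_field[OF \<phi> this, of X p]
    have "along (push_field \<phi> X) (hat (push_field \<phi> Y)) (\<phi> p) = along X (\<lambda>q. L (hat Y q)) p"
      by (simp add: hat_push_field[OF \<phi>] inv)
    also have "\<dots> = L (along X (hat Y) p)"
      using Y by (simp add: along_linear[OF L(2)])
    finally have "hat (conn B (push_field \<phi> X) (push_field \<phi> Y)) (\<phi> p) =
        L (along X (hat Y) p + B' (hat X p) (hat Y p))"
      unfolding hat_conn[OF sX sY] by (simp add: hat_push_field[OF \<phi>] inv linear_add[OF L(1)] B')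
    then show ?thesis
      unfolding pull_connection_def push_inv inv_inv using X Y
      by (simp add: inv conn_def)
  next
    case False
    then have "conn B (push_field \<phi> X) (push_field \<phi> Y) = (\<lambda>p. 0)"
      by (auto simp: conn_def smooth_push_field_iff[OF \<phi>])
    moreover have "push_field (inv \<phi>) (\<lambda>p. 0) = (\<lambda>p. 0)"
      using linear_0[OF smooth_linear_derivative[of "inv \<phi>"]] \<phi>
      by (simp add: push_field_def intertwines_def)
    ultimately show ?thesis
      using False by (auto simp: pull_connection_def conn_def)
  qed
qed

subsection \<open>Left translations\<close>

definition group_inverse :: "'v::euclidean_space rh \<Rightarrow> 'v rh" where
  "group_inverse a = (- fst a, - exp (- fst a) *\<^sub>R snd a)"

lemma rh_mult_inverse: "rh_mult (group_inverse a) (rh_mult a p) = p" "rh_mult a (rh_mult (group_inverse a) p) = p"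
  by (simp_all add: rh_mult_def group_inverse_def exp_minus prod_eq_iff algebra_simps)

lemma bij_rh_mult: "bij (rh_mult a)"
  by (metis bijI' rh_mult_inverse)

lemma inv_rh_mult: "inv (rh_mult a) = rh_mult (group_inverse a)"
  by (rule inv_equality) (rule rh_mult_inverse)+

lemma rh_mult_eq_frame: "rh_mult a = (\<lambda>u. frame a u + a)"
  by (simp add: rh_mult_def frame_def fun_eq_iff prod_eq_iff)

lemma rh_mult_zero [simp]: "rh_mult a 0 = a" "rh_mult 0 a = a"
  by (simp_all add: rh_mult_def)

lemma frame_mult: "frame (rh_mult a p) u = frame a (frame p u)"
  by (simp add: frame_def rh_mult_def exp_add)

lemma frechet_rh_mult: "frechet_derivative (rh_mult a) (at p) = frame a"
proof -
  have "(rh_mult a has_derivative frame a) (at p)"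
    unfolding rh_mult_eq_frame
    by (intro has_derivative_add_const linear_imp_has_derivative linear_frame)
  then show ?thesis using frechet_derivative_at by metis
qed

lemma smooth_rh_mult: "smooth (rh_mult a)"
  unfolding rh_mult_eq_frame
  by (rule smooth_affine) (simp add: linear_frame linear_conv_bounded_linear[symmetric])

lemma intertwines_rh_mult: "intertwines (rh_mult a) (\<lambda>u. u)"
  by (simp add: intertwines_def bij_rh_mult smooth_rh_mult inv_rh_mult frechet_rh_mult frame_mult
      linear_iff bij_id[unfolded id_def])

subsection \<open>Automorphisms\<close>

text \<open>The bracket involves only \<open>fst\<close>, so these are automorphisms of the Lie algebra.\<close>

definition automorphism :: "('v::euclidean_space rh \<Rightarrow> 'v rh) \<Rightarrow> bool" where
  "automorphism L \<longleftrightarrow> linear L \<and> bij L \<and> (\<forall>u. fst (L u) = fst u)"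

lemma automorphism_inv:
  assumes "automorphism L"
  shows "automorphism (inv L)"
  unfolding automorphism_def
proof (intro conjI allI)
  have L: "linear L" "bij L" "\<And>u. fst (L u) = fst u" using assms by (auto simp: automorphism_def)
  show "linear (inv L)" by (rule linear_inv[OF L(1,2)])
  show "bij (inv L)" by (rule bij_imp_bij_inv[OF L(2)])
  show "fst (inv L u) = fst u" for u
    using L(3)[of "inv L u"] L(2) by (simp add: bij_is_surj surj_f_inv_f)
qed

lemma automorphism_comp:
  assumes "automorphism L" "automorphism M"
  shows "automorphism (\<lambda>u. L (M u))"
  using assms linear_compose[of M L] bij_comp[of M L] by (simp add: automorphism_def o_def)

lemma automorphism_ident: "automorphism (\<lambda>u. u)"
  by (simp add: automorphism_def linear_iff bij_id[unfolded id_def])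

text \<open>The derivative \<open>L\<close> at the unit intertwines because \<open>\<phi>\<close> commutes with translations. That \<open>L\<close> preserves
  \<open>fst\<close> is seen in the group: conjugation by \<open>(t, 0)\<close> acts on \<open>{0} \<times> 'v\<close> as
  multiplication by \<open>exp t\<close>, and this factor is determined by the group structure.\<close>

lemma group_automorphism_intertwines:
  fixes \<phi> :: "'v::euclidean_space rh \<Rightarrow> 'v rh"
  assumes \<phi>: "\<phi> \<in> lie_group_automorphisms rh_mult"
  shows "\<exists>L. automorphism L \<and> intertwines \<phi> L"
proof -
  have bij: "bij \<phi>" and sm: "smooth \<phi>" "smooth (inv \<phi>)"
    and hom: "\<phi> (rh_mult a b) = rh_mult (\<phi> a) (\<phi> b)" for a b
    using \<phi> by (auto simp: lie_group_automorphisms_def)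
  define L where "L = frechet_derivative \<phi> (at 0)"
  have lin: "linear L" unfolding L_def by (rule smooth_linear_derivative[OF sm(1)])
  have hom0: "\<phi> 0 = 0"
  proof -
    have "rh_mult (\<phi> 0) (\<phi> 0) = \<phi> 0" using hom[of 0 0] by simp
    then have "rh_mult (group_inverse (\<phi> 0)) (rh_mult (\<phi> 0) (\<phi> 0)) = rh_mult (group_inverse (\<phi> 0)) (rh_mult (\<phi> 0) 0)"
      by simp
    then show ?thesis by (simp only: rh_mult_inverse)
  qed
  have D: "frechet_derivative \<phi> (at p) (frame p u) = frame (\<phi> p) (L u)" for p u
  proof -
    have 1: "((\<lambda>q. \<phi> (rh_mult p q)) has_derivative
        (\<lambda>u. frechet_derivative \<phi> (at (rh_mult p 0)) (frechet_derivative (rh_mult p) (at 0) u))) (at 0)"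
      by (rule has_derivative_compose[OF smooth_has_derivative[OF smooth_rh_mult] smooth_has_derivative[OF sm(1)]])
    have "((\<lambda>q. rh_mult (\<phi> p) (\<phi> q)) has_derivative
        (\<lambda>u. frechet_derivative (rh_mult (\<phi> p)) (at (\<phi> 0)) (L u))) (at 0)"
      unfolding L_def
      by (rule has_derivative_compose[OF smooth_has_derivative[OF sm(1)] smooth_has_derivative[OF smooth_rh_mult]])
    then have "((\<lambda>q. \<phi> (rh_mult p q)) has_derivative (\<lambda>u. frame (\<phi> p) (L u))) (at 0)"
      by (simp add: hom frechet_rh_mult)
    from has_derivative_unique[OF 1 this] show ?thesis
      by (simp add: frechet_rh_mult fun_eq_iff del: split_paired_All)
  qed
  have inj: "inj L"
  proof -
    have "((\<lambda>x. inv \<phi> (\<phi> x)) has_derivative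
      (\<lambda>v. frechet_derivative (inv \<phi>) (at (\<phi> 0)) (L v))) (at 0)"
      unfolding L_def
      by (rule has_derivative_compose[OF smooth_has_derivative[OF sm(1)] smooth_has_derivative[OF sm(2)]])
    moreover have "(\<lambda>x. inv \<phi> (\<phi> x)) = (\<lambda>x. x)" using bij by (simp add: bij_is_inj)
    ultimately have "(\<lambda>v. frechet_derivative (inv \<phi>) (at (\<phi> 0)) (L v)) = (\<lambda>v. v)"
      using has_derivative_unique[OF _ has_derivative_ident] by simp
    then show ?thesis by (metis injI)
  qed
  then have bijL: "bij L"
    using linear_injective_imp_surjective[OF lin] by (simp add: bij_def)
  have fst_hom: "fst (\<phi> (rh_mult a b)) = fst (\<phi> a) + fst (\<phi> b)" for a b
    unfolding hom by (simp add: rh_mult_def)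
  \<comment> \<open>Conjugation by \<open>(ln 2, 0)\<close> doubles the elements of the commutator subgroup, so the real
    character \<open>fst \<circ> \<phi>\<close> vanishes there.\<close>
  have fst_V: "fst (\<phi> (0, v)) = 0" for v
  proof -
    have "rh_mult (ln 2, 0) (0, v) = rh_mult (rh_mult (0, v) (0, v)) (ln 2, 0)"
      by (simp add: rh_mult_def scaleR_2)
    then show ?thesis using fst_hom by (metis add.commute add_cancel_right_right add_left_cancel)
  qed
  \<comment> \<open>Compare the two sides of \<open>\<phi> ((t, 0) (0, v) (t, 0)\<^sup>-\<^sup>1) = \<phi> (0, exp t *\<^sub>R v)\<close>, differentiated at \<open>v = 0\<close>.\<close>
  have fst_R: "fst (\<phi> (t, 0)) = t" for t
  proof -
    obtain b :: 'v where b: "b \<noteq> 0" using nonempty_Basis nonzero_Basis by blast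
    have fst_L: "fst (L (0, v)) = 0" for v
    proof -
      have "((\<lambda>s. fst (\<phi> (0, s))) has_derivative (\<lambda>v. fst (L (0, v)))) (at 0)"
        unfolding L_def
        by (rule has_derivative_fst, rule has_derivative_compose[where g=\<phi>])
           (auto intro!: derivative_eq_intros smooth_has_derivative[OF sm(1)] simp: zero_prod_def[symmetric])
      moreover have "(\<lambda>s. fst (\<phi> (0, s))) = (\<lambda>s. 0)" by (simp add: fst_V)
      ultimately have "((\<lambda>s::'v. 0::real) has_derivative (\<lambda>v. fst (L (0, v)))) (at 0)" by (simp only:)
      from fun_cong[OF has_derivative_unique[OF this has_derivative_const]] show ?thesis .
    qed
    have "rh_mult (\<phi> (t, 0)) (\<phi> (0, v)) = rh_mult (\<phi> (0, exp t *\<^sub>R v)) (\<phi> (t, 0))" for v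
      unfolding hom[symmetric] by (simp add: rh_mult_def)
    then have eq: "exp (fst (\<phi> (t, 0))) *\<^sub>R snd (\<phi> (0, v)) = snd (\<phi> (0, exp t *\<^sub>R v))" for v
      by (simp add: rh_mult_def fst_V)
    have d: "((\<lambda>v. snd (\<phi> (0, r *\<^sub>R v))) has_derivative (\<lambda>v. snd (L (0, r *\<^sub>R v)))) (at 0)" for r
      unfolding L_def
      by (rule has_derivative_snd, rule has_derivative_compose[where g=\<phi>])
         (auto intro!: derivative_eq_intros smooth_has_derivative[OF sm(1)] simp: zero_prod_def[symmetric])
    have "((\<lambda>v. exp (fst (\<phi> (t, 0))) *\<^sub>R snd (\<phi> (0, v))) has_derivative
        (\<lambda>v. exp (fst (\<phi> (t, 0))) *\<^sub>R snd (L (0, v)))) (at 0)"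
      using has_derivative_scaleR_right[OF d[of 1]] by simp
    then have "((\<lambda>v. snd (\<phi> (0, exp t *\<^sub>R v))) has_derivative
        (\<lambda>v. exp (fst (\<phi> (t, 0))) *\<^sub>R snd (L (0, v)))) (at 0)"
      by (simp only: eq)
    from fun_cong[OF has_derivative_unique[OF d[of "exp t"] this], of b]
    have e: "snd (L (0, exp t *\<^sub>R b)) = exp (fst (\<phi> (t, 0))) *\<^sub>R snd (L (0, b))" .
    have "L (0, exp t *\<^sub>R b) = exp t *\<^sub>R L (0, b)"
      using linear_scale[OF lin, of "exp t" "(0, b)"] by simp
    then have "exp t *\<^sub>R snd (L (0, b)) = exp (fst (\<phi> (t, 0))) *\<^sub>R snd (L (0, b))"
      using e by simp
    moreover have "snd (L (0, b)) \<noteq> 0"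
    proof
      assume "snd (L (0, b)) = 0"
      then have "L (0, b) = L 0" using fst_L[of b] by (simp add: linear_0[OF lin] prod_eq_iff)
      then show False using injD[OF inj] b by (auto simp: zero_prod_def)
    qed
    ultimately show ?thesis by simp
  qed
  have fst_phi: "(\<lambda>p. fst (\<phi> p)) = fst"
  proof
    fix p :: "'v rh"
    have "rh_mult (0, snd p) (fst p, 0) = p" by (simp add: rh_mult_def)
    then show "fst (\<phi> p) = fst p" using fst_hom[of "(0, snd p)" "(fst p, 0)"] by (simp add: fst_V fst_R)
  qed
  have "((\<lambda>p. fst (\<phi> p)) has_derivative (\<lambda>u. fst (L u))) (at 0)"
    unfolding L_def by (rule has_derivative_fst[OF smooth_has_derivative[OF sm(1)]])
  then have "(fst has_derivative (\<lambda>u. fst (L u))) (at 0)" by (simp only: fst_phi)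
  from has_derivative_unique[OF this has_derivative_fst[OF has_derivative_ident]]
  have "fst (L u) = fst u" for u by (metis (no_types, lifting))
  then show ?thesis
    using lin bijL bij sm D unfolding intertwines_def automorphism_def by blast
qed

text \<open>If \<open>T\<close> maps \<open>(0, b)\<close> to \<open>(0, A b)\<close> and \<open>(1, 0)\<close> to \<open>(1, w)\<close>, the automorphism is
  \<open>(t, v) \<mapsto> (t, A v + (exp t - 1) *\<^sub>R w)\<close>. The assignment is functorial, which yields the inverse.\<close>

lemma automorphism_integrates:
  fixes T :: "'v::euclidean_space rh \<Rightarrow> 'v rh"
  assumes T: "automorphism T"
  shows "\<exists>\<phi> \<in> lie_group_automorphisms rh_mult. intertwines \<phi> T"
proof -
  define \<Phi> where "\<Phi> T p = (fst p, snd (T (0, snd p)) + (exp (fst p) - 1) *\<^sub>R snd (T (1, 0)))"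
    for T :: "'v rh \<Rightarrow> 'v rh" and p
  have expand: "snd (T u) = snd (T (0, snd u)) + fst u *\<^sub>R snd (T (1, 0))"
    if T: "automorphism T" for T :: "'v rh \<Rightarrow> 'v rh" and u
  proof -
    have lin: "linear T" using T by (simp add: automorphism_def)
    have "u = (0, snd u) + fst u *\<^sub>R (1, 0)" by (simp add: prod_eq_iff)
    then have "T u = T (0, snd u) + fst u *\<^sub>R T (1, 0)"
      using linear_add[OF lin] linear_scale[OF lin] by metis
    then show ?thesis by simp
  qed
  have comp: "\<Phi> S (\<Phi> T p) = \<Phi> (\<lambda>u. S (T u)) p"
    if S: "automorphism S" and T: "automorphism T" for S T :: "'v rh \<Rightarrow> 'v rh" and p
  proof -
    have lin: "linear S" and f: "fst (T u) = fst u" for u using S T by (auto simp: automorphism_def)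
    have s: "snd (S (0, v + r *\<^sub>R w)) = snd (S (0, v)) + r *\<^sub>R snd (S (0, w))" for v w r
      using linear_add[OF lin, of "(0, v)" "r *\<^sub>R (0, w)"] linear_scale[OF lin, of r "(0, w)"] by simp
    show ?thesis
      using expand[OF S, of "T (0, snd p)"] expand[OF S, of "T (1, 0)"]
      by (simp add: \<Phi>_def f s scaleR_add_right)
  qed
  have ident: "\<Phi> (\<lambda>u. u) p = p" for p by (simp add: \<Phi>_def)
  have T': "automorphism (inv T)" by (rule automorphism_inv[OF T])
  have "(\<lambda>u. T (inv T u)) = (\<lambda>u. u)" "(\<lambda>u. inv T (T u)) = (\<lambda>u. u)"
    using T by (simp_all add: automorphism_def bij_is_inj bij_is_surj surj_f_inv_f)
  then have inv1: "\<Phi> T (\<Phi> (inv T) p) = p" and inv2: "\<Phi> (inv T) (\<Phi> T p) = p" for p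
    by (simp_all add: comp T T' ident)
  have bij: "bij (\<Phi> T)" by (metis bijI' inv1 inv2)
  have inv: "inv (\<Phi> T) = \<Phi> (inv T)" by (rule inv_equality) (simp_all add: inv1 inv2)
  have smooth: "smooth (\<Phi> T)" if T: "automorphism T" for T :: "'v rh \<Rightarrow> 'v rh"
  proof -
    have lin: "linear T" using T by (simp add: automorphism_def)
    have l: "T (0, v + r *\<^sub>R w) = T (0, v) + r *\<^sub>R T (0, w)" for v w r
      using linear_add[OF lin, of "(0, v)" "r *\<^sub>R (0, w)"] linear_scale[OF lin, of r "(0, w)"] by simp
    have "linear (\<lambda>p :: 'v rh. (fst p, snd (T (0, snd p))))"
      using l[of _ 1] l[of 0] linear_0[OF lin] by (simp add: linear_iff zero_prod_def[symmetric])
    then have 1: "bounded_linear (\<lambda>p :: 'v rh. (fst p, snd (T (0, snd p))))"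
      by (simp add: linear_conv_bounded_linear)
    have eq: "\<Phi> T = (\<lambda>p. ((fst p, snd (T (0, snd p))) + (0, - snd (T (1, 0)))) + exp (fst p) *\<^sub>R (0 + (0, snd (T (1, 0)))))"
      by (simp add: \<Phi>_def fun_eq_iff algebra_simps)
    show ?thesis
      unfolding eq by (rule smooth_add[OF smooth_affine[OF 1] smooth_exp_affine[OF bounded_linear_fst bounded_linear_zero]])
  qed
  have hom: "\<Phi> T (rh_mult a b) = rh_mult (\<Phi> T a) (\<Phi> T b)" for a b
  proof -
    have lin: "linear T" using T by (simp add: automorphism_def)
    have l: "T (0, v + r *\<^sub>R w) = T (0, v) + r *\<^sub>R T (0, w)" for v w r
      using linear_add[OF lin, of "(0, v)" "r *\<^sub>R (0, w)"] linear_scale[OF lin, of r "(0, w)"] by simp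
    show ?thesis by (simp add: \<Phi>_def rh_mult_def l exp_add algebra_simps)
  qed
  have D: "frechet_derivative (\<Phi> T) (at p) (frame p u) = frame (\<Phi> T p) (T u)" for p u
  proof -
    have lin: "linear T" and f: "fst (T u) = fst u" using T by (auto simp: automorphism_def)
    have l: "T (0, r *\<^sub>R w) = r *\<^sub>R T (0, w)" for w r
      using linear_scale[OF lin, of r "(0, w)"] by simp
    have "bounded_linear T" using lin by (simp add: linear_conv_bounded_linear)
    then have "(\<Phi> T has_derivative
        (\<lambda>u. (fst u, snd (T (0, snd u)) + (exp (fst p) * fst u) *\<^sub>R snd (T (1, 0))))) (at p)"
      unfolding \<Phi>_def
      by (auto intro!: derivative_eq_intros bounded_linear.has_derivative[of T])
    from frechet_derivative_at[OF this, symmetric] show ?thesis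
      using expand[OF T, of u] f
      by (simp add: frame_def \<Phi>_def l algebra_simps prod_eq_iff)
  qed
  have "\<Phi> T \<in> lie_group_automorphisms rh_mult"
    by (simp add: lie_group_automorphisms_def bij smooth[OF T] inv smooth[OF T'] hom)
  moreover have "intertwines (\<Phi> T) T"
    using T by (simp add: intertwines_def bij smooth[OF T] inv smooth[OF T'] D automorphism_def)
  ultimately show ?thesis by blast
qed

section \<open>Left-invariant statistical structures\<close>

definition stat ::
    "('v rh \<Rightarrow> 'v rh \<Rightarrow> real) \<Rightarrow> ('v rh \<Rightarrow> 'v rh \<Rightarrow> 'v rh \<Rightarrow> real) \<Rightarrow>
     ('v::euclidean_space rh) metric \<times> ('v rh) connection" where
  "stat m c = (metric_of m, conn (stat_mult m c))"

definition metric_form ::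
    "('v rh \<Rightarrow> 'v rh \<Rightarrow> real) \<Rightarrow>
     ('v::euclidean_space rh \<Rightarrow> 'v rh) \<Rightarrow> ('v rh \<Rightarrow> 'v rh) \<Rightarrow> real" where
  "metric_form m = (\<lambda>X Y. if X \<in> rh_algebra \<and> Y \<in> rh_algebra then m (X 0) (Y 0) else 0)"

definition cubic_form_of ::
    "('v rh \<Rightarrow> 'v rh \<Rightarrow> 'v rh \<Rightarrow> real) \<Rightarrow> ('v::euclidean_space rh) cubic_form" where
  "cubic_form_of c = (\<lambda>X Y Z. if X \<in> rh_algebra \<and> Y \<in> rh_algebra \<and> Z \<in> rh_algebra
     then c (X 0) (Y 0) (Z 0) else 0)"

definition trilinear_of ::
    "('v rh) cubic_form \<Rightarrow> 'v::euclidean_space rh \<Rightarrow> 'v rh \<Rightarrow> 'v rh \<Rightarrow> real" where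
  "trilinear_of C u v w = C (left_inv u) (left_inv v) (left_inv w)"

lemma trilinear_of_cubic_form_of [simp]: "trilinear_of (cubic_form_of c) = c"
  by (intro ext) (simp add: trilinear_of_def cubic_form_of_def)

lemma metric_form_left_inv [simp]: "metric_form m (left_inv u) (left_inv v) = m u v"
  by (simp add: metric_form_def)

lemma cubic_form_of_left_inv [simp]: "cubic_form_of c (left_inv u) (left_inv v) (left_inv w) = c u v w"
  by (simp add: cubic_form_of_def)

lemma linear_form_on_left_inv:
  assumes "linear_form_on rh_algebra f"
  shows "linear (\<lambda>u. f (left_inv u))"
  using assms unfolding linear_form_on_def linear_iff left_inv_linear_simps
  by (simp add: left_inv_linear_simps)

lemma linear_form_onI:
  assumes f: "linear f"
  shows "linear_form_on rh_algebra (\<lambda>X. if X \<in> rh_algebra then f (X 0) else 0)"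
proof -
  have add: "(\<lambda>p. X p + Y p) \<in> rh_algebra" if XY: "X \<in> rh_algebra" "Y \<in> rh_algebra" for X Y :: "real \<times> 'a \<Rightarrow> _"
  proof -
    obtain u v where "X = left_inv u" "Y = left_inv v" using XY by (auto simp: rh_algebra_eq)
    then have "(\<lambda>p. X p + Y p) = left_inv (u + v)" by (simp add: left_inv_linear_simps)
    then show ?thesis by simp
  qed
  have scale: "(\<lambda>p. k *\<^sub>R X p) \<in> rh_algebra" if X: "X \<in> rh_algebra" for X :: "real \<times> 'a \<Rightarrow> _" and k
  proof -
    obtain u where "X = left_inv u" using X by (auto simp: rh_algebra_eq)
    then have "(\<lambda>p. k *\<^sub>R X p) = left_inv (k *\<^sub>R u)" by (simp add: left_inv_linear_simps)
    then show ?thesis by simp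
  qed
  show ?thesis
    unfolding linear_form_on_def using add scale linear_add[OF f] linear_scale[OF f] by simp
qed

lemma sym_trilinear_trilinear_of:
  assumes C: "C \<in> symmetric_cubic_forms rh_algebra"
  shows "sym_trilinear (trilinear_of C)" "cubic_form_of (trilinear_of C) = C"
proof -
  have lin: "linear_form_on rh_algebra (C X Y)" and sym: "C X Y Z = C Y X Z" "C X Y Z = C X Z Y" for X Y Z
    using C by (auto simp: symmetric_cubic_forms_def)
  have "linear (\<lambda>w. C (left_inv u) (left_inv v) (left_inv w))" for u v
    by (rule linear_form_on_left_inv[OF lin])
  then show "sym_trilinear (trilinear_of C)"
    unfolding sym_trilinear_def trilinear_of_def using sym by blast
  have "C X Y Z = 0" if "X \<notin> rh_algebra \<or> Y \<notin> rh_algebra \<or> Z \<notin> rh_algebra" for X Y Z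
    using that lin[of X Y] lin[of X Z] lin[of Y Z] sym unfolding linear_form_on_def by metis
  then show "cubic_form_of (trilinear_of C) = C"
    by (intro ext) (auto simp: cubic_form_of_def trilinear_of_def rh_algebra_at_0)
qed

lemma cubic_form_of_in:
  assumes c: "sym_trilinear c"
  shows "cubic_form_of c \<in> symmetric_cubic_forms rh_algebra"
proof -
  have "linear_form_on rh_algebra (cubic_form_of c X Y)" for X Y
  proof (cases "X \<in> rh_algebra \<and> Y \<in> rh_algebra")
    case True
    then have "cubic_form_of c X Y = (\<lambda>Z. if Z \<in> rh_algebra then c (X 0) (Y 0) (Z 0) else 0)"
      by (simp add: cubic_form_of_def)
    then show ?thesis
      using linear_form_onI[OF sym_trilinear_linear(3)[OF c]] by simp
  next
    case False
    then have "cubic_form_of c X Y = (\<lambda>Z. 0)" by (auto simp: cubic_form_of_def)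
    then show ?thesis by (simp add: linear_form_on_def)
  qed
  moreover have "cubic_form_of c X Y Z = cubic_form_of c Y X Z" "cubic_form_of c X Y Z = cubic_form_of c X Z Y"
    for X Y Z
    using sym_trilinear_commute[OF c] by (auto simp: cubic_form_of_def)
  ultimately show ?thesis unfolding symmetric_cubic_forms_def by blast
qed

lemma symmetric_cubic_forms_eq: "symmetric_cubic_forms rh_algebra = cubic_form_of ` Collect sym_trilinear"
proof (intro equalityI subsetI)
  fix C :: "(real \<times> 'a) cubic_form" assume C: "C \<in> symmetric_cubic_forms rh_algebra"
  show "C \<in> cubic_form_of ` Collect sym_trilinear"
    using sym_trilinear_trilinear_of[OF C] by (intro image_eqI[of _ _ "trilinear_of C"]) simp_all
qed (auto intro: cubic_form_of_in)

lemma left_field_eq: "left_field rh_mult p u = left_inv (coframe p u)"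
  unfolding left_field_def
proof (rule the_equality)
  show "left_inv (coframe p u) \<in> rh_algebra \<and> left_inv (coframe p u) p = u"
    by simp (simp add: left_inv_def)
  fix X assume X: "X \<in> rh_algebra \<and> X p = u"
  then obtain v where "X = left_inv v" by (auto simp: rh_algebra_eq)
  then show "X = left_inv (coframe p u)" using X by auto
qed

lemma left_cubic_tensor_cubic_form_of: "left_cubic_tensor rh_mult (cubic_form_of c) = tensor_of c"
  by (simp add: left_cubic_tensor_def left_field_eq tensor_of_def)

lemma lie_unit_rh: "lie_unit (rh_mult :: 'v::euclidean_space rh \<Rightarrow> _) = 0"
  unfolding lie_unit_def
proof (rule the_equality)
  show "\<forall>a. rh_mult 0 a = a \<and> rh_mult a 0 = (a :: 'v rh)" by simp
  fix u :: "'v rh" assume "\<forall>a. rh_mult u a = a \<and> rh_mult a u = a"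
  then show "u = 0" by (metis rh_mult_zero(1))
qed

lemma metric_at_unit_metric_of: "metric_at_unit rh_mult (metric_of m) = metric_form m"
  by (intro ext) (simp add: metric_at_unit_def metric_form_def lie_unit_rh metric_of_def)

lemma cubic_at_unit_conn:
  assumes m: "inner_product m" and c: "sym_trilinear c"
  shows "cubic_at_unit rh_mult (metric_of m) (conn (stat_mult m c)) = cubic_form_of c"
proof (intro ext)
  fix X Y Z
  show "cubic_at_unit rh_mult (metric_of m) (conn (stat_mult m c)) X Y Z = cubic_form_of c X Y Z"
  proof (cases "X \<in> rh_algebra \<and> Y \<in> rh_algebra \<and> Z \<in> rh_algebra")
    case True
    then have s: "smooth X" "smooth Y" "smooth Z" by (auto simp: lie_algebra_def)
    show ?thesis
      using True by (simp add: cubic_at_unit_def cubic_form_of_def lie_unit_rh conn_stat_mult(3)[OF m c s] hat_def)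
  next
    case False
    then show ?thesis by (auto simp: cubic_at_unit_def cubic_form_of_def)
  qed
qed

lemma left_invariant_metric:
  fixes h :: "('v::euclidean_space rh) metric"
  assumes h: "riemannian_metric h" and inv: "\<And>a. pull_metric (rh_mult a) h = h"
  shows "inner_product (h 0)" "h = metric_of (h 0)"
proof -
  show "inner_product (h 0)"
    using h unfolding riemannian_metric_def inner_product_def by blast
  show "h = metric_of (h 0)"
  proof (intro ext)
    fix p u v
    have "pull_metric (rh_mult p) h 0 (coframe p u) (coframe p v) = h p u v"
      by (simp add: pull_metric_def frechet_rh_mult)
    then show "h p u v = metric_of (h 0) p u v"
      by (simp add: inv metric_of_def)
  qed
qed

lemma metric_of_at_0 [simp]: "metric_of m 0 = m"
  by (simp add: metric_of_def)

lemma stat_left_invariant: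
  assumes m: "inner_product m" and c: "sym_trilinear c"
  shows "stat m c \<in> left_invariant_statistical_structures rh_mult"
proof -
  note B = bilinear_stat_mult[OF m c]
  have "pull_metric (rh_mult a) (metric_of m) = metric_of m" for a
    by (rule pull_metric_intertwines[OF intertwines_rh_mult])
  moreover have "pull_connection (rh_mult a) (conn (stat_mult m c)) = conn (stat_mult m c)" for a
    by (rule pull_connection_intertwines[OF intertwines_rh_mult B]) (rule refl)
  moreover have "statistical_structure (metric_of m) (conn (stat_mult m c))"
    unfolding statistical_structure_def
  proof (intro conjI ballI)
    show "riemannian_metric (metric_of m)" by (rule riemannian_metric_of[OF m])
    show "affine_connection (conn (stat_mult m c))" "torsion_free (conn (stat_mult m c))"
      by (rule conn_stat_mult[OF m c])+
    fix X Y Z :: "real \<times> 'a \<Rightarrow> real \<times> 'a"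
    assume "X \<in> vector_fields" "Y \<in> vector_fields" "Z \<in> vector_fields"
    then have s: "smooth X" "smooth Y" "smooth Z" by auto
    show "nabla_metric (conn (stat_mult m c)) (metric_of m) X Y Z =
        nabla_metric (conn (stat_mult m c)) (metric_of m) Y X Z"
      unfolding conn_stat_mult(3)[OF m c s] conn_stat_mult(3)[OF m c s(2,1,3)]
      by (rule ext) (rule sym_trilinear_commute[OF c])
    show "nabla_metric (conn (stat_mult m c)) (metric_of m) X Y Z =
        nabla_metric (conn (stat_mult m c)) (metric_of m) X Z Y"
      unfolding conn_stat_mult(3)[OF m c s] conn_stat_mult(3)[OF m c s(1,3,2)]
      by (rule ext) (rule sym_trilinear_commute[OF c])
  qed
  ultimately show ?thesis
    by (simp add: left_invariant_statistical_structures_def stat_def)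
qed

text \<open>A left-invariant connection maps pairs of left-invariant fields to left-invariant fields, so its cubic form is
  constant on them, and the connection is recovered from metric and cubic form.\<close>

lemma left_invariant_stat:
  assumes hD: "(h, D) \<in> left_invariant_statistical_structures (rh_mult :: 'v::euclidean_space rh \<Rightarrow> _)"
  shows "\<exists>m c. inner_product m \<and> sym_trilinear c \<and> (h, D) = stat m c"
proof -
  define m where "m = h 0"
  have st: "statistical_structure h D" and invh: "\<And>a. pull_metric (rh_mult a) h = h"
    and invD: "\<And>a. pull_connection (rh_mult a) D = D"
    using hD by (auto simp: left_invariant_statistical_structures_def)
  have rm: "riemannian_metric h" and D: "affine_connection D" "torsion_free D"
    and sym: "\<And>X Y Z. smooth X \<Longrightarrow> smooth Y \<Longrightarrow> smooth Z \<Longrightarrow> nabla_metric D h X Y Z = nabla_metric D h Y X Z \<and>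
        nabla_metric D h X Y Z = nabla_metric D h X Z Y"
    using st by (auto simp: statistical_structure_def)
  have m: "inner_product m" and h: "h = metric_of m"
    unfolding m_def using left_invariant_metric[OF rm invh] by simp_all
  have smD: "smooth (D X Y)" if "smooth X" "smooth Y" for X Y
    using D(1) that unfolding affine_connection_def by blast
  define B where "B u v = D (left_inv u) (left_inv v) 0" for u v
  have DB: "D (left_inv u) (left_inv v) = left_inv (B u v)" for u v
  proof -
    have "push_field (rh_mult b) (D (left_inv u) (left_inv v)) = D (left_inv u) (left_inv v)" for b
    proof -
      have "inv (rh_mult (group_inverse b)) = rh_mult b"
        by (rule inv_equality) (rule rh_mult_inverse)+
      then show ?thesis
        using fun_cong[OF fun_cong[OF invD[of "group_inverse b"], of "left_inv u"], of "left_inv v"]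
        unfolding pull_connection_def push_field_left_inv[OF intertwines_rh_mult] by simp
    qed
    then have "D (left_inv u) (left_inv v) \<in> rh_algebra"
      by (simp add: lie_algebra_def smD)
    then show ?thesis unfolding B_def by (rule rh_algebra_at_0[symmetric])
  qed
  have radd: "B u (v + w) = B u v + B u w" and rscale: "B u (k *\<^sub>R v) = k *\<^sub>R B u v" for u v w k
  proof -
    have "D (left_inv u) (\<lambda>p. left_inv v p + left_inv w p) =
        (\<lambda>p. D (left_inv u) (left_inv v) p + D (left_inv u) (left_inv w) p)"
      using D(1)[unfolded affine_connection_def, THEN conjunct2, THEN conjunct2, THEN conjunct1, rule_format,
          of "left_inv u" "left_inv v" "left_inv w"] by simp
    then show "B u (v + w) = B u v + B u w"
      by (simp add: B_def left_inv_linear_simps)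
    from D(1)[unfolded affine_connection_def, THEN conjunct2, THEN conjunct2, THEN conjunct2, THEN conjunct1,
        rule_format, of "left_inv u" "left_inv v" "\<lambda>p. k"]
    show "B u (k *\<^sub>R v) = k *\<^sub>R B u v"
      by (simp add: B_def left_inv_linear_simps)
  qed
  define c where "c u v w = - m (B u v) w - m v (B u w)" for u v w
  have nab: "nabla_metric D h (left_inv u) (left_inv v) (left_inv w) = (\<lambda>p. c u v w)" for u v w
    by (rule ext) (simp add: nabla_metric_def h DB c_def)
  have "linear (c u v)" for u v
    unfolding linear_iff c_def by (simp add: radd rscale inner_product_simps[OF m] algebra_simps)
  moreover have "c u v w = c v u w" "c u v w = c u w v" for u v w
    using sym[of "left_inv u" "left_inv v" "left_inv w"] unfolding nab by (metis smooth_left_inv)+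
  ultimately have c: "sym_trilinear c" unfolding sym_trilinear_def by blast
  have "D = conn (stat_mult m c)"
    by (rule conn_stat_mult_unique[OF m c D]) (use nab h in simp)
  then show ?thesis using m c h by (auto simp: stat_def)
qed

lemma left_invariant_statistical_structures_eq:
  "left_invariant_statistical_structures rh_mult =
     {stat m c | m c. inner_product m \<and> sym_trilinear c}"
proof (intro equalityI subsetI)
  fix s :: "(real \<times> 'a) metric \<times> (real \<times> 'a) connection"
  assume "s \<in> left_invariant_statistical_structures rh_mult"
  then show "s \<in> {stat m c | m c. inner_product m \<and> sym_trilinear c}"
    using left_invariant_stat[of "fst s" "snd s"] by auto
qed (use stat_left_invariant in blast)

lemma stat_inject:
  assumes "inner_product m" "sym_trilinear c" "inner_product m'" "sym_trilinear c'"
  shows "stat m c = stat m' c' \<longleftrightarrow> m = m' \<and> c = c'"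
proof
  assume eq: "stat m c = stat m' c'"
  then have 1: "metric_of m = metric_of m'" by (simp add: stat_def)
  then have mm: "m = m'" by (metis metric_of_at_0)
  have "cubic_form_of c = cubic_form_of c'"
    using cubic_at_unit_conn[OF assms(1,2)] cubic_at_unit_conn[OF assms(3,4)] eq by (simp add: stat_def)
  then show "m = m' \<and> c = c'" using mm by (metis trilinear_of_cubic_form_of)
qed simp

section \<open>Orbits\<close>

text \<open>The action of \<open>(r, \<phi>)\<close> on the data of a structure, where \<open>M\<close> is the inverse of the derivative of
  \<open>\<phi>\<close>. The cubic form is scaled along with the metric because it is \<open>\<nabla> g\<close> for an unscaled
  connection.\<close>

definition transform_metric ::
    "real \<Rightarrow> ('a \<Rightarrow> 'a) \<Rightarrow> ('a \<Rightarrow> 'a \<Rightarrow> real) \<Rightarrow> 'a \<Rightarrow> 'a \<Rightarrow> real" where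
  "transform_metric r M m u v = r * m (M u) (M v)"

definition transform_cubic ::
    "real \<Rightarrow> ('a \<Rightarrow> 'a) \<Rightarrow> ('a \<Rightarrow> 'a \<Rightarrow> 'a \<Rightarrow> real) \<Rightarrow> 'a \<Rightarrow> 'a \<Rightarrow> 'a \<Rightarrow> real" where
  "transform_cubic r M c u v w = r * c (M u) (M v) (M w)"

lemma inner_product_transform:
  assumes m: "inner_product m" and r: "r > 0" and M: "linear M" "inj M"
  shows "inner_product (transform_metric r M m)"
proof -
  have "bilinear (transform_metric r M m)"
    unfolding bilinear_def linear_iff
    by (simp add: transform_metric_def linear_add[OF M(1)] linear_scale[OF M(1)] inner_product_simps[OF m] algebra_simps)
  moreover have "M u \<noteq> 0" if "u \<noteq> 0" for u
    using that M by (metis injD linear_0)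
  ultimately show ?thesis
    using m r by (simp add: inner_product_def transform_metric_def)
qed

lemma sym_trilinear_transform:
  assumes c: "sym_trilinear c" and M: "linear M"
  shows "sym_trilinear (transform_cubic r M c)"
  unfolding sym_trilinear_def linear_iff transform_cubic_def
  using sym_trilinear_commute[OF c]
  by (simp add: linear_add[OF M] linear_scale[OF M] sym_trilinear_simps[OF c] algebra_simps)

lemma automorphism_inj: "automorphism M \<Longrightarrow> linear M" "automorphism M \<Longrightarrow> inj M"
  by (auto simp: automorphism_def bij_def)

text \<open>Naturality of the Koszul formula. Metric and cubic form are scaled by the same factor, which leaves
  the product unchanged.\<close>

lemma stat_mult_transform:
  fixes M :: "'v::euclidean_space rh \<Rightarrow> 'v rh"
  assumes m: "inner_product m" and c: "sym_trilinear c" and r: "r > 0" and M: "automorphism M"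
  shows "M (stat_mult (transform_metric r M m) (transform_cubic r M c) u v) = stat_mult m c (M u) (M v)"
proof (rule inner_product_eqI[OF m])
  fix w
  have lin: "linear M" "inj M" and f: "\<And>u. fst (M u) = fst u" and surj: "surj M"
    using M by (auto simp: automorphism_def bij_def)
  obtain w' where w: "w = M w'" using surj by (metis surjD)
  have m': "inner_product (transform_metric r M m)" by (rule inner_product_transform[OF m r lin])
  have c': "sym_trilinear (transform_cubic r M c)" by (rule sym_trilinear_transform[OF c lin(1)])
  have "r * m (M (stat_mult (transform_metric r M m) (transform_cubic r M c) u v)) w =
      r * m (stat_mult m c (M u) (M v)) w"
    using stat_mult[OF m' c', of u v w']
    by (simp add: transform_metric_def transform_cubic_def w stat_mult[OF m c] f algebra_simps)
  then show "m (M (stat_mult (transform_metric r M m) (transform_cubic r M c) u v)) w =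
      m (stat_mult m c (M u) (M v)) w" using r by simp
qed

lemma pull_stat:
  assumes m: "inner_product m" and c: "sym_trilinear c" and r: "r > 0"
    and M: "automorphism M" and \<psi>: "intertwines \<psi> M"
  shows "((\<lambda>p u v. r * pull_metric \<psi> (metric_of m) p u v), pull_connection \<psi> (conn (stat_mult m c))) =
    stat (transform_metric r M m) (transform_cubic r M c)"
proof -
  have "pull_connection \<psi> (conn (stat_mult m c)) = conn (stat_mult (transform_metric r M m) (transform_cubic r M c))"
    by (rule pull_connection_intertwines[OF \<psi> bilinear_stat_mult[OF m c]]) (rule stat_mult_transform[OF m c r M])
  then show ?thesis
    by (simp add: stat_def pull_metric_intertwines[OF \<psi>]) (simp add: metric_of_def transform_metric_def)
qed

text \<open>Each automorphism of the group contributes the inverse of its derivative at the unit, and every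
  automorphism of the Lie algebra arises in this way.\<close>

lemma statistical_orbit_stat:
  fixes m :: "'v::euclidean_space rh \<Rightarrow> 'v rh \<Rightarrow> real"
  assumes m: "inner_product m" and c: "sym_trilinear c"
  shows "statistical_orbit rh_mult (stat m c) =
    {stat (transform_metric r M m) (transform_cubic r M c) | r M. r > 0 \<and> automorphism M}"
proof (intro set_eqI iffI)
  fix s assume "s \<in> statistical_orbit rh_mult (stat m c)"
  then obtain r \<phi> where r: "r > 0" and \<phi>: "\<phi> \<in> lie_group_automorphisms rh_mult"
    and s: "s = ((\<lambda>p u v. r * pull_metric (inv \<phi>) (metric_of m) p u v), pull_connection (inv \<phi>) (conn (stat_mult m c)))"
    unfolding statistical_orbit_def stat_def by auto
  obtain L where L: "automorphism L" "intertwines \<phi> L"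
    using group_automorphism_intertwines[OF \<phi>] by blast
  have "s = stat (transform_metric r (inv L) m) (transform_cubic r (inv L) c)"
    unfolding s by (rule pull_stat[OF m c r automorphism_inv[OF L(1)] intertwines_inv[OF L(2)]])
  then show "s \<in> {stat (transform_metric r M m) (transform_cubic r M c) | r M. r > 0 \<and> automorphism M}"
    using r automorphism_inv[OF L(1)] by blast
next
  fix s assume "s \<in> {stat (transform_metric r M m) (transform_cubic r M c) | r M. r > 0 \<and> automorphism M}"
  then obtain r M where r: "r > 0" and M: "automorphism M"
    and s: "s = stat (transform_metric r M m) (transform_cubic r M c)" by blast
  obtain \<phi> where \<phi>: "\<phi> \<in> lie_group_automorphisms rh_mult" "intertwines \<phi> (inv M)"
    using automorphism_integrates[OF automorphism_inv[OF M]] by blast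
  have "inv (inv M) = M" using M by (simp add: automorphism_def inv_inv_eq)
  then have "intertwines (inv \<phi>) M" using intertwines_inv[OF \<phi>(2)] by simp
  from pull_stat[OF m c r M this] s
  have "s = ((\<lambda>p u v. r * pull_metric (inv \<phi>) (metric_of m) p u v), pull_connection (inv \<phi>) (conn (stat_mult m c)))"
    by simp
  then show "s \<in> statistical_orbit rh_mult (stat m c)"
    using r \<phi>(1) unfolding statistical_orbit_def stat_def by auto
qed

lemma transform_comp:
  "transform_metric r M (transform_metric s N m) = transform_metric (r * s) (\<lambda>u. N (M u)) m"
  "transform_cubic r M (transform_cubic s N c) = transform_cubic (r * s) (\<lambda>u. N (M u)) c"
  "transform_metric 1 (\<lambda>u. u) m = m" "transform_cubic 1 (\<lambda>u. u) c = c"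
  by (simp_all add: transform_metric_def transform_cubic_def fun_eq_iff)

lemma automorphism_inv_simps:
  assumes "automorphism M"
  shows "M (inv M u) = u" "inv M (M u) = u"
  using assms by (simp_all add: automorphism_def bij_is_inj bij_is_surj surj_f_inv_f)

lemma statistical_orbit_eq_iff:
  assumes m: "inner_product m" and c: "sym_trilinear c"
    and m': "inner_product m'" and c': "sym_trilinear c'"
  shows "statistical_orbit rh_mult (stat m c) = statistical_orbit rh_mult (stat m' c') \<longleftrightarrow>
    (\<exists>r M. r > 0 \<and> automorphism M \<and> m' = transform_metric r M m \<and> c' = transform_cubic r M c)"
proof
  assume eq: "statistical_orbit rh_mult (stat m c) = statistical_orbit rh_mult (stat m' c')"
  have "stat m' c' \<in> statistical_orbit rh_mult (stat m' c')"
    unfolding statistical_orbit_stat[OF m' c']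
    using transform_comp(3,4) automorphism_ident zero_less_one by (metis (mono_tags, lifting) mem_Collect_eq)
  then obtain r M where r: "r > 0" and M: "automorphism M"
    and s: "stat m' c' = stat (transform_metric r M m) (transform_cubic r M c)"
    unfolding eq[symmetric] statistical_orbit_stat[OF m c] by blast
  then have "m' = transform_metric r M m \<and> c' = transform_cubic r M c"
    using stat_inject[OF m' c' inner_product_transform[OF m r] sym_trilinear_transform[OF c]]
      automorphism_inj[OF M] by blast
  then show "\<exists>r M. r > 0 \<and> automorphism M \<and> m' = transform_metric r M m \<and> c' = transform_cubic r M c"
    using r M by blast
next
  have sub: "statistical_orbit rh_mult (stat m' c') \<subseteq> statistical_orbit rh_mult (stat m c)"
    if m: "inner_product m" and c: "sym_trilinear c" and m': "inner_product m'" and c': "sym_trilinear c'"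
      and r: "r > 0" and M: "automorphism M" and eq: "m' = transform_metric r M m" "c' = transform_cubic r M c"
    for r M m m' c c'
  proof
    fix s assume "s \<in> statistical_orbit rh_mult (stat m' c')"
    then obtain t N where t: "t > 0" and N: "automorphism N"
      and s: "s = stat (transform_metric t N m') (transform_cubic t N c')"
      unfolding statistical_orbit_stat[OF m' c'] by blast
    have "s = stat (transform_metric (t * r) (\<lambda>u. M (N u)) m) (transform_cubic (t * r) (\<lambda>u. M (N u)) c)"
      unfolding s eq transform_comp ..
    moreover have "t * r > 0" using t r by simp
    ultimately show "s \<in> statistical_orbit rh_mult (stat m c)"
      unfolding statistical_orbit_stat[OF m c] using automorphism_comp[OF M N] by blast
  qed
  assume "\<exists>r M. r > 0 \<and> automorphism M \<and> m' = transform_metric r M m \<and> c' = transform_cubic r M c"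
  then obtain r M where r: "r > 0" and M: "automorphism M"
    and eq: "m' = transform_metric r M m" "c' = transform_cubic r M c" by blast
  have "m = transform_metric (1 / r) (inv M) m'" "c = transform_cubic (1 / r) (inv M) c'"
    unfolding eq transform_comp using r by (simp_all add: automorphism_inv_simps[OF M] transform_comp)
  moreover have "1 / r > 0" using r by simp
  ultimately show "statistical_orbit rh_mult (stat m c) = statistical_orbit rh_mult (stat m' c')"
    using sub[OF m c m' c' r M eq] sub[OF m' c' m c _ automorphism_inv[OF M]] by blast
qed

section \<open>Orbit spaces and continuous normal forms\<close>

lemma homeomorphic_space_of_quotient_maps:
  assumes p: "quotient_map X Y p" and q: "quotient_map X Z q"
    and fib: "\<And>x y. x \<in> topspace X \<Longrightarrow> y \<in> topspace X \<Longrightarrow> p x = p y \<longleftrightarrow> q x = q y"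
  shows "Y homeomorphic_space Z"
proof -
  have cont: "continuous_map X Y p" "continuous_map X Z q"
    using p q quotient_imp_continuous_map by blast+
  obtain f where f: "continuous_map Y Z f" "\<And>x. x \<in> topspace X \<Longrightarrow> f (p x) = q x"
    using quotient_map_lift_exists[OF p cont(2)] fib by metis
  obtain g where g: "continuous_map Z Y g" "\<And>x. x \<in> topspace X \<Longrightarrow> g (q x) = p x"
    using quotient_map_lift_exists[OF q cont(1)] fib by metis
  have "topspace Y = p ` topspace X" "topspace Z = q ` topspace X"
    using p q by (auto simp: quotient_map_def)
  then have "homeomorphic_maps Y Z f g"
    using f g by (auto simp: homeomorphic_maps_def)
  then show ?thesis using homeomorphic_space_def by blast
qed

text \<open>Here \<open>s\<close> sends a structure to a normal form and \<open>i\<close> sends a normal form to a structure. The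
  composition \<open>q \<circ> s\<close> is a quotient map: it is continuous, and openness of a preimage in \<open>T\<close>
  passes to \<open>S\<close> along \<open>i\<close>. It has the same fibres as the orbit map.\<close>

lemma orbit_topology_homeomorphic_normal_forms:
  assumes q: "quotient_map S Q q" and s: "continuous_map T S s" and i: "continuous_map S T i"
    and si: "\<And>c. c \<in> topspace S \<Longrightarrow> q (s (i c)) = q c"
    and fib: "\<And>x y. x \<in> topspace T \<Longrightarrow> y \<in> topspace T \<Longrightarrow> orb x = orb y \<longleftrightarrow> q (s x) = q (s y)"
  shows "orbit_topology T orb homeomorphic_space Q"
proof -
  have qS: "q ` topspace S = topspace Q"
    and qopen: "\<And>U. U \<subseteq> topspace Q \<Longrightarrow> openin S {x \<in> topspace S. q x \<in> U} \<longleftrightarrow> openin Q U"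
    using q by (auto simp: quotient_map_def)
  have cont: "continuous_map T Q (\<lambda>x. q (s x))"
    using continuous_map_compose[OF s quotient_imp_continuous_map[OF q]] by (simp add: o_def)
  have i_in: "i c \<in> topspace T" if "c \<in> topspace S" for c
    using continuous_map_funspace[OF i] that by auto
  have "quotient_map T Q (\<lambda>x. q (s x))"
    unfolding quotient_map_def
  proof (intro conjI allI impI iffI)
    show "(\<lambda>x. q (s x)) ` topspace T = topspace Q"
    proof
      show "(\<lambda>x. q (s x)) ` topspace T \<subseteq> topspace Q"
        using continuous_map_funspace[OF cont] by auto
      show "topspace Q \<subseteq> (\<lambda>x. q (s x)) ` topspace T"
        unfolding qS[symmetric] using si i_in by (force simp: image_iff)
    qed
    fix U assume U: "U \<subseteq> topspace Q"
    show "openin T {x \<in> topspace T. q (s x) \<in> U}" if "openin Q U"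
      using openin_continuous_map_preimage[OF cont that] .
    assume "openin T {x \<in> topspace T. q (s x) \<in> U}"
    from openin_continuous_map_preimage[OF i this]
    have "openin S {c \<in> topspace S. i c \<in> {x \<in> topspace T. q (s x) \<in> U}}" .
    moreover have "{c \<in> topspace S. i c \<in> {x \<in> topspace T. q (s x) \<in> U}} = {c \<in> topspace S. q c \<in> U}"
      using si i_in by auto
    ultimately show "openin Q U" using qopen[OF U] by simp
  qed
  from homeomorphic_space_of_quotient_maps[OF quotient_map_orbit_topology this] fib
  show ?thesis by blast
qed

lemma continuous_map_pullback_image:
  assumes "continuous_map (subtopology T (f ` A)) S g"
  shows "continuous_map (pullback_topology A f T) S (\<lambda>x. g (f x))"
proof -
  have "continuous_map (pullback_topology A f T) T f"
    using continuous_map_pullback[of T T id A f] by simp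
  then have "continuous_map (pullback_topology A f T) (subtopology T (f ` A)) f"
    by (auto simp: continuous_map_in_subtopology topspace_pullback_topology)
  from continuous_map_compose[OF this assms] show ?thesis by (simp add: o_def)
qed

section \<open>Continuity of multilinear evaluation and of orthonormalization\<close>

lemma continuous_on_bilinear_family:
  fixes m :: "'x::topological_space \<Rightarrow> 'a::euclidean_space \<Rightarrow> 'a \<Rightarrow> real"
  assumes m: "\<And>x. x \<in> S \<Longrightarrow> bilinear (m x)" and cont: "\<And>u v. continuous_on S (\<lambda>x. m x u v)"
    and f: "continuous_on S f" and g: "continuous_on S g"
  shows "continuous_on S (\<lambda>x. m x (f x) (g x))"
proof -
  have "continuous_on S (\<lambda>x. \<Sum>a\<in>Basis. \<Sum>b\<in>Basis. (f x \<bullet> a) * ((g x \<bullet> b) * m x a b))"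
    by (intro continuous_intros cont f g)
  moreover have "m x (f x) (g x) = (\<Sum>a\<in>Basis. \<Sum>b\<in>Basis. (f x \<bullet> a) * ((g x \<bullet> b) * m x a b))"
    if "x \<in> S" for x
  proof -
    have lin: "linear (\<lambda>u. m x u (g x))" "\<And>u. linear (m x u)" using m[OF that] by (auto simp: bilinear_def)
    show ?thesis
      by (subst derivative_expansion[OF lin(1)], subst (1) derivative_expansion[OF lin(2)])
         (simp add: sum_distrib_left)
  qed
  ultimately show ?thesis by (simp cong: continuous_on_cong_simp)
qed

lemma continuous_on_trilinear_family:
  fixes c :: "'x::topological_space \<Rightarrow> 'a::euclidean_space \<Rightarrow> 'a \<Rightarrow> 'a \<Rightarrow> real"
  assumes c: "\<And>x. x \<in> S \<Longrightarrow> sym_trilinear (c x)" and cont: "\<And>u v w. continuous_on S (\<lambda>x. c x u v w)"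
    and f: "continuous_on S f" and g: "continuous_on S g" and h: "continuous_on S h"
  shows "continuous_on S (\<lambda>x. c x (f x) (g x) (h x))"
proof -
  have "continuous_on S (\<lambda>x. c x a (g x) (h x))" for a
    by (rule continuous_on_bilinear_family[OF _ cont g h])
       (use sym_trilinear_linear[OF c] in \<open>simp add: bilinear_def\<close>)
  then have "continuous_on S (\<lambda>x. \<Sum>a\<in>Basis. (f x \<bullet> a) * c x a (g x) (h x))"
    by (intro continuous_intros f)
  moreover have "c x (f x) (g x) (h x) = (\<Sum>a\<in>Basis. (f x \<bullet> a) * c x a (g x) (h x))"
    if "x \<in> S" for x
    by (subst derivative_expansion[OF sym_trilinear_linear(1)[OF c[OF that]]]) simp
  ultimately show ?thesis by (simp cong: continuous_on_cong_simp)
qed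

text \<open>The Gram-Schmidt process, in the order in which the induction adds the indices. Every step is a
  continuous formula because independence keeps the vectors to be normalized away from zero.\<close>

lemma continuous_gram_schmidt:
  fixes m :: "'x::topological_space \<Rightarrow> 'a::euclidean_space \<Rightarrow> 'a \<Rightarrow> real" and b :: "'i \<Rightarrow> 'a"
  assumes m: "\<And>x. x \<in> S \<Longrightarrow> inner_product (m x)" and cont: "\<And>u v. continuous_on S (\<lambda>x. m x u v)"
    and I: "finite I" and "inj_on b I" and "independent (b ` I)"
  shows "\<exists>q. \<forall>i\<in>I. continuous_on S (q i) \<and>
    (\<forall>x\<in>S. q i x \<in> span (b ` I) \<and> (\<forall>j\<in>I. m x (q i x) (q j x) = (if i = j then 1 else 0)))"
  using I assms(4,5)
proof (induction I rule: finite_induct)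
  case (insert k I)
  have inj: "inj_on b I" and notin: "b k \<notin> b ` I" using insert by auto
  have ind: "independent (b ` I)" and notspan: "b k \<notin> span (b ` I)"
    using insert.prems(2) notin by (auto simp: independent_insert)
  obtain q where q: "\<And>i. i \<in> I \<Longrightarrow> continuous_on S (q i)"
    and span: "\<And>i x. i \<in> I \<Longrightarrow> x \<in> S \<Longrightarrow> q i x \<in> span (b ` I)"
    and on: "\<And>i j x. i \<in> I \<Longrightarrow> j \<in> I \<Longrightarrow> x \<in> S \<Longrightarrow> m x (q i x) (q j x) = (if i = j then 1 else 0)"
    using insert.IH[OF inj ind] by blast
  have bil: "bilinear (m x)" if "x \<in> S" for x using m[OF that] by (rule inner_product_bilinear)
  define f where "f x = b k - (\<Sum>i\<in>I. m x (b k) (q i x) *\<^sub>R q i x)" for x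
  define N where "N x = sqrt (m x (f x) (f x))" for x
  have cf: "continuous_on S f"
    unfolding f_def
    by (intro continuous_intros continuous_on_bilinear_family[OF bil cont] q)
  have cN: "continuous_on S N"
    unfolding N_def by (intro continuous_intros continuous_on_bilinear_family[OF bil cont] cf)
  have fspan: "f x \<in> span (insert (b k) (b ` I))" if "x \<in> S" for x
  proof -
    have "(\<Sum>i\<in>I. m x (b k) (q i x) *\<^sub>R q i x) \<in> span (b ` I)"
      using span[OF _ that] by (intro span_sum span_scale) auto
    then have "(\<Sum>i\<in>I. m x (b k) (q i x) *\<^sub>R q i x) \<in> span (insert (b k) (b ` I))"
      using span_mono[of "b ` I" "insert (b k) (b ` I)"] by blast
    then show ?thesis
      unfolding f_def by (intro span_diff) (simp_all add: span_base)
  qed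
  have fnz: "f x \<noteq> 0" if "x \<in> S" for x
  proof
    assume "f x = 0"
    then have "b k = (\<Sum>i\<in>I. m x (b k) (q i x) *\<^sub>R q i x)" by (simp add: f_def)
    also have "\<dots> \<in> span (b ` I)" using span[OF _ that] by (intro span_sum span_scale) auto
    finally show False using notspan by simp
  qed
  have Npos: "N x > 0" "N x * N x = m x (f x) (f x)" if "x \<in> S" for x
    using m[OF that] fnz[OF that] by (auto simp: N_def inner_product_def less_imp_le)
  have forth: "m x (f x) (q j x) = 0" if j: "j \<in> I" and x: "x \<in> S" for j x
  proof -
    have lin: "linear (\<lambda>u. m x u (q j x))" using bil[OF x] by (simp add: bilinear_def)
    have "m x (f x) (q j x) = m x (b k) (q j x) - (\<Sum>i\<in>I. m x (b k) (q i x) * m x (q i x) (q j x))"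
      unfolding f_def by (simp add: linear_diff[OF lin] linear_sum[OF lin] inner_product_simps[OF m[OF x]])
    also have "(\<Sum>i\<in>I. m x (b k) (q i x) * m x (q i x) (q j x)) = (\<Sum>i\<in>I. if i = j then m x (b k) (q j x) else 0)"
      by (rule sum.cong) (simp_all add: on j x)
    finally show ?thesis using j insert.hyps by simp
  qed
  define q' where "q' i x = (if i = k then (1 / N x) *\<^sub>R f x else q i x)" for i x
  have "continuous_on S (q' i)" if i: "i \<in> insert k I" for i
  proof (cases "i = k")
    case True
    have "\<forall>x\<in>S. N x \<noteq> 0" using Npos by force
    then have "continuous_on S (\<lambda>x. (1 / N x) *\<^sub>R f x)" by (intro continuous_intros cf cN)
    then show ?thesis using True by (simp add: q'_def[abs_def])
  next
    case False
    then show ?thesis using i q by (simp add: q'_def[abs_def])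
  qed
  moreover have "q' i x \<in> span (b ` insert k I)" if "i \<in> insert k I" "x \<in> S" for i x
    using that fspan[OF that(2)] span[of i x] span_mono[of "b ` I" "insert (b k) (b ` I)"]
    by (auto simp: q'_def intro: span_scale)
  moreover have "m x (q' i x) (q' j x) = (if i = j then 1 else 0)"
    if "i \<in> insert k I" "j \<in> insert k I" "x \<in> S" for i j x
  proof -
    have com: "m x (q j x) (f x) = m x (f x) (q j x)" for j
      by (rule inner_product_commute[OF m[OF that(3)]])
    have "m x (f x) (f x) = N x * N x" "N x \<noteq> 0" using Npos[OF that(3)] by auto
    then show ?thesis
      using that insert.hyps forth on by (auto simp: q'_def inner_product_simps[OF m[OF that(3)]] com)
  qed
  ultimately show ?case by blast
qed simp

(* The index 1 has a distinguished meaning and should not be rewritten. *)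
declare One_nat_def [simp del]

section \<open>Orthonormal frames adapted to the derived algebra\<close>

text \<open>The situation of the theorem at the unit element: \<open>\<epsilon> i\<close> is the value of \<open>e\<^sub>i\<close>, and the values of
  \<open>fst\<close> express the bracket relations.\<close>

locale adapted_frame =
  fixes n :: nat and \<epsilon> :: "nat \<Rightarrow> 'v::euclidean_space rh" and m :: "'v rh \<Rightarrow> 'v rh \<Rightarrow> real"
  assumes n: "n \<ge> 2" and m: "inner_product m"
    and orthonormal: "i \<in> {1..n} \<Longrightarrow> j \<in> {1..n} \<Longrightarrow> m (\<epsilon> i) (\<epsilon> j) = (if i = j then 1 else 0)"
    and spanning: "\<exists>c. u = (\<Sum>i=1..n. c i *\<^sub>R \<epsilon> i)"
    and fst_first: "fst (\<epsilon> 1) = 1" and fst_others: "i \<in> {2..n} \<Longrightarrow> fst (\<epsilon> i) = 0"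
begin

lemmas m_simps = inner_product_simps[OF m]

lemma coordinate_of_sum:
  assumes "i \<in> {1..n}"
  shows "m (\<epsilon> i) (\<Sum>j=1..n. a j *\<^sub>R \<epsilon> j) = a i"
proof -
  have "m (\<epsilon> i) (\<Sum>j=1..n. a j *\<^sub>R \<epsilon> j) = (\<Sum>j=1..n. a j * m (\<epsilon> i) (\<epsilon> j))"
    by (simp add: linear_sum[OF inner_product_linear[OF m]] m_simps)
  also have "\<dots> = (\<Sum>j=1..n. if j = i then a i else 0)"
    by (rule sum.cong) (use assms orthonormal in auto)
  finally show ?thesis using assms by simp
qed

lemma expansion: "u = (\<Sum>i=1..n. m (\<epsilon> i) u *\<^sub>R \<epsilon> i)"
proof -
  obtain c where c: "u = (\<Sum>i=1..n. c i *\<^sub>R \<epsilon> i)" using spanning by blast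
  have "(\<Sum>i=1..n. m (\<epsilon> i) u *\<^sub>R \<epsilon> i) = (\<Sum>i=1..n. c i *\<^sub>R \<epsilon> i)"
    by (intro sum.cong refl arg_cong2[where f="scaleR"]) (simp only: c coordinate_of_sum)
  then show ?thesis using c by simp
qed

lemma split_first: "{1..n} = insert 1 {2..n}"
  using n by auto

lemma sum_split_first: "(\<Sum>i=1..n. f i) = f 1 + (\<Sum>i=2..n. f i)"
  unfolding split_first by simp

lemma first_coordinate: "m (\<epsilon> 1) u = fst u"
proof -
  have "fst u = fst (\<Sum>i=1..n. m (\<epsilon> i) u *\<^sub>R \<epsilon> i)" using expansion[of u] by simp
  also have "\<dots> = (\<Sum>i=1..n. m (\<epsilon> i) u * fst (\<epsilon> i))" by (simp add: fst_sum)
  also have "\<dots> = m (\<epsilon> 1) u * fst (\<epsilon> 1) + (\<Sum>i=2..n. m (\<epsilon> i) u * fst (\<epsilon> i))" by (rule sum_split_first)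
  also have "(\<Sum>i=2..n. m (\<epsilon> i) u * fst (\<epsilon> i)) = 0" by (rule sum.neutral) (simp add: fst_others)
  finally show ?thesis by (simp add: fst_first)
qed

lemma grad_first: "grad m = \<epsilon> 1"
  by (rule inner_product_eqI[OF m]) (simp add: grad[OF m] first_coordinate)

lemma parseval: "(\<Sum>i=1..n. m (\<epsilon> i) u * m (\<epsilon> i) v) = m u v"
proof -
  have lin: "linear (\<lambda>u. m u v)" using inner_product_bilinear[OF m] by (simp add: bilinear_def)
  have "m u v = m (\<Sum>i=1..n. m (\<epsilon> i) u *\<^sub>R \<epsilon> i) v" using expansion[of u] by simp
  also have "\<dots> = (\<Sum>i=1..n. m (\<epsilon> i) u * m (\<epsilon> i) v)" by (simp add: linear_sum[OF lin] m_simps)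
  finally show ?thesis by simp
qed

lemma parseval_others: "(\<Sum>i=2..n. m (\<epsilon> i) u * m (\<epsilon> i) v) = m u v - fst u * fst v"
  using parseval[of u v] unfolding sum_split_first by (simp add: first_coordinate)

lemma automorphismI:
  assumes lin: "linear O'" and iso: "\<And>u v. m' (O' u) (O' v) = r * m u v" and r: "r > 0" and m': "inner_product m'"
    and fst: "\<And>u. fst (O' u) = fst u"
  shows "automorphism O'"
proof -
  have "inj O'"
  proof (rule injI)
    fix u v assume "O' u = O' v"
    then have "O' (u - v) = 0" by (simp add: linear_diff[OF lin])
    then have "r * m (u - v) (u - v) = 0" using iso[of "u - v" "u - v"] by (simp add: inner_product_simps[OF m'])
    then have "\<not> m (u - v) (u - v) > 0" using r by simp
    then have "u - v = 0" using m unfolding inner_product_def by blast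
    then show "u = v" by simp
  qed
  then have "bij O'" using linear_injective_imp_surjective[OF lin] by (simp add: bij_def)
  then show ?thesis using lin fst by (simp add: automorphism_def)
qed

text \<open>Every inner product is, up to scale, the image of \<open>m\<close> under an automorphism, and scale and
  automorphism can be chosen continuously: orthonormalize \<open>\<epsilon> 2, \<dots>, \<epsilon> n\<close>, which span the kernel of
  \<open>fst\<close>, and project \<open>\<epsilon> 1\<close> onto the orthogonal complement of that kernel. The square
  length of this projection, not \<open>1\<close>, is the scale, because automorphisms preserve \<open>fst\<close>.\<close>

lemma continuous_normalization:
  fixes h :: "'x::topological_space \<Rightarrow> 'v rh \<Rightarrow> 'v rh \<Rightarrow> real"
  assumes h: "\<And>x. x \<in> S \<Longrightarrow> inner_product (h x)" and cont: "\<And>u v. continuous_on S (\<lambda>x. h x u v)"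
  shows "\<exists>r T. continuous_on S r \<and> (\<forall>u. continuous_on S (\<lambda>x. T x u)) \<and>
    (\<forall>x\<in>S. r x > 0 \<and> automorphism (T x) \<and> (\<forall>u v. h x (T x u) (T x v) = r x * m u v))"
proof -
  have inj: "inj_on \<epsilon> {2..n}"
  proof (rule inj_onI)
    fix i j assume ij: "i \<in> {2..n}" "j \<in> {2..n}" "\<epsilon> i = \<epsilon> j"
    then have "m (\<epsilon> i) (\<epsilon> j) = 1" "m (\<epsilon> i) (\<epsilon> j) = (if i = j then 1 else 0)"
      using orthonormal[of i i] orthonormal[of i j] by auto
    then show "i = j" by (simp split: if_splits)
  qed
  have ind: "independent (\<epsilon> ` {2..n})"
  proof (rule independent_if_scalars_zero)
    fix f v assume 0: "(\<Sum>v\<in>\<epsilon> ` {2..n}. f v *\<^sub>R v) = 0" and v: "v \<in> \<epsilon> ` {2..n}"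
    then obtain i where i: "i \<in> {2..n}" "v = \<epsilon> i" by blast
    have "0 = m (\<epsilon> i) (\<Sum>j=2..n. f (\<epsilon> j) *\<^sub>R \<epsilon> j)"
      using 0 by (simp add: sum.reindex[OF inj] m_simps)
    also have "\<dots> = (\<Sum>j=2..n. f (\<epsilon> j) * m (\<epsilon> i) (\<epsilon> j))"
      by (simp add: linear_sum[OF inner_product_linear[OF m]] m_simps)
    also have "\<dots> = (\<Sum>j=2..n. if j = i then f v else 0)"
      by (rule sum.cong) (use i orthonormal in auto)
    finally show "f v = 0" using i by simp
  qed simp
  obtain q where "\<forall>i\<in>{2..n}. continuous_on S (q i) \<and>
    (\<forall>x\<in>S. q i x \<in> span (\<epsilon> ` {2..n}) \<and> (\<forall>j\<in>{2..n}. h x (q i x) (q j x) = (if i = j then 1 else 0)))"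
    using continuous_gram_schmidt[where S=S, OF h cont _ inj ind] by auto
  then have q: "\<And>i. i \<in> {2..n} \<Longrightarrow> continuous_on S (q i)"
    and span: "\<And>i x. i \<in> {2..n} \<Longrightarrow> x \<in> S \<Longrightarrow> q i x \<in> span (\<epsilon> ` {2..n})"
    and on: "\<And>i j x. i \<in> {2..n} \<Longrightarrow> j \<in> {2..n} \<Longrightarrow> x \<in> S \<Longrightarrow> h x (q i x) (q j x) = (if i = j then 1 else 0)"
    by blast+
  have bil: "bilinear (h x)" if "x \<in> S" for x using h[OF that] by (rule inner_product_bilinear)
  have "span (\<epsilon> ` {2..n}) \<subseteq> {u. fst u = 0}"
    by (rule span_minimal) (auto simp: fst_others subspace_def)
  then have fst_q: "fst (q i x) = 0" if "i \<in> {2..n}" "x \<in> S" for i x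
    using span[OF that] by auto
  define u1 where "u1 x = \<epsilon> 1 - (\<Sum>i=2..n. h x (\<epsilon> 1) (q i x) *\<^sub>R q i x)" for x
  define r where "r x = h x (u1 x) (u1 x)" for x
  define t where "t i x = (if i = 1 then u1 x else sqrt (r x) *\<^sub>R q i x)" for i x
  define T where "T x u = (\<Sum>i=1..n. m (\<epsilon> i) u *\<^sub>R t i x)" for x u
  have cu1: "continuous_on S u1"
    unfolding u1_def by (intro continuous_intros continuous_on_bilinear_family[OF bil cont] q)
  have cr: "continuous_on S r"
    unfolding r_def by (intro continuous_on_bilinear_family[OF bil cont] cu1)
  have ct: "continuous_on S (t i)" if "i \<in> {1..n}" for i
  proof (cases "i = 1")
    case False
    then have "i \<in> {2..n}" using that by auto
    then have "continuous_on S (\<lambda>x. sqrt (r x) *\<^sub>R q i x)" by (intro continuous_intros cr q)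
    then show ?thesis using False by (simp add: t_def[abs_def])
  qed (simp add: t_def[abs_def] cu1)
  have cT: "continuous_on S (\<lambda>x. T x u)" for u
    unfolding T_def by (intro continuous_intros ct)
  have props: "r x > 0 \<and> automorphism (T x) \<and> (\<forall>u v. h x (T x u) (T x v) = r x * m u v)" if x: "x \<in> S" for x
  proof -
    note h_simps = inner_product_simps[OF h[OF x]]
    have lin1: "linear (\<lambda>u. h x u w)" and lin2: "linear (h x w)" for w using bil[OF x] by (auto simp: bilinear_def)
    have fst_u1: "fst (u1 x) = 1"
      unfolding u1_def by (simp add: fst_first fst_sum fst_q x)
    then have "u1 x \<noteq> 0" by auto
    then have r: "r x > 0" using h[OF x] by (simp add: r_def inner_product_def)
    have orth: "h x (u1 x) (q j x) = 0" if j: "j \<in> {2..n}" for j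
    proof -
      have "h x (u1 x) (q j x) = h x (\<epsilon> 1) (q j x) - (\<Sum>i=2..n. h x (\<epsilon> 1) (q i x) * h x (q i x) (q j x))"
        unfolding u1_def by (simp add: linear_diff[OF lin1] linear_sum[OF lin1] h_simps)
      also have "(\<Sum>i=2..n. h x (\<epsilon> 1) (q i x) * h x (q i x) (q j x)) = (\<Sum>i=2..n. if i = j then h x (\<epsilon> 1) (q j x) else 0)"
        by (rule sum.cong) (use j x in \<open>auto simp: on\<close>)
      finally show ?thesis using j by simp
    qed
    have tt: "h x (t i x) (t j x) = (if i = j then r x else 0)" if ij: "i \<in> {1..n}" "j \<in> {1..n}" for i j
    proof -
      have "i = 1 \<or> i \<in> {2..n}" "j = 1 \<or> j \<in> {2..n}" using ij by auto
      moreover have "sqrt (r x) * sqrt (r x) = r x" using r by simp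
      ultimately show ?thesis
        using orth inner_product_commute[OF h[OF x], of _ "u1 x"] on[OF _ _ x]
        by (auto simp: t_def h_simps r_def[symmetric])
    qed
    have iso: "h x (T x u) (T x v) = r x * m u v" for u v
    proof -
      have "h x (T x u) (T x v) = (\<Sum>i=1..n. m (\<epsilon> i) u * (\<Sum>j=1..n. m (\<epsilon> j) v * h x (t i x) (t j x)))"
      proof -
        have 1: "h x (T x u) w = (\<Sum>i=1..n. m (\<epsilon> i) u * h x (t i x) w)" for w
          unfolding T_def by (simp add: linear_sum[OF lin1] h_simps)
        have 2: "h x w (T x v) = (\<Sum>j=1..n. m (\<epsilon> j) v * h x w (t j x))" for w
          unfolding T_def by (simp add: linear_sum[OF lin2] h_simps)
        show ?thesis by (rule trans[OF 1[of "T x v"]]) (simp only: 2)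
      qed
      also have "\<dots> = (\<Sum>i=1..n. m (\<epsilon> i) u * (\<Sum>j=1..n. if j = i then m (\<epsilon> i) v * r x else 0))"
        by (intro sum.cong refl arg_cong2[where f="(*)"]) (simp add: tt)
      also have "\<dots> = (\<Sum>i=1..n. r x * (m (\<epsilon> i) u * m (\<epsilon> i) v))"
        by (rule sum.cong) simp_all
      also have "\<dots> = r x * m u v" by (simp add: sum_distrib_left[symmetric] parseval)
      finally show ?thesis .
    qed
    have "linear (T x)"
      unfolding T_def by (auto simp: linear_iff m_simps algebra_simps sum.distrib scaleR_sum_right)
    moreover have "fst (T x u) = fst u" for u
    proof -
      have "fst (T x u) = (\<Sum>i=1..n. m (\<epsilon> i) u * fst (t i x))" by (simp add: T_def fst_sum)
      also have "\<dots> = m (\<epsilon> 1) u + (\<Sum>i=2..n. m (\<epsilon> i) u * fst (t i x))"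
        by (simp add: sum_split_first t_def fst_u1)
      also have "(\<Sum>i=2..n. m (\<epsilon> i) u * fst (t i x)) = 0"
        by (rule sum.neutral) (auto simp: t_def fst_q x)
      finally show ?thesis by (simp add: first_coordinate)
    qed
    ultimately show ?thesis
      using automorphismI[OF _ iso r h[OF x]] r iso by blast
  qed
  show ?thesis using cr cT props by blast
qed

text \<open>A conformal automorphism maps \<open>grad m\<close>, which is \<open>\<epsilon> 1\<close>, to \<open>k *\<^sub>R grad m\<close>, while it preserves \<open>fst\<close>. So
  a stabilizer of \<open>m\<close> in the acting group involves no scaling.\<close>

lemma conformal_automorphism_isometric:
  assumes M: "automorphism M" and conf: "\<And>u v. m (M u) (M v) = k * m u v"
  shows "k = 1"
proof -
  have "M (\<epsilon> 1) = k *\<^sub>R \<epsilon> 1"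
  proof (rule inner_product_eqI[OF m])
    fix w
    have "m (M (\<epsilon> 1)) (M (inv M w)) = k * fst (inv M w)" by (simp add: conf first_coordinate)
    also have "fst (inv M w) = fst w"
      using automorphism_inv[OF M] by (simp add: automorphism_def)
    finally show "m (M (\<epsilon> 1)) w = m (k *\<^sub>R \<epsilon> 1) w"
      by (simp add: automorphism_inv_simps[OF M] m_simps first_coordinate)
  qed
  then have "fst (M (\<epsilon> 1)) = k" by (simp add: fst_first)
  then show ?thesis using M by (simp add: automorphism_def fst_first)
qed

definition isometry :: "('v rh \<Rightarrow> 'v rh) \<Rightarrow> bool" where
  "isometry M \<longleftrightarrow> automorphism M \<and> (\<forall>u v. m (M u) (M v) = m u v)"

text \<open>Since the isometries form a group, precomposition with them gives the same orbits as the action by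
  \<open>C(M\<^sup>-\<^sup>1 \<cdot>, M\<^sup>-\<^sup>1 \<cdot>, M\<^sup>-\<^sup>1 \<cdot>)\<close>.\<close>

definition isometry_orbit :: "('v rh) cubic_form \<Rightarrow> ('v rh) cubic_form set" where
  "isometry_orbit C = {cubic_form_of (transform_cubic 1 M (trilinear_of C)) | M. isometry M}"

lemma isometry_inv: "isometry M \<Longrightarrow> isometry (inv M)"
  unfolding isometry_def
  by (metis automorphism_inv automorphism_inv_simps(1))

lemma isometry_comp: "isometry M \<Longrightarrow> isometry N \<Longrightarrow> isometry (\<lambda>u. M (N u))"
  by (simp add: isometry_def automorphism_comp)

lemma isometry_ident: "isometry (\<lambda>u. u)"
  by (simp add: isometry_def automorphism_ident)

lemma isometry_orbit_eq_iff:
  "isometry_orbit (cubic_form_of c) = isometry_orbit (cubic_form_of c') \<longleftrightarrow>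
    (\<exists>M. isometry M \<and> c' = transform_cubic 1 M c)"
proof
  have "cubic_form_of c' \<in> isometry_orbit (cubic_form_of c')"
    unfolding isometry_orbit_def trilinear_of_cubic_form_of 
    by (intro CollectI exI[of _ "\<lambda>u. u"]) (simp add: transform_comp isometry_ident)
  moreover assume "isometry_orbit (cubic_form_of c) = isometry_orbit (cubic_form_of c')"
  ultimately obtain M where "isometry M" "cubic_form_of c' = cubic_form_of (transform_cubic 1 M c)"
    unfolding isometry_orbit_def trilinear_of_cubic_form_of by blast
  then show "\<exists>M. isometry M \<and> c' = transform_cubic 1 M c" by (metis trilinear_of_cubic_form_of)
next
  have sub: "isometry_orbit (cubic_form_of (transform_cubic 1 M c)) \<subseteq> isometry_orbit (cubic_form_of c)"
    if M: "isometry M" for M c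
    unfolding isometry_orbit_def trilinear_of_cubic_form_of transform_comp
    using isometry_comp[OF M] by auto
  assume "\<exists>M. isometry M \<and> c' = transform_cubic 1 M c"
  then obtain M where M: "isometry M" and c': "c' = transform_cubic 1 M c" by blast
  have "c = transform_cubic 1 (inv M) c'"
    using M by (simp add: c' transform_comp automorphism_inv_simps isometry_def)
  then show "isometry_orbit (cubic_form_of c) = isometry_orbit (cubic_form_of c')"
    using sub[OF M, of c] sub[OF isometry_inv[OF M], of c'] c' by auto
qed

lemma isometry_alpha_form:
  assumes "isometry M"
  shows "transform_cubic 1 M (alpha_form m a) = alpha_form m a"
  using assms by (simp add: isometry_def automorphism_def transform_cubic_def alpha_form_def fun_eq_iff)

subsection \<open>The block orthogonal group\<close>

lemma block_orthogonal_isometry: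
  assumes A: "A \<in> block_orthogonal n"
  defines "M \<equiv> \<lambda>u. \<Sum>i=1..n. (\<Sum>j=1..n. A i j * m (\<epsilon> j) u) *\<^sub>R \<epsilon> i"
  shows "isometry M"
proof -
  have A1: "A 1 1 = 1" "\<And>i. i \<in> {2..n} \<Longrightarrow> A 1 i = 0" "\<And>i. i \<in> {2..n} \<Longrightarrow> A i 1 = 0"
    and Ao: "\<And>i j. i \<in> {2..n} \<Longrightarrow> j \<in> {2..n} \<Longrightarrow> (\<Sum>k=2..n. A k i * A k j) = (if i = j then 1 else 0)"
    using A by (auto simp: block_orthogonal_def)
  have orth: "(\<Sum>k=1..n. A k i * A k j) = (if i = j then 1 else 0)" if ij: "i \<in> {1..n}" "j \<in> {1..n}" for i j
  proof -
    have "i = 1 \<or> i \<in> {2..n}" "j = 1 \<or> j \<in> {2..n}" using ij by auto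
    then show ?thesis
      unfolding sum_split_first using A1 Ao by (auto intro!: sum.neutral)
  qed
  have coord: "m (\<epsilon> k) (M u) = (\<Sum>j=1..n. A k j * m (\<epsilon> j) u)" if "k \<in> {1..n}" for k u
    unfolding M_def by (rule coordinate_of_sum[OF that])
  have iso: "m (M u) (M v) = m u v" for u v
  proof -
    have "m (M u) (M v) = (\<Sum>k=1..n. m (\<epsilon> k) (M u) * m (\<epsilon> k) (M v))" by (rule parseval[symmetric])
    also have "\<dots> = (\<Sum>k=1..n. (\<Sum>i=1..n. A k i * m (\<epsilon> i) u) * (\<Sum>j=1..n. A k j * m (\<epsilon> j) v))"
      by (rule sum.cong) (simp_all add: coord)
    also have "\<dots> = (\<Sum>k=1..n. \<Sum>i=1..n. \<Sum>j=1..n. m (\<epsilon> i) u * m (\<epsilon> j) v * (A k i * A k j))"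
      by (simp add: sum_product ac_simps)
    also have "\<dots> = (\<Sum>i=1..n. \<Sum>j=1..n. m (\<epsilon> i) u * m (\<epsilon> j) v * (\<Sum>k=1..n. A k i * A k j))"
      by (subst sum.swap, rule sum.cong[OF refl], subst sum.swap) (simp add: sum_distrib_left)
    also have "\<dots> = (\<Sum>i=1..n. \<Sum>j=1..n. if j = i then m (\<epsilon> i) u * m (\<epsilon> i) v else 0)"
      by (intro sum.cong refl) (simp add: orth)
    also have "\<dots> = m u v" by (simp add: parseval)
    finally show ?thesis .
  qed
  have lin: "linear M"
    unfolding M_def linear_iff
    by (simp add: m_simps algebra_simps sum.distrib scaleR_sum_right sum_distrib_left)
  have "fst (M u) = fst u" for u
  proof -
    have "fst (M u) = (\<Sum>j=1..n. A 1 j * m (\<epsilon> j) u)" using coord[of 1 u] n by (simp add: first_coordinate)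
    also have "\<dots> = A 1 1 * m (\<epsilon> 1) u + (\<Sum>j=2..n. A 1 j * m (\<epsilon> j) u)" by (rule sum_split_first)
    also have "(\<Sum>j=2..n. A 1 j * m (\<epsilon> j) u) = 0" by (rule sum.neutral) (simp add: A1)
    finally show ?thesis by (simp add: A1 first_coordinate)
  qed
  then have "automorphism M"
    using automorphismI[OF lin _ zero_less_one m] iso by simp
  then show ?thesis using iso by (simp add: isometry_def)
qed

text \<open>An isometry fixes \<open>\<epsilon> 1\<close>, which represents \<open>fst\<close>; this makes its matrix a block matrix.\<close>

lemma isometry_block_orthogonal:
  assumes M: "isometry M"
  defines "A \<equiv> \<lambda>i j. m (\<epsilon> i) (M (\<epsilon> j))"
  shows "A \<in> block_orthogonal n" "M u = (\<Sum>i=1..n. (\<Sum>j=1..n. A i j * m (\<epsilon> j) u) *\<^sub>R \<epsilon> i)"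
proof -
  have lin: "linear M" and fst: "\<And>u. fst (M u) = fst u" and iso: "\<And>u v. m (M u) (M v) = m u v"
    using M by (auto simp: isometry_def automorphism_def)
  have M1: "M (\<epsilon> 1) = \<epsilon> 1"
  proof (rule inner_product_eqI[OF m])
    fix w
    have "m (M (\<epsilon> 1)) (M (inv M w)) = fst (inv M w)" by (simp add: iso first_coordinate)
    also have "\<dots> = fst w"
      using isometry_inv[OF M] by (simp add: isometry_def automorphism_def)
    finally show "m (M (\<epsilon> 1)) w = m (\<epsilon> 1) w"
      using M by (simp add: isometry_def automorphism_inv_simps first_coordinate)
  qed
  have "(\<Sum>k=2..n. A k i * A k j) = (if i = j then 1 else 0)" if "i \<in> {2..n}" "j \<in> {2..n}" for i j
    using parseval_others[of "M (\<epsilon> i)" "M (\<epsilon> j)"] that orthonormal[of i j]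
    by (simp add: A_def iso fst fst_others)
  moreover have "A 1 1 = 1" "\<And>i. i \<in> {2..n} \<Longrightarrow> A 1 i = 0"
    by (simp_all add: A_def first_coordinate fst fst_first fst_others)
  moreover have "\<And>i. i \<in> {2..n} \<Longrightarrow> A i 1 = 0"
    using orthonormal[of _ 1] n by (auto simp: A_def M1)
  ultimately show "A \<in> block_orthogonal n" by (simp add: block_orthogonal_def)
  have "m (\<epsilon> i) (M u) = (\<Sum>j=1..n. A i j * m (\<epsilon> j) u)" for i
  proof -
    have "M u = M (\<Sum>j=1..n. m (\<epsilon> j) u *\<^sub>R \<epsilon> j)" using expansion[of u] by simp
    also have "\<dots> = (\<Sum>j=1..n. m (\<epsilon> j) u *\<^sub>R M (\<epsilon> j))"
      by (simp add: linear_sum[OF lin] linear_scale[OF lin])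
    finally show ?thesis
      by (simp add: A_def linear_sum[OF inner_product_linear[OF m]] m_simps mult.commute)
  qed
  then show "M u = (\<Sum>i=1..n. (\<Sum>j=1..n. A i j * m (\<epsilon> j) u) *\<^sub>R \<epsilon> i)"
    using expansion[of "M u"] by simp
qed

lemma act_cubic_left_inv:
  assumes M: "isometry M" and f: "\<And>u. f (left_inv u) = left_inv (M u)"
  shows "act_cubic rh_algebra f C = cubic_form_of (transform_cubic 1 (inv M) (trilinear_of C))"
proof -
  have inv: "inv_into rh_algebra f (left_inv u) = left_inv (inv M u)" for u
  proof (rule inv_into_f_eq)
    show "inj_on f rh_algebra"
      using M by (auto simp: inj_on_def rh_algebra_eq f isometry_def automorphism_def bij_def dest: injD)
    show "f (left_inv (inv M u)) = left_inv u"
      using M by (simp add: f isometry_def automorphism_inv_simps)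
  qed simp
  show ?thesis
  proof (intro ext)
    fix X Y Z
    show "act_cubic rh_algebra f C X Y Z = cubic_form_of (transform_cubic 1 (inv M) (trilinear_of C)) X Y Z"
    proof (cases "X \<in> rh_algebra \<and> Y \<in> rh_algebra \<and> Z \<in> rh_algebra")
      case True
      then obtain u v w where "X = left_inv u" "Y = left_inv v" "Z = left_inv w"
        unfolding rh_algebra_eq by blast
      then show ?thesis
        by (simp add: act_cubic_def transform_cubic_def trilinear_of_def inv)
    next
      case False
      then show ?thesis by (auto simp: act_cubic_def cubic_form_of_def)
    qed
  qed
qed

lemma block_orbit_eq:
  assumes e: "\<And>i. i \<in> {1..n} \<Longrightarrow> e i = left_inv (\<epsilon> i)"
    and x: "\<And>i u. i \<in> {1..n} \<Longrightarrow> x i (left_inv u) = m (\<epsilon> i) u"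
  shows "block_orbit rh_algebra n e x C = isometry_orbit C"
proof -
  have mm: "matrix_map n e x A (left_inv u) = left_inv (\<Sum>i=1..n. (\<Sum>j=1..n. A i j * m (\<epsilon> j) u) *\<^sub>R \<epsilon> i)"
    for A u
  proof
    fix p
    have "matrix_map n e x A (left_inv u) p = (\<Sum>i=1..n. (\<Sum>j=1..n. A i j * m (\<epsilon> j) u) *\<^sub>R left_inv (\<epsilon> i) p)"
      unfolding matrix_map_def
      by (intro sum.cong refl arg_cong2[where f="scaleR"]) (simp_all add: e x)
    then show "matrix_map n e x A (left_inv u) p = left_inv (\<Sum>i=1..n. (\<Sum>j=1..n. A i j * m (\<epsilon> j) u) *\<^sub>R \<epsilon> i) p"
      by (simp add: left_inv_def linear_sum[OF linear_frame] frame_linear_simps)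
  qed
  show ?thesis
  proof (intro set_eqI iffI)
    fix C' assume "C' \<in> block_orbit rh_algebra n e x C"
    then obtain A where A: "A \<in> block_orthogonal n" and C': "C' = act_cubic rh_algebra (matrix_map n e x A) C"
      by (auto simp: block_orbit_def)
    note M = block_orthogonal_isometry[OF A]
    show "C' \<in> isometry_orbit C"
      unfolding C' act_cubic_left_inv[OF M mm] isometry_orbit_def using isometry_inv[OF M] by blast
  next
    fix C' assume "C' \<in> isometry_orbit C"
    then obtain M where M: "isometry M" and C': "C' = cubic_form_of (transform_cubic 1 M (trilinear_of C))"
      by (auto simp: isometry_orbit_def)
    note iM = isometry_inv[OF M]
    have "matrix_map n e x (\<lambda>i j. m (\<epsilon> i) (inv M (\<epsilon> j))) (left_inv u) = left_inv (inv M u)" for u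
      unfolding mm by (simp add: isometry_block_orthogonal(2)[OF iM, of u])
    from act_cubic_left_inv[OF iM this]
    have "C' = act_cubic rh_algebra (matrix_map n e x (\<lambda>i j. m (\<epsilon> i) (inv M (\<epsilon> j)))) C"
      using M by (simp add: C' isometry_def automorphism_def inv_inv_eq)
    then show "C' \<in> block_orbit rh_algebra n e x C"
      using isometry_block_orthogonal(1)[OF iM] by (auto simp: block_orbit_def)
  qed
qed

end

section \<open>Symmetric products\<close>

lemma sym_prod_3:
  "sym_prod [a, b, c] [X, Y, Z] =
    (a X * b Y * c Z + a X * c Y * b Z + b X * a Y * c Z + b X * c Y * a Z + c X * a Y * b Z + c X * b Y * a Z) / 6"
proof -
  have s: "{..<3::nat} = insert 0 (insert 1 {2})" by auto
  have f: "finite {2::nat}" "finite (insert 1 {2::nat})" "1 \<notin> {2::nat}" "0 \<notin> insert 1 {2::nat}" by auto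
  have len: "length [a, b, c] = 3" by simp
  show ?thesis
    unfolding sym_prod_def len s sum_over_permutations_insert[OF f(2,4)] sum_over_permutations_insert[OF f(1,3)] permutes_sing
    by (simp add: transpose_def fact_numeral nth_Cons')
qed

text \<open>Of the 24 permutations, four give the same product: each is determined by the two positions that receive \<open>a\<close>.\<close>

lemma sym_prod_4:
  "sym_prod [a, a, b, b] [W, X, Y, Z] =
    (a W * a X * b Y * b Z + a W * b X * a Y * b Z + a W * b X * b Y * a Z +
     b W * a X * a Y * b Z + b W * a X * b Y * a Z + b W * b X * a Y * a Z) / 6"
proof -
  have s: "{..<4::nat} = insert 0 (insert 1 (insert 2 {3}))" by auto
  have f: "finite {3::nat}" "finite (insert 2 {3::nat})" "finite (insert 1 (insert 2 {3::nat}))"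
    "2 \<notin> {3::nat}" "1 \<notin> insert 2 {3::nat}" "0 \<notin> insert 1 (insert 2 {3::nat})" by auto
  have len: "length [a, a, b, b] = 4" by simp
  show ?thesis
    unfolding sym_prod_def len s sum_over_permutations_insert[OF f(3,6)] sum_over_permutations_insert[OF f(2,5)]
      sum_over_permutations_insert[OF f(1,4)] permutes_sing
    by (simp add: transpose_def fact_numeral nth_Cons')
qed

lemma sum_below_diagonal:
  fixes F :: "nat \<Rightarrow> nat \<Rightarrow> real"
  assumes sym: "\<And>i j. F i j = F j i" and diag: "\<And>i. F i i = 0"
  shows "(\<Sum>i=1..n. \<Sum>j=1..n. F i j) = 2 * (\<Sum>j=1..n. \<Sum>i\<in>{1..<j}. F i j)"
proof (induction n)
  case (Suc n)
  have "{1..<Suc n} = {1..n}" by auto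
  then show ?case
    using Suc sym[of "Suc n"] by (simp add: sum.distrib diag)
qed simp

section \<open>The forms and tensors of the theorem in an adapted frame\<close>

locale hyperbolic_frame = adapted_frame n \<epsilon> m
  for n :: nat and \<epsilon> :: "nat \<Rightarrow> 'v::euclidean_space rh" and m +
  fixes e :: "nat \<Rightarrow> 'v rh \<Rightarrow> 'v rh" and x :: "nat \<Rightarrow> ('v rh \<Rightarrow> 'v rh) \<Rightarrow> real"
  assumes e: "i \<in> {1..n} \<Longrightarrow> e i = left_inv (\<epsilon> i)"
    and x: "i \<in> {1..n} \<Longrightarrow> x i (left_inv u) = m (\<epsilon> i) u"
    and x_outside: "i \<in> {1..n} \<Longrightarrow> X \<notin> rh_algebra \<Longrightarrow> x i X = 0"
begin

lemma x_first: "x 1 (left_inv u) = fst u"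
  using x[of 1 u] n by (simp add: first_coordinate)

lemma sum_x: "(\<Sum>i=1..n. x i (left_inv u) * x i (left_inv v)) = m u v"
  by (rule trans[OF _ parseval], rule sum.cong) (simp_all add: x)

lemma sum_x_others: "(\<Sum>i=2..n. x i (left_inv u) * x i (left_inv v)) = m u v - fst u * fst v"
  unfolding parseval_others[symmetric] by (rule sum.cong) (simp_all add: x)

lemma fst_grad: "fst (grad m) = 1"
  by (simp add: grad_first fst_first)

lemma cubic_alpha_eq: "cubic_alpha n x a = cubic_form_of (alpha_form m a)"
proof (intro ext)
  fix X Y Z
  show "cubic_alpha n x a X Y Z = cubic_form_of (alpha_form m a) X Y Z"
  proof (cases "X \<in> rh_algebra \<and> Y \<in> rh_algebra \<and> Z \<in> rh_algebra")
    case True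
    then obtain u v w where XYZ: "X = left_inv u" "Y = left_inv v" "Z = left_inv w"
      unfolding rh_algebra_eq by blast
    have first: "sym_prod [x 1, x 1, x 1] [X, Y, Z] = fst u * fst v * fst w"
      by (simp add: sym_prod_3 XYZ x_first)
    have "6 * (\<Sum>i=2..n. sym_prod [x 1, x i, x i] [X, Y, Z]) =
      2 * (fst u * (\<Sum>i=2..n. x i Y * x i Z) + fst v * (\<Sum>i=2..n. x i X * x i Z) + fst w * (\<Sum>i=2..n. x i X * x i Y))"
      unfolding sum_distrib_left distrib_left sum.distrib[symmetric]
      by (intro sum.cong refl) (simp add: sym_prod_3 XYZ x_first)
    then have others: "6 * (\<Sum>i=2..n. sym_prod [x 1, x i, x i] [X, Y, Z]) =
      2 * (fst u * (m v w - fst v * fst w) + fst v * (m u w - fst u * fst w) + fst w * (m u v - fst u * fst v))"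
      by (simp only: XYZ sum_x_others)
    show ?thesis
      unfolding cubic_alpha_def first others
      by (simp add: XYZ alpha_form_def fst_grad algebra_simps)
  next
    case False
    then have z: "x i X * x j Y * x k Z = 0" if "i \<in> {1..n}" "j \<in> {1..n}" "k \<in> {1..n}" for i j k
      using x_outside that by auto
    have sp: "sym_prod [x i, x j, x k] [X, Y, Z] = 0" if "i \<in> {1..n}" "j \<in> {1..n}" "k \<in> {1..n}" for i j k
      unfolding sym_prod_3 by (simp only: z that) simp
    have in_range: "1 \<in> {1..n}" "\<And>i. i \<in> {2..n} \<Longrightarrow> i \<in> {1..n}" using n by auto
    then have "sym_prod [x 1, x 1, x 1] [X, Y, Z] = 0" by (intro sp)
    moreover have "(\<Sum>i=2..n. sym_prod [x 1, x i, x i] [X, Y, Z]) = 0"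
      using in_range by (intro sum.neutral ballI sp)
    ultimately show ?thesis
      using False by (auto simp: cubic_alpha_def cubic_form_of_def)
  qed
qed

lemma sym_prod_4_sum:
  "(\<Sum>i=2..n. \<Sum>j=2..n. sym_prod [x i, x i, x j, x j] [left_inv w, left_inv u, left_inv v, left_inv t]) =
   ((m w u - fst w * fst u) * (m v t - fst v * fst t) + (m w v - fst w * fst v) * (m u t - fst u * fst t) +
    (m w t - fst w * fst t) * (m u v - fst u * fst v)) / 3"
proof -
  define P where "P u v = (\<Sum>i=2..n. x i (left_inv u) * x i (left_inv v))" for u v
  have PP: "(\<Sum>i=2..n. \<Sum>j=2..n. (x i (left_inv a) * x i (left_inv b)) * (x j (left_inv c) * x j (left_inv d))) =
      P a b * P c d" for a b c d
    unfolding P_def by (simp add: sum_product)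
  have "(\<Sum>i=2..n. \<Sum>j=2..n. sym_prod [x i, x i, x j, x j] [left_inv w, left_inv u, left_inv v, left_inv t]) =
    (P w u * P v t + P w v * P u t + P w t * P u v + P u v * P w t + P u t * P w v + P v t * P w u) / 6"
    unfolding sym_prod_4 PP[symmetric] sum.distrib[symmetric] sum_divide_distrib
    by (intro sum.cong refl) (simp add: ac_simps)
  then show ?thesis
    unfolding P_def sum_x_others by (simp add: field_simps)
qed

lemma levi_civita_eq: "levi_civita (metric_of m) = conn (stat_mult m (alpha_form m 0))"
  unfolding levi_civita_metric_of[OF m] by (rule arg_cong[where f="\<lambda>c. conn (stat_mult m c)"])
    (simp add: alpha_form_def fun_eq_iff)

lemma cubic_connection_alpha:
  "cubic_connection (metric_of m) (left_cubic_tensor rh_mult (cubic_alpha n x a)) = conn (stat_mult m (alpha_form m a))"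
  unfolding cubic_alpha_eq left_cubic_tensor_cubic_form_of
  by (rule cubic_connection_tensor_of[OF m sym_trilinear_alpha_form[OF m]])

text \<open>The terms that contain \<open>fst\<close> of an argument cancel: what remains is the symmetrization of the product of
  the metric with itself on the kernel of \<open>fst\<close>.\<close>

lemma nabla_cubic_alpha:
  "nabla_cubic (levi_civita (metric_of m)) (left_cubic_tensor rh_mult (cubic_alpha n x a))
     (left_inv w) (left_inv u) (left_inv v) (left_inv t) p =
   - 6 * a * (\<Sum>i=2..n. \<Sum>j=2..n. sym_prod [x i, x i, x j, x j] [left_inv w, left_inv u, left_inv v, left_inv t])"
proof -
  have N: "stat_mult m (alpha_form m 0) w u = m w u *\<^sub>R \<epsilon> 1 - fst u *\<^sub>R w" for w u
    by (simp add: stat_mult_alpha_form[OF m] grad_first)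
  have com: "m b a = m a b" for a b by (rule inner_product_commute[OF m])
  show ?thesis
    unfolding sym_prod_4_sum nabla_cubic_def levi_civita_eq cubic_alpha_eq left_cubic_tensor_cubic_form_of conn_left_inv
    by (simp add: tensor_of_def N)
       (simp add: alpha_form_def fst_grad m_simps fst_first first_coordinate com[of _ "\<epsilon> 1"]
        com[of u w] com[of v w] com[of t w] algebra_simps)
qed

lemma curvature_alpha:
  "metric_of m p (curvature (conn (stat_mult m (alpha_form m a))) (left_inv u) (left_inv v) (left_inv w) p) (left_inv t p) =
   (1 - a\<^sup>2) * (m u w * m v t - m u t * m v w)"
  unfolding curvature_conn_left_inv curv_alpha_form[OF m] fst_grad
  by (simp add: metric_of_def m_simps)

lemma sum_wedge:
  "(\<Sum>j=1..n. \<Sum>i\<in>{1..<j}. wedge (x i) (x j) (left_inv u) (left_inv v) * wedge (x i) (x j) (left_inv w) (left_inv t)) =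
   m u w * m v t - m u t * m v w"
proof -
  let ?F = "\<lambda>i j. wedge (x i) (x j) (left_inv u) (left_inv v) * wedge (x i) (x j) (left_inv w) (left_inv t)"
  let ?x = "\<lambda>i u. x i (left_inv u)"
  have "2 * (\<Sum>j=1..n. \<Sum>i\<in>{1..<j}. ?F i j) = (\<Sum>i=1..n. \<Sum>j=1..n. ?F i j)"
    by (rule sum_below_diagonal[symmetric]) (simp_all add: wedge_def algebra_simps)
  also have "\<dots> = (\<Sum>i=1..n. \<Sum>j=1..n. (?x i u * ?x i w) * (?x j v * ?x j t)) - (\<Sum>i=1..n. \<Sum>j=1..n. (?x i u * ?x i t) * (?x j v * ?x j w))
     - (\<Sum>i=1..n. \<Sum>j=1..n. (?x i v * ?x i w) * (?x j u * ?x j t)) + (\<Sum>i=1..n. \<Sum>j=1..n. (?x i v * ?x i t) * (?x j u * ?x j w))"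
    unfolding sum.distrib[symmetric] sum_subtractf[symmetric]
    by (intro sum.cong refl) (simp add: wedge_def algebra_simps)
  also have "\<dots> = 2 * (m u w * m v t - m u t * m v w)"
    unfolding sum_product[symmetric] sum_x by (simp add: algebra_simps)
  finally show ?thesis by simp
qed

lemma forms_eq:
  assumes P: "\<And>c. sym_trilinear c \<Longrightarrow> P (metric_of m) (conn (stat_mult m c)) \<longleftrightarrow> c \<in> alpha_form m ` A"
  shows "{C \<in> symmetric_cubic_forms rh_algebra.
    P (metric_of m) (cubic_connection (metric_of m) (left_cubic_tensor rh_mult C))} = cubic_alpha n x ` A"
proof -
  have P': "P (metric_of m) (cubic_connection (metric_of m) (left_cubic_tensor rh_mult (cubic_form_of c))) \<longleftrightarrow>
      c \<in> alpha_form m ` A" if "sym_trilinear c" for c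
    unfolding left_cubic_tensor_cubic_form_of cubic_connection_tensor_of[OF m that] by (rule P[OF that])
  show ?thesis
  proof (intro equalityI subsetI)
    fix C assume "C \<in> {C \<in> symmetric_cubic_forms rh_algebra.
      P (metric_of m) (cubic_connection (metric_of m) (left_cubic_tensor rh_mult C))}"
    then obtain c where c: "sym_trilinear c" "C = cubic_form_of c"
      and PC: "P (metric_of m) (cubic_connection (metric_of m) (left_cubic_tensor rh_mult C))"
      unfolding symmetric_cubic_forms_eq by blast
    then have "c \<in> alpha_form m ` A" using P'[OF c(1)] by simp
    then show "C \<in> cubic_alpha n x ` A" unfolding c(2) cubic_alpha_eq by blast
  next
    fix C assume "C \<in> cubic_alpha n x ` A"
    then obtain a where a: "a \<in> A" "C = cubic_form_of (alpha_form m a)"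
      unfolding cubic_alpha_eq by blast
    note st = sym_trilinear_alpha_form[OF m, of a]
    show "C \<in> {C \<in> symmetric_cubic_forms rh_algebra.
      P (metric_of m) (cubic_connection (metric_of m) (left_cubic_tensor rh_mult C))}"
      using a P'[OF st] cubic_form_of_in[OF st] by simp
  qed
qed

lemma cs_forms_eq: "cs_forms rh_mult (metric_of m) = range (cubic_alpha n x)"
  unfolding cs_forms_def by (rule forms_eq[where P = conjugate_symmetric, OF conjugate_symmetric_conn[OF m]])

lemma df_forms_eq: "df_forms rh_mult (metric_of m) = cubic_alpha n x ` {1, -1}"
  unfolding df_forms_def by (rule forms_eq[where P = dually_flat, OF dually_flat_conn[OF m]])

section \<open>Moduli spaces\<close>

abbreviation stat_of :: "('v rh) cubic_form \<Rightarrow> ('v rh) metric \<times> ('v rh) connection" where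
  "stat_of C \<equiv> stat m (trilinear_of C)"

lemma at_unit_stat:
  assumes "inner_product h" "sym_trilinear c"
  shows "(\<lambda>(h, D). (metric_at_unit rh_mult h, cubic_at_unit rh_mult h D)) (stat h c) = (metric_form h, cubic_form_of c)"
  by (simp add: stat_def metric_at_unit_metric_of cubic_at_unit_conn[OF assms])

lemma topspace_statistical:
  "topspace (statistical_topology rh_mult) = {stat h c | h c. inner_product h \<and> sym_trilinear c}"
  by (simp add: statistical_topology_def topspace_pullback_topology left_invariant_statistical_structures_eq)

lemma continuous_stat_of:
  "continuous_map (subtopology euclidean (symmetric_cubic_forms rh_algebra)) (statistical_topology rh_mult) stat_of"
  unfolding statistical_topology_def
proof (rule continuous_map_pullback')
  let ?at = "\<lambda>(h, D). (metric_at_unit rh_mult h, cubic_at_unit rh_mult h D)"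
  have at: "?at (stat_of C) = (metric_form m, C)" if "C \<in> symmetric_cubic_forms rh_algebra" for C
    using at_unit_stat[OF m sym_trilinear_trilinear_of(1)[OF that]]
    by (simp add: sym_trilinear_trilinear_of(2)[OF that])
  have "continuous_on (symmetric_cubic_forms rh_algebra) (?at \<circ> stat_of)"
    by (rule continuous_on_eq[OF continuous_on_Pair[OF continuous_on_const continuous_on_id]]) (simp add: at)
  then show "continuous_map (subtopology euclidean (symmetric_cubic_forms rh_algebra)) euclidean (?at \<circ> stat_of)"
    by simp
  show "topspace (subtopology euclidean (symmetric_cubic_forms rh_algebra)) \<subseteq>
      stat_of -` left_invariant_statistical_structures rh_mult"
    using stat_left_invariant[OF m sym_trilinear_trilinear_of(1)] by auto
qed

text \<open>The normal form of the structure given by \<open>(h, c)\<close> is the cubic form that remains when \<open>h\<close> is moved to \<open>m\<close> by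
  some scaling and automorphism; the choice has to be continuous.\<close>

definition is_normal_form ::
    "(('v rh) metric \<times> ('v rh) connection \<Rightarrow> ('v rh) cubic_form) \<Rightarrow> bool" where
  "is_normal_form s \<longleftrightarrow>
    continuous_map (statistical_topology rh_mult) (subtopology euclidean (symmetric_cubic_forms rh_algebra)) s \<and>
    (\<forall>h c. inner_product h \<longrightarrow> sym_trilinear c \<longrightarrow>
      (\<exists>r T. r > 0 \<and> automorphism T \<and> (\<forall>u v. h (T u) (T v) = r * m u v) \<and>
        s (stat h c) = cubic_form_of (transform_cubic (1 / r) T c)))"

lemma is_normal_form_exists: "\<exists>s. is_normal_form s"
proof -
  let ?at = "\<lambda>(h, D). (metric_at_unit rh_mult h, cubic_at_unit rh_mult h D)"
  let ?L = "left_invariant_statistical_structures rh_mult :: (('v rh) metric \<times> ('v rh) connection) set"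
  define h' where "h' y u v = fst y (left_inv u) (left_inv v)"
    for y :: "(('v rh \<Rightarrow> 'v rh) \<Rightarrow> ('v rh \<Rightarrow> 'v rh) \<Rightarrow> real) \<times> ('v rh) cubic_form" and u v
  define c' where "c' y = trilinear_of (snd y)"
    for y :: "(('v rh \<Rightarrow> 'v rh) \<Rightarrow> ('v rh \<Rightarrow> 'v rh) \<Rightarrow> real) \<times> ('v rh) cubic_form"
  define S where "S = ?at ` ?L"
  have S: "S = {(metric_form h, cubic_form_of c) | h c. inner_product h \<and> sym_trilinear c}"
  proof (intro equalityI subsetI)
    fix y :: "(('v rh \<Rightarrow> 'v rh) \<Rightarrow> ('v rh \<Rightarrow> 'v rh) \<Rightarrow> real) \<times> ('v rh) cubic_form"
    assume "y \<in> S"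
    then obtain h c where hc: "inner_product h" "sym_trilinear c" and y: "y = ?at (stat h c)"
      unfolding S_def left_invariant_statistical_structures_eq by blast
    show "y \<in> {(metric_form h, cubic_form_of c) | h c. inner_product h \<and> sym_trilinear c}"
      unfolding y at_unit_stat[OF hc] using hc by blast
  next
    fix y :: "(('v rh \<Rightarrow> 'v rh) \<Rightarrow> ('v rh \<Rightarrow> 'v rh) \<Rightarrow> real) \<times> ('v rh) cubic_form"
    assume "y \<in> {(metric_form h, cubic_form_of c) | h c. inner_product h \<and> sym_trilinear c}"
    then obtain h c where hc: "inner_product h" "sym_trilinear c"
      and y: "y = (metric_form h, cubic_form_of c)" by blast
    have "y = ?at (stat h c)" unfolding y at_unit_stat[OF hc] ..
    then show "y \<in> S" unfolding S_def using stat_left_invariant[OF hc] by (rule image_eqI)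
  qed
  have hc [simp]: "h' (metric_form h, C) = h" "c' (M, cubic_form_of c) = c" for h c C M
    by (simp_all add: h'_def c'_def fun_eq_iff)
  have ip: "inner_product (h' y)" and st: "sym_trilinear (c' y)" if "y \<in> S" for y
    using that unfolding S by auto
  have ch: "continuous_on S (\<lambda>y. h' y u v)" for u v
    unfolding h'_def
    by (rule continuous_on_product_then_coordinatewise[OF continuous_on_product_then_coordinatewise[OF
          continuous_on_fst[OF continuous_on_id]]])
  have cc: "continuous_on S (\<lambda>y. c' y u v w)" for u v w
    unfolding c'_def trilinear_of_def
    by (rule continuous_on_product_then_coordinatewise[OF continuous_on_product_then_coordinatewise[OF
          continuous_on_product_then_coordinatewise[OF continuous_on_snd[OF continuous_on_id]]]])
  obtain r T where cr: "continuous_on S r" and cT: "\<And>u. continuous_on S (\<lambda>y. T y u)"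
    and rT: "\<And>y. y \<in> S \<Longrightarrow> r y > 0 \<and> automorphism (T y) \<and> (\<forall>u v. h' y (T y u) (T y v) = r y * m u v)"
    using continuous_normalization[of S h', OF ip ch] by blast
  define \<sigma> where "\<sigma> y = cubic_form_of (transform_cubic (1 / r y) (T y) (c' y))" for y
  have "continuous_on S (\<lambda>y. \<sigma> y X Y Z)" for X Y Z
  proof (cases "X \<in> rh_algebra \<and> Y \<in> rh_algebra \<and> Z \<in> rh_algebra")
    case True
    have "\<forall>y\<in>S. r y \<noteq> 0" using rT by force
    then have "continuous_on S (\<lambda>y. 1 / r y * c' y (T y (X 0)) (T y (Y 0)) (T y (Z 0)))"
      by (intro continuous_intros cr continuous_on_trilinear_family[OF st cc] cT)
    then show ?thesis using True by (simp add: \<sigma>_def cubic_form_of_def transform_cubic_def)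
  next
    case False
    then have "(\<lambda>y. \<sigma> y X Y Z) = (\<lambda>y. 0)" by (auto simp: \<sigma>_def cubic_form_of_def)
    then show ?thesis by (simp only: continuous_on_const)
  qed
  then have "continuous_on S \<sigma>"
    by (intro continuous_on_coordinatewise_then_product)
  moreover have "\<sigma> ` S \<subseteq> symmetric_cubic_forms rh_algebra"
    using rT st by (auto simp: \<sigma>_def automorphism_inj intro!: cubic_form_of_in sym_trilinear_transform)
  ultimately have "continuous_map (subtopology euclidean S) (subtopology euclidean (symmetric_cubic_forms rh_algebra)) \<sigma>"
    by (auto simp: continuous_map_in_subtopology)
  then have cont: "continuous_map (statistical_topology rh_mult)
      (subtopology euclidean (symmetric_cubic_forms rh_algebra)) (\<lambda>s. \<sigma> (?at s))"
    unfolding S_def statistical_topology_def by (rule continuous_map_pullback_image)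
  have "\<exists>\<rho> U. \<rho> > 0 \<and> automorphism U \<and> (\<forall>u v. h (U u) (U v) = \<rho> * m u v) \<and>
        \<sigma> (?at (stat h c)) = cubic_form_of (transform_cubic (1 / \<rho>) U c)"
    if h: "inner_product h" and c: "sym_trilinear c" for h c
  proof -
    let ?y = "(metric_form h, cubic_form_of c)"
    have "?y \<in> S" using h c unfolding S by blast
    then show ?thesis
      unfolding at_unit_stat[OF h c] using rT[of ?y]
      by (intro exI[of _ "r ?y"] exI[of _ "T ?y"]) (simp add: \<sigma>_def)
  qed
  then show ?thesis using cont unfolding is_normal_form_def by blast
qed

definition normal_form ::
    "('v rh) metric \<times> ('v rh) connection \<Rightarrow> ('v rh) cubic_form" where
  "normal_form = (SOME s. is_normal_form s)"

lemmas is_normal_form = someI_ex[OF is_normal_form_exists, folded normal_form_def, unfolded is_normal_form_def]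

lemma continuous_normal_form_map:
  "continuous_map (statistical_topology rh_mult) (subtopology euclidean (symmetric_cubic_forms rh_algebra)) normal_form"
  using is_normal_form by blast

lemma normal_form:
  assumes "inner_product h" "sym_trilinear c"
  obtains r T where "r > 0" "automorphism T" "m = transform_metric (1 / r) T h"
    "normal_form (stat h c) = cubic_form_of (transform_cubic (1 / r) T c)"
proof -
  obtain r T where "r > 0" "automorphism T" "\<And>u v. h (T u) (T v) = r * m u v"
    "normal_form (stat h c) = cubic_form_of (transform_cubic (1 / r) T c)"
    using is_normal_form assms by blast
  moreover from this have "m = transform_metric (1 / r) T h"
    by (simp add: transform_metric_def fun_eq_iff del: split_paired_All)
  ultimately show thesis using that by blast
qed

text \<open>Both structures may be replaced by their normal forms with inner product \<open>m\<close>. An element of the acting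
  group that relates these fixes \<open>m\<close>, so it is an isometry.\<close>

lemma orbit_eq_normal_form:
  assumes h: "inner_product h" and c: "sym_trilinear c"
    and h': "inner_product h'" and c': "sym_trilinear c'"
  shows "statistical_orbit rh_mult (stat h c) = statistical_orbit rh_mult (stat h' c') \<longleftrightarrow>
    isometry_orbit (normal_form (stat h c)) = isometry_orbit (normal_form (stat h' c'))"
proof -
  note orbit = statistical_orbit_eq_iff
  obtain r T where r: "r > 0" and T: "automorphism T" and mT: "m = transform_metric (1 / r) T h"
    and nf: "normal_form (stat h c) = cubic_form_of (transform_cubic (1 / r) T c)"
    using normal_form[OF h c] .
  obtain r' T' where r': "r' > 0" and T': "automorphism T'" and mT': "m = transform_metric (1 / r') T' h'"
    and nf': "normal_form (stat h' c') = cubic_form_of (transform_cubic (1 / r') T' c')"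
    using normal_form[OF h' c'] .
  let ?d = "transform_cubic (1 / r) T c" and ?d' = "transform_cubic (1 / r') T' c'"
  have d: "sym_trilinear ?d" and d': "sym_trilinear ?d'"
    using sym_trilinear_transform c c' T T' automorphism_inj by blast+
  have 1: "statistical_orbit rh_mult (stat h c) = statistical_orbit rh_mult (stat m ?d)"
    unfolding orbit[OF h c m d] using r T mT by (intro exI[of _ "1 / r"] exI[of _ T]) simp
  have 2: "statistical_orbit rh_mult (stat h' c') = statistical_orbit rh_mult (stat m ?d')"
    unfolding orbit[OF h' c' m d'] using r' T' mT' by (intro exI[of _ "1 / r'"] exI[of _ T']) simp
  have "(\<exists>k M. k > 0 \<and> automorphism M \<and> m = transform_metric k M m \<and> ?d' = transform_cubic k M ?d) \<longleftrightarrow>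
      (\<exists>M. isometry M \<and> ?d' = transform_cubic 1 M ?d)"
  proof
    assume "\<exists>k M. k > 0 \<and> automorphism M \<and> m = transform_metric k M m \<and> ?d' = transform_cubic k M ?d"
    then obtain k M where k: "k > 0" and M: "automorphism M" and mk: "m = transform_metric k M m"
      and dk: "?d' = transform_cubic k M ?d" by blast
    have mM: "m (M u) (M v) = 1 / k * m u v" for u v
      using fun_cong[OF fun_cong[OF mk, of u], of v] k by (simp add: transform_metric_def field_simps)
    have "1 / k = 1" by (rule conformal_automorphism_isometric[OF M mM])
    then have "k = 1" by simp
    then show "\<exists>M. isometry M \<and> ?d' = transform_cubic 1 M ?d"
      using M mM dk by (auto simp: isometry_def)
  next
    assume "\<exists>M. isometry M \<and> ?d' = transform_cubic 1 M ?d"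
    then obtain M where "isometry M" and dM: "?d' = transform_cubic 1 M ?d" by blast
    then have "automorphism M" "m = transform_metric 1 M m"
      by (simp_all add: isometry_def transform_metric_def fun_eq_iff del: split_paired_All)
    then show "\<exists>k M. k > 0 \<and> automorphism M \<and> m = transform_metric k M m \<and> ?d' = transform_cubic k M ?d"
      using dM zero_less_one by blast
  qed
  then show ?thesis
    unfolding 1 2 orbit[OF m d m d'] nf nf' isometry_orbit_eq_iff .
qed

lemma normal_form_stat_of:
  assumes "sym_trilinear c"
  shows "isometry_orbit (normal_form (stat m c)) = isometry_orbit (cubic_form_of c)"
proof -
  obtain r T where r: "r > 0" and T: "automorphism T" and mT: "m = transform_metric (1 / r) T m"
    and nf: "normal_form (stat m c) = cubic_form_of (transform_cubic (1 / r) T c)"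
    using normal_form[OF m assms] .
  have mM: "m (T u) (T v) = r * m u v" for u v
    using fun_cong[OF fun_cong[OF mT, of u], of v] r by (simp add: transform_metric_def field_simps)
  have "r = 1" by (rule conformal_automorphism_isometric[OF T mM])
  then show ?thesis
    unfolding nf using T mM by (subst eq_commute) (auto simp: isometry_orbit_eq_iff isometry_def)
qed

lemma moduli_stat_homeomorphic:
  "moduli_stat (rh_mult :: 'v rh \<Rightarrow> _) homeomorphic_space
    orbit_topology (subtopology euclidean (symmetric_cubic_forms rh_algebra)) (block_orbit rh_algebra n e x)"
proof -
  have block: "block_orbit rh_algebra n e x = isometry_orbit"
    by (rule ext) (rule block_orbit_eq[OF e x])
  show ?thesis
    unfolding moduli_stat_def block
  proof (rule orbit_topology_homeomorphic_normal_forms[OF quotient_map_orbit_topology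
        continuous_normal_form_map continuous_stat_of])
    fix C assume "C \<in> topspace (subtopology euclidean (symmetric_cubic_forms (rh_algebra :: ('v rh \<Rightarrow> _) set)))"
    then have C: "C \<in> symmetric_cubic_forms rh_algebra" by simp
    show "isometry_orbit (normal_form (stat_of C)) = isometry_orbit C"
      using normal_form_stat_of[OF sym_trilinear_trilinear_of(1)[OF C]] sym_trilinear_trilinear_of(2)[OF C]
      by simp
  next
    fix s s' :: "('v rh) metric \<times> ('v rh) connection"
    assume "s \<in> topspace (statistical_topology rh_mult)" "s' \<in> topspace (statistical_topology rh_mult)"
    then show "statistical_orbit rh_mult s = statistical_orbit rh_mult s' \<longleftrightarrow>
        isometry_orbit (normal_form s) = isometry_orbit (normal_form s')"
      unfolding topspace_statistical using orbit_eq_normal_form by blast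
  qed
qed

lemma isometry_orbit_alpha: "isometry_orbit (cubic_alpha n x a) = {cubic_alpha n x a}"
proof -
  have "{cubic_form_of (transform_cubic 1 M (alpha_form m a)) | M. isometry M} = {cubic_form_of (alpha_form m a)}"
  proof (intro equalityI subsetI)
    fix C assume "C \<in> {cubic_form_of (alpha_form m a)}"
    then show "C \<in> {cubic_form_of (transform_cubic 1 M (alpha_form m a)) | M. isometry M}"
      by (intro CollectI exI[of _ "\<lambda>u. u"]) (simp add: isometry_ident isometry_alpha_form)
  qed (auto simp: isometry_alpha_form)
  then show ?thesis
    by (simp add: isometry_orbit_def cubic_alpha_eq)
qed

text \<open>Isometries fix the forms of the family, so on a class of structures whose forms belong to
  the family the normal form itself is a complete invariant.\<close>

lemma moduli_of_alpha_forms_homeomorphic: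
  assumes P: "\<And>h c. inner_product h \<Longrightarrow> sym_trilinear c \<Longrightarrow> P (stat h c) \<longleftrightarrow> c \<in> alpha_form h ` A"
  shows "orbit_topology (subtopology (statistical_topology (rh_mult :: 'v rh \<Rightarrow> _)) (Collect P)) (statistical_orbit rh_mult)
    homeomorphic_space subtopology euclidean (cubic_alpha n x ` A)"
proof -
  let ?S = "subtopology euclidean (cubic_alpha n x ` A)"
  let ?T = "subtopology (statistical_topology rh_mult) (Collect P)"
  have nf_in: "normal_form (stat h c) \<in> cubic_alpha n x ` A"
    if h: "inner_product h" and c: "sym_trilinear c" and Pc: "P (stat h c)" for h c
  proof -
    obtain r T where r: "r > 0" and T: "automorphism T" and mT: "m = transform_metric (1 / r) T h"
      and nf: "normal_form (stat h c) = cubic_form_of (transform_cubic (1 / r) T c)"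
      using normal_form[OF h c] .
    obtain a where a: "a \<in> A" "c = alpha_form h a" using P[OF h c] Pc by auto
    have fT: "fst (T u) = fst u" for u using T by (simp add: automorphism_def)
    have hT: "h (T u) (T v) = r * m u v" for u v
      using fun_cong[OF fun_cong[OF mT, of u], of v] r by (simp add: transform_metric_def field_simps)
    have "T (grad m) = r *\<^sub>R grad h"
    proof (rule inner_product_eqI[OF h])
      fix w
      have "h (T (grad m)) (T (inv T w)) = r * fst (T (inv T w))" by (simp only: hT grad[OF m] fT)
      then show "h (T (grad m)) w = h (r *\<^sub>R grad h) w"
        by (simp add: automorphism_inv_simps[OF T] inner_product_simps[OF h] grad[OF h])
    qed
    then have "fst (grad m) = r * fst (grad h)" using fT[of "grad m"] by simp
    then have gh: "fst (grad h) = 1 / r" using r by (simp add: fst_grad field_simps)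
    have "transform_cubic (1 / r) T c = alpha_form m a"
      unfolding a transform_cubic_def alpha_form_def hT fT gh fst_grad
      using r by (simp add: fun_eq_iff field_simps del: split_paired_All)
    then show ?thesis using a(1) by (simp add: nf cubic_alpha_eq)
  qed
  have alpha_sym: "cubic_alpha n x a \<in> symmetric_cubic_forms rh_algebra" for a
    unfolding cubic_alpha_eq by (rule cubic_form_of_in[OF sym_trilinear_alpha_form[OF m]])
  show ?thesis
  proof (rule orbit_topology_homeomorphic_normal_forms[where S = ?S and q = id and s = normal_form and i = stat_of])
    show "quotient_map ?S ?S id"
      using homeomorphic_map_id[of ?S] by (simp add: homeomorphic_map_def id_def)
    have "continuous_map ?T (subtopology euclidean (symmetric_cubic_forms rh_algebra)) normal_form"
      by (rule continuous_map_from_subtopology[OF continuous_normal_form_map])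
    moreover have "normal_form ` topspace ?T \<subseteq> cubic_alpha n x ` A"
      using nf_in by (auto simp: topspace_statistical)
    ultimately show "continuous_map ?T ?S normal_form"
      by (auto simp: continuous_map_in_subtopology)
    have "continuous_map ?S (statistical_topology rh_mult) stat_of"
      using continuous_map_from_subtopology[OF continuous_stat_of, of "cubic_alpha n x ` A"] alpha_sym
      by (simp add: subtopology_subtopology Int_absorb1 image_subset_iff)
    moreover have "P (stat_of (cubic_alpha n x a))" if "a \<in> A" for a
      using that P[OF m sym_trilinear_alpha_form[OF m]] by (simp add: cubic_alpha_eq)
    ultimately show "continuous_map ?S ?T stat_of"
      by (auto simp: continuous_map_in_subtopology)
    fix C assume "C \<in> topspace ?S"
    then obtain a where a: "a \<in> A" "C = cubic_alpha n x a" by auto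
    have st: "sym_trilinear (alpha_form m a)" by (rule sym_trilinear_alpha_form[OF m])
    have "normal_form (stat m (alpha_form m a)) \<in> cubic_alpha n x ` A"
      using P[OF m st] a by (intro nf_in[OF m st]) simp
    then obtain b where b: "normal_form (stat m (alpha_form m a)) = cubic_alpha n x b" by auto
    have "{cubic_alpha n x b} = {cubic_alpha n x a}"
      using normal_form_stat_of[OF st] unfolding b cubic_alpha_eq[symmetric] isometry_orbit_alpha .
    then show "id (normal_form (stat_of C)) = id C"
      using b by (simp add: a cubic_alpha_eq)
  next
    fix s s' assume "s \<in> topspace ?T" "s' \<in> topspace ?T"
    then obtain h c h' c' where hc: "inner_product h" "sym_trilinear c" "s = stat h c" "P s"
      and hc': "inner_product h'" "sym_trilinear c'" "s' = stat h' c'" "P s'"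
      by (auto simp: topspace_statistical)
    obtain a a' where "normal_form s = cubic_alpha n x a" "normal_form s' = cubic_alpha n x a'"
      using nf_in[OF hc(1,2)] nf_in[OF hc'(1,2)] hc hc' by auto
    then show "statistical_orbit rh_mult s = statistical_orbit rh_mult s' \<longleftrightarrow> id (normal_form s) = id (normal_form s')"
      using orbit_eq_normal_form[OF hc(1,2) hc'(1,2)] by (simp add: hc(3) hc'(3) isometry_orbit_alpha)
  qed
qed

lemma alpha_line_homeomorphic:
  "subtopology euclidean (cubic_alpha n x ` A) homeomorphic_space subtopology euclidean A"
proof -
  define f where "f C = C (left_inv (\<epsilon> 1)) (left_inv (\<epsilon> 1)) (left_inv (\<epsilon> 1)) / 4" for C :: "('v rh) cubic_form"
  have f: "f (cubic_alpha n x a) = a" for a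
    using first_coordinate[of "\<epsilon> 1"] by (simp add: f_def cubic_alpha_eq alpha_form_def fst_grad fst_first)
  have "continuous_on S f" for S
    unfolding f_def
    by (intro continuous_intros continuous_on_product_then_coordinatewise[OF continuous_on_product_then_coordinatewise[OF
          continuous_on_product_then_coordinatewise[OF continuous_on_id]]]) simp
  moreover have "continuous_on A (cubic_alpha n x)"
    unfolding cubic_alpha_def
    by (intro continuous_on_coordinatewise_then_product continuous_intros)
  ultimately have "homeomorphic_maps (subtopology euclidean (cubic_alpha n x ` A)) (subtopology euclidean A) f (cubic_alpha n x)"
    by (auto simp: homeomorphic_maps_def continuous_map_in_subtopology f)
  then show ?thesis using homeomorphic_space_def by blast
qed

end

theorem theorem6p1:
  fixes n :: nat
    and e :: "nat \<Rightarrow> real \<times> 'v::euclidean_space \<Rightarrow> real \<times> 'v"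
    and x :: "nat \<Rightarrow> (real \<times> 'v \<Rightarrow> real \<times> 'v) \<Rightarrow> real"
    and g :: "(real \<times> 'v) metric"
  assumes "n \<ge> 2" and "DIM('v) = n - 1"
    and "lie_basis rh_algebra n e" and "rh_relations n e"
    and "dual_basis_of rh_algebra n e x"
    and "riemannian_metric g" and "\<And>a. pull_metric (rh_mult a) g = g"
    and "\<And>i j p. i \<in> {1..n} \<Longrightarrow> j \<in> {1..n} \<Longrightarrow> g p (e i p) (e j p) = (if i = j then 1 else 0)"
  shows
    "(\<forall>\<alpha>. \<forall>W\<in>rh_algebra. \<forall>X\<in>rh_algebra. \<forall>Y\<in>rh_algebra. \<forall>Z\<in>rh_algebra. \<forall>p.
        nabla_cubic (levi_civita g) (left_cubic_tensor rh_mult (cubic_alpha n x \<alpha>)) W X Y Z p =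
        - 6 * \<alpha> * (\<Sum>i=2..n. \<Sum>j=2..n. sym_prod [x i, x i, x j, x j] [W, X, Y, Z])) \<and>
     (\<forall>\<alpha>. \<forall>X\<in>rh_algebra. \<forall>Y\<in>rh_algebra. \<forall>Z\<in>rh_algebra. \<forall>W\<in>rh_algebra. \<forall>p.
        g p (curvature (cubic_connection g (left_cubic_tensor rh_mult (cubic_alpha n x \<alpha>))) X Y Z p) (W p) =
          (1 - \<alpha>\<^sup>2) * g p (curvature (levi_civita g) X Y Z p) (W p) \<and>
        (1 - \<alpha>\<^sup>2) * g p (curvature (levi_civita g) X Y Z p) (W p) =
          (1 - \<alpha>\<^sup>2) * (\<Sum>j=1..n. \<Sum>i\<in>{1..<j}. wedge (x i) (x j) X Y * wedge (x i) (x j) Z W)) \<and>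
     cs_forms rh_mult g = range (cubic_alpha n x) \<and>
     df_forms rh_mult g = {cubic_alpha n x 1, cubic_alpha n x (- 1)} \<and>
     moduli_stat (rh_mult :: real \<times> 'v \<Rightarrow> _) homeomorphic_space
       orbit_topology (subtopology euclidean (symmetric_cubic_forms rh_algebra)) (block_orbit rh_algebra n e x) \<and>
     moduli_stat_cs (rh_mult :: real \<times> 'v \<Rightarrow> _) homeomorphic_space
       subtopology euclidean (range (cubic_alpha n x)) \<and>
     subtopology euclidean (range (cubic_alpha n x)) homeomorphic_space (euclidean :: real topology) \<and>
     moduli_stat_df (rh_mult :: real \<times> 'v \<Rightarrow> _) homeomorphic_space
       subtopology euclidean (cubic_alpha n x ` {1, - 1}) \<and>
     subtopology euclidean (cubic_alpha n x ` {1, - 1}) homeomorphic_space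
       subtopology euclidean {1, - 1 :: real}"
proof -
  define m where "m = g 0"
  define \<epsilon> where "\<epsilon> i = e i 0" for i
  have m: "inner_product m" and g: "g = metric_of m"
    unfolding m_def using left_invariant_metric[OF assms(6,7)] by simp_all
  have e_in: "e i \<in> rh_algebra" if "i \<in> {1..n}" for i
    using assms(3) that by (simp add: lie_basis_def)
  have e: "e i = left_inv (\<epsilon> i)" if "i \<in> {1..n}" for i
    unfolding \<epsilon>_def by (rule rh_algebra_at_0[OF e_in[OF that], symmetric])
  have on: "m (\<epsilon> i) (\<epsilon> j) = (if i = j then 1 else 0)" if "i \<in> {1..n}" "j \<in> {1..n}" for i j
    unfolding m_def \<epsilon>_def by (rule assms(8)[OF that])
  have spanning: "\<exists>c. u = (\<Sum>i=1..n. c i *\<^sub>R \<epsilon> i)" for u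
  proof -
    obtain c where "left_inv u = (\<lambda>p. \<Sum>i=1..n. c i *\<^sub>R e i p)"
      using assms(3) unfolding lie_basis_def by (meson left_inv_in)
    from fun_cong[OF this, of 0] show ?thesis by (auto simp: \<epsilon>_def)
  qed
  have rel: "fst (\<epsilon> 1) *\<^sub>R \<epsilon> i - fst (\<epsilon> i) *\<^sub>R \<epsilon> 1 = \<epsilon> i" if i: "i \<in> {2..n}" for i
  proof -
    have "i \<in> {1..n}" "1 \<in> {1..n}" using i by auto
    then have "lie_bracket (left_inv (\<epsilon> 1)) (left_inv (\<epsilon> i)) = left_inv (\<epsilon> i)"
      using assms(4) i unfolding rh_relations_def by (metis e)
    then show ?thesis unfolding lie_bracket_left_inv by (simp add: br_def)
  qed
  have fst_first: "fst (\<epsilon> 1) = 1" and fst_others: "\<And>i. i \<in> {2..n} \<Longrightarrow> fst (\<epsilon> i) = 0"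
  proof -
    have *: "fst (\<epsilon> 1) = 1 \<and> fst (\<epsilon> i) = 0" if i: "i \<in> {2..n}" for i
    proof -
      have "i \<in> {1..n}" "1 \<in> {1..n}" "i \<noteq> 1" using i by auto
      then show ?thesis
        using arg_cong[OF rel[OF i], of "m (\<epsilon> i)"] arg_cong[OF rel[OF i], of "m (\<epsilon> 1)"]
          on[of i i] on[of i 1] on[of 1 i] on[of 1 1]
        by (simp add: inner_product_simps[OF m])
    qed
    show "fst (\<epsilon> 1) = 1" using *[of 2] assms(1) by auto
    show "\<And>i. i \<in> {2..n} \<Longrightarrow> fst (\<epsilon> i) = 0" using * by blast
  qed
  interpret adapted_frame n \<epsilon> m
    by unfold_locales (fact assms(1) m on spanning fst_first fst_others)+
  have lin: "linear_form_on rh_algebra (x i)" and dual: "\<And>j. j \<in> {1..n} \<Longrightarrow> x i (e j) = (if i = j then 1 else 0)"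
    if "i \<in> {1..n}" for i
    using assms(5) that by (auto simp: dual_basis_of_def)
  have x: "x i (left_inv u) = m (\<epsilon> i) u" if i: "i \<in> {1..n}" for i u
  proof -
    note l = linear_form_on_left_inv[OF lin[OF i]]
    have "x i (left_inv u) = x i (left_inv (\<Sum>j=1..n. m (\<epsilon> j) u *\<^sub>R \<epsilon> j))" using expansion[of u] by simp
    also have "\<dots> = (\<Sum>j=1..n. m (\<epsilon> j) u * x i (left_inv (\<epsilon> j)))"
      by (simp add: linear_sum[OF l] linear_scale[OF l])
    also have "\<dots> = (\<Sum>j=1..n. if j = i then m (\<epsilon> i) u else 0)"
      by (intro sum.cong refl) (use dual[OF i] e in auto)
    finally show ?thesis using i by simp
  qed
  have x_outside: "x i X = 0" if "i \<in> {1..n}" "X \<notin> rh_algebra" for i X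
    using lin[OF that(1)] that(2) by (simp add: linear_form_on_def)
  interpret hyperbolic_frame n \<epsilon> m e x
    by unfold_locales (fact e x x_outside)+
  have P_cs: "(case stat h c of (h, D) \<Rightarrow> conjugate_symmetric h D) \<longleftrightarrow> c \<in> alpha_form h ` UNIV"
    if "inner_product h" "sym_trilinear c" for h :: "'v rh \<Rightarrow> 'v rh \<Rightarrow> real" and c
    using conjugate_symmetric_conn[OF that] by (simp add: stat_def)
  have P_df: "(case stat h c of (h, D) \<Rightarrow> dually_flat h D) \<longleftrightarrow> c \<in> alpha_form h ` {1, -1}"
    if "inner_product h" "sym_trilinear c" for h :: "'v rh \<Rightarrow> 'v rh \<Rightarrow> real" and c
    using dually_flat_conn[OF that] by (simp add: stat_def)
  show ?thesis
  proof (intro conjI allI ballI)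
    fix \<alpha> p and W X Y Z :: "'v rh \<Rightarrow> 'v rh"
    assume "W \<in> rh_algebra" "X \<in> rh_algebra" "Y \<in> rh_algebra" "Z \<in> rh_algebra"
    then show "nabla_cubic (levi_civita g) (left_cubic_tensor rh_mult (cubic_alpha n x \<alpha>)) W X Y Z p =
        - 6 * \<alpha> * (\<Sum>i=2..n. \<Sum>j=2..n. sym_prod [x i, x i, x j, x j] [W, X, Y, Z])"
      unfolding rh_algebra_eq g using nabla_cubic_alpha by blast
  next
    fix \<alpha> p and X Y Z W :: "'v rh \<Rightarrow> 'v rh"
    assume "X \<in> rh_algebra" "Y \<in> rh_algebra" "Z \<in> rh_algebra" "W \<in> rh_algebra"
    then obtain u v w t where XYZW: "X = left_inv u" "Y = left_inv v" "Z = left_inv w" "W = left_inv t"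
      unfolding rh_algebra_eq by blast
    show "g p (curvature (cubic_connection g (left_cubic_tensor rh_mult (cubic_alpha n x \<alpha>))) X Y Z p) (W p) =
          (1 - \<alpha>\<^sup>2) * g p (curvature (levi_civita g) X Y Z p) (W p)"
      unfolding g XYZW cubic_connection_alpha levi_civita_eq curvature_alpha by simp
    show "(1 - \<alpha>\<^sup>2) * g p (curvature (levi_civita g) X Y Z p) (W p) =
          (1 - \<alpha>\<^sup>2) * (\<Sum>j=1..n. \<Sum>i\<in>{1..<j}. wedge (x i) (x j) X Y * wedge (x i) (x j) Z W)"
      unfolding g XYZW levi_civita_eq curvature_alpha sum_wedge by simp
  next
    show "cs_forms rh_mult g = range (cubic_alpha n x)" unfolding g by (rule cs_forms_eq)
    show "df_forms rh_mult g = {cubic_alpha n x 1, cubic_alpha n x (- 1)}" unfolding g df_forms_eq by simp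
    show "moduli_stat (rh_mult :: 'v rh \<Rightarrow> _) homeomorphic_space
       orbit_topology (subtopology euclidean (symmetric_cubic_forms rh_algebra)) (block_orbit rh_algebra n e x)"
      by (rule moduli_stat_homeomorphic)
    show "moduli_stat_cs (rh_mult :: 'v rh \<Rightarrow> _) homeomorphic_space subtopology euclidean (range (cubic_alpha n x))"
      unfolding moduli_stat_cs_def by (rule moduli_of_alpha_forms_homeomorphic[OF P_cs])
    show "subtopology euclidean (range (cubic_alpha n x)) homeomorphic_space (euclidean :: real topology)"
      using alpha_line_homeomorphic[of UNIV] by simp
    show "moduli_stat_df (rh_mult :: 'v rh \<Rightarrow> _) homeomorphic_space
       subtopology euclidean (cubic_alpha n x ` {1, - 1})"
      unfolding moduli_stat_df_def by (rule moduli_of_alpha_forms_homeomorphic[OF P_df])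
    show "subtopology euclidean (cubic_alpha n x ` {1, - 1}) homeomorphic_space subtopology euclidean {1, - 1 :: real}"
      by (rule alpha_line_homeomorphic)
  qed
qed

end
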